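(* Let $q=s^{-2}$, let $N\in\mathbb{N}$, let $u_1,\dots,u_N$ be pairwise distinct complex numbers, and let $f:\mathsf{Sign}_N^+\to\mathbb{R}$ be supported on signatures with distinct parts. Assume that the weights $\mathcal{W}^f(\omega;\mathbf z)$, $\omega\in\mathcal{P}_N$, are absolutely summable for $\mathbf z$ in some neighborhood of $\mathbf u=(u_1,\dots,u_N)$, with sum $Z^f(\mathbf z)$, and that $\mathcal{W}^f(\omega;\mathbf u)\ge0$ for every $\omega\in\mathcal{P}_N$ and $Z^f(\mathbf u)>0$. Let $\mathbb{P}^f(\omega)=\mathcal{W}^f(\omega;\mathbf u)/Z^f(\mathbf u)$ be the resulting probability measure on $\mathcal{P}_N$. Let $k\in\{1,\dots,N\}$ and $1\le m_1\le m_2\le\dots\le m_k\le N$ be integers with $m_i\ge i$ for every $i$. Then $$\mathbb{P}^f(A(\mathbf m))=\frac{\mathcal{W}^f(\mathbf m;\mathbf u)}{Z^f(\mathbf u)}=\frac{(D^1_{m_1}D^2_{m_2}\cdots D^k_{m_k}Z^f)(\mathbf u)}{Z^f(\mathbf u)}.$$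
   Context: $\mathsf{Sign}_m^+$ is the set of integer sequences $\lambda_1\ge\dots\ge\lambda_m\ge0$. The parameter $s$ is generic (in particular $s\ne0$, $s^2\neq1$, $su_j\neq1$) and $q=s^{-2}$. Path collections: let $D_N=\mathbb{Z}_{\ge0}\times\{1,\dots,N\}$. $\mathcal{P}_N$ is the set of collections $\omega$ of $N$ up-right lattice paths in $D_N$ such that a path enters each point $(0,m)$, $1\le m\le N$, through the horizontal arrow from $(-1,m)$, all paths exit through the top boundary, and no two paths share a horizontal or a vertical edge. $\omega(i,j)=(i_1,j_1;i_2,j_2)$ records the numbers of arrows at $(i,j)$ entering from below, entering from the left, leaving upwards, leaving to the right. $\lambda^k(\omega)=(\lambda_1^k\ge\dots\ge\lambda_k^k)$ is the ordered list of $x$-coordinates of the intersections of $\omega$ with the line $y=k+1/2$. Weights: for $g\in\mathbb{Z}_{\ge0}$: $w_u(g,0;g,0)=\frac{1-sq^gu}{1-su}$, $w_u(g+1,0;g,1)=\frac{(1-s^2q^g)u}{1-su}$, $w_u(g,1;g,1)=\frac{u-sq^g}{1-su}$, $w_u(g,1;g+1,0)=\frac{1-q^{g+1}}{1-su}$; all other weights are $0$. For $\mathbf z=(z_1,\dots,z_N)$, $\mathcal{W}^f(\omega;\mathbf z)=\prod_{i=0}^\infty\prod_{j=1}^N w_{z_j}(\omega(i,j))\cdot f(\lambda^N(\omega))$, and $Z^f(\mathbf z)=\sum_{\omega\in\mathcal{P}_N}\mathcal{W}^f(\omega;\mathbf z)$ wherever this series converges absolutely. Events: $\mathsf{Sign}^*_{m,r}$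 is the set of $\lambda\in\mathsf{Sign}_m^+$ with $\lambda_1>\lambda_2>\dots>\lambda_m$ and $\lambda_m=0,\lambda_{m-1}=1,\dots,\lambda_{m-r+1}=r-1$. Put $A(\mathbf m)=\{\omega\in\mathcal{P}_N:\lambda^{m_i}(\omega)\in\mathsf{Sign}^*_{m_i,i},\ i=1,\dots,k\}$ and $\mathcal{W}^f(\mathbf m;\mathbf z)=\sum_{\omega\in A(\mathbf m)}\mathcal{W}^f(\omega;\mathbf z)$. Operators: $\mathsf{F}_\lambda(u_1,\dots,u_m)$, $\lambda\in\mathsf{Sign}_m^+$, is the sum of $\prod_{i\ge0}\prod_{j=1}^m w_{u_j}(\omega(i,j))$ over all collections of $m$ up-right paths in $\mathbb{Z}_{\ge0}\times\{1,\dots,m\}$ starting with the horizontal edges $(-1,y)\to(0,y)$, $1\le y\le m$, and ending with the vertical edges $(\lambda_i,m)\to(\lambda_i,m+1)$ (vertical edges may be shared, horizontal ones may not). Let $F_k(u_1,\dots,u_k)=\mathsf{F}_{(k-1,k-2,\dots,0)}(u_1,\dots,u_k)$ (a symmetric rational function) and $F_k(S)=F_k(s,\dots,s)=s^{k(k-1)/2}\left(\frac{1-q}{1-s^2}\right)^{k(k+1)/2}$; for $I=\{i_1,\dots,i_k\}$, $F_k(u_I)=F_k(u_{i_1},\dots,u_{i_k})$. $T_{u_i,s}$ replaces the $i$-th variable by $s$. For $1\le k\le m$, $$D_m^k=\sum_{I\subset\{1,\dots,m\},\,|I|=k}\ \prod_{i\in I,\,j\in\{1,\dots,m\}\setminus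 I}\frac{u_j-qu_i}{u_j-u_i}\ \prod_{j\in\{1,\dots,m\}\setminus I}\left(\frac{u_j-s}{u_j-sq}\right)^k\ \frac{F_k(u_I)}{F_k(S)}\ \prod_{i\in I}T_{u_i,s};$$ it acts on functions of $N\ge m$ variables through the first $m$ variables. In products of operators, coefficients are treated as rational functions and removable singularities are filled in when variables are specialized to $s$. *)

theory Defs
  imports "HOL-Analysis.Analysis" "HOL-Library.Complex_Order"
begin

section \<open>Path collections\<close>

type_synonym vertex = "int \<times> int"
type_synonym edge = "vertex \<times> vertex"

definition up_right_step :: "vertex \<Rightarrow> vertex \<Rightarrow> bool" where
  "up_right_step a b \<longleftrightarrow>
     b = (fst a + 1, snd a) \<or> b = (fst a, snd a + 1)"

definition grid :: "nat \<Rightarrow> vertex set" where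
  "grid M = {0..} \<times> {1..int M}"

text \<open>An up-right path in \<open>grid M\<close>, listed together with the tail \<open>(-1, y)\<close> of its entering arrow
  and the head \<open>(x, M + 1)\<close> of the arrow by which it leaves through the top boundary.\<close>

definition up_right_path :: "nat \<Rightarrow> nat \<Rightarrow> vertex list \<Rightarrow> bool" where
  "up_right_path M y p \<longleftrightarrow>
     (\<exists>r x. p = (-1, int y) # r @ [(x, int M + 1)] \<and> r \<noteq> [] \<and>
        hd r = (0, int y) \<and> last r = (x, int M) \<and>
        set r \<subseteq> grid M \<and> successively up_right_step r)"

definition path_edges :: "vertex list \<Rightarrow> edge set" where
  "path_edges p = set (zip p (tl p))"

text \<open>Paths are indistinguishable: a collection is recorded by the number of paths that use each
  edge. In particular two paths that meet at a vertex without sharing an edge give one collection,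
  whether they are thought of as touching or as crossing.\<close>

type_synonym path_collection = "edge \<Rightarrow> nat"

definition path_collections :: "nat \<Rightarrow> path_collection set" where
  "path_collections M =
     {(\<lambda>e. card {y \<in> {1..M}. e \<in> path_edges (p y)}) | p. \<forall>y\<in>{1..M}. up_right_path M y (p y)}"

text \<open>The set \<open>\<P>\<^sub>N\<close>.\<close>

definition paths_P :: "nat \<Rightarrow> path_collection set" where
  "paths_P N = {\<omega> \<in> path_collections N. \<forall>e. \<omega> e \<le> 1}"

text \<open>Arrows at the vertex \<open>(i, j)\<close>: from below, from the left, upwards, to the right.\<close>

definition arrows :: "path_collection \<Rightarrow> int \<Rightarrow> int \<Rightarrow> nat \<times> nat \<times> nat \<times> nat" where
  "arrows \<omega> i j =
     (\<omega> ((i, j - 1), (i, j)), \<omega> ((i - 1, j), (i, j)),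
      \<omega> ((i, j), (i, j + 1)), \<omega> ((i, j), (i + 1, j)))"


section \<open>Signatures\<close>

text \<open>A signature \<open>\<lambda>\<^sub>1 \<ge> \<dots> \<ge> \<lambda>\<^sub>m \<ge> 0\<close> is the list \<open>[\<lambda>\<^sub>1, \<dots>, \<lambda>\<^sub>m]\<close>; thus \<open>\<lambda>\<^sub>i\<close> is \<open>\<lambda> ! (i - 1)\<close>.\<close>

definition Sign :: "nat \<Rightarrow> nat list set" where
  "Sign m = {l. length l = m \<and> sorted_wrt (\<ge>) l}"

text \<open>The entries prescribed below are \<open>\<lambda>\<^sub>m = 0, \<dots>, \<lambda>\<^bsub>m-r+1\<^esub> = r - 1\<close>.\<close>

definition Sign_star :: "nat \<Rightarrow> nat \<Rightarrow> nat list set" where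
  "Sign_star m r = {l \<in> Sign m. sorted_wrt (>) l \<and> (\<forall>t<r. l ! (m - 1 - t) = t)}"

text \<open>\<open>\<lambda>\<^sup>k(\<omega>)\<close>: the \<open>x\<close>-coordinates of the vertical edges crossing the line \<open>y = k + 1/2\<close>, listed with
  multiplicity in decreasing order.\<close>

definition row_signature :: "nat \<Rightarrow> path_collection \<Rightarrow> nat list" where
  "row_signature k \<omega> =
     (THE l. sorted_wrt (\<ge>) l \<and>
        (\<forall>x. count_list l x = \<omega> ((int x, int k), (int x, int k + 1))))"


section \<open>Weights\<close>

fun vertex_weight ::
    "complex \<Rightarrow> complex \<Rightarrow> complex \<Rightarrow> nat \<times> nat \<times> nat \<times> nat \<Rightarrow> complex" where
  "vertex_weight s q u (i1, j1, i2, j2) =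
     (if j1 = 0 \<and> j2 = 0 \<and> i2 = i1 then (1 - s * q ^ i1 * u) / (1 - s * u)
      else if j1 = 0 \<and> j2 = 1 \<and> i1 = i2 + 1 then (1 - s\<^sup>2 * q ^ i2) * u / (1 - s * u)
      else if j1 = 1 \<and> j2 = 1 \<and> i2 = i1 then (u - s * q ^ i1) / (1 - s * u)
      else if j1 = 1 \<and> j2 = 0 \<and> i2 = i1 + 1 then (1 - q ^ (i1 + 1)) / (1 - s * u)
      else 0)"

text \<open>Only finitely many factors of the infinite product differ from \<open>1\<close> when \<open>s * z j \<noteq> 1\<close>.
  Here and below a tuple \<open>(z\<^sub>1, \<dots>, z\<^sub>N)\<close> is a function on \<open>nat\<close> of which only the values on
  \<open>{1..N}\<close> are used.\<close>

definition collection_weight ::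
    "complex \<Rightarrow> complex \<Rightarrow> nat \<Rightarrow> (nat \<Rightarrow> complex) \<Rightarrow> path_collection \<Rightarrow> complex" where
  "collection_weight s q M z \<omega> =
     (\<Prod>i. \<Prod>j = 1..M. vertex_weight s q (z j) (arrows \<omega> (int i) (int j)))"

definition weight_f ::
    "complex \<Rightarrow> complex \<Rightarrow> nat \<Rightarrow> (nat list \<Rightarrow> real) \<Rightarrow> (nat \<Rightarrow> complex) \<Rightarrow> path_collection \<Rightarrow> complex"
  where
  "weight_f s q N f z \<omega> =
     collection_weight s q N z \<omega> * complex_of_real (f (row_signature N \<omega>))"

text \<open>The value of \<^const>\<open>infsum\<close> is \<open>0\<close> where the series does not converge absolutely.\<close>

definition partition_fun ::
    "complex \<Rightarrow> complex \<Rightarrow> nat \<Rightarrow> (nat list \<Rightarrow> real) \<Rightarrow> (nat \<Rightarrow> complex) \<Rightarrow> complex" where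
  "partition_fun s q N f z = (\<Sum>\<^sub>\<infinity>\<omega>\<in>paths_P N. weight_f s q N f z \<omega>)"

definition event_A :: "nat \<Rightarrow> nat \<Rightarrow> (nat \<Rightarrow> nat) \<Rightarrow> path_collection set" where
  "event_A N k m =
     {\<omega> \<in> paths_P N. \<forall>i\<in>{1..k}. row_signature (m i) \<omega> \<in> Sign_star (m i) i}"

definition event_weight ::
    "complex \<Rightarrow> complex \<Rightarrow> nat \<Rightarrow> (nat list \<Rightarrow> real) \<Rightarrow> nat \<Rightarrow> (nat \<Rightarrow> nat) \<Rightarrow> (nat \<Rightarrow> complex) \<Rightarrow> complex"
  where
  "event_weight s q N f k m z = (\<Sum>\<^sub>\<infinity>\<omega>\<in>event_A N k m. weight_f s q N f z \<omega>)"

text \<open>The measure \<open>\<P>\<^sup>f\<close>. The quotient is a nonnegative real under the assumptions on \<open>f\<close> and \<open>u\<close>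
  in force whenever it is used; \<^const>\<open>Re\<close> only adjusts the type.\<close>

definition prob_f ::
    "complex \<Rightarrow> complex \<Rightarrow> nat \<Rightarrow> (nat list \<Rightarrow> real) \<Rightarrow> (nat \<Rightarrow> complex) \<Rightarrow> path_collection measure"
  where
  "prob_f s q N f u =
     point_measure (paths_P N)
       (\<lambda>\<omega>. ennreal (Re (weight_f s q N f u \<omega> / partition_fun s q N f u)))"


section \<open>The difference operators\<close>

definition F_paths :: "nat \<Rightarrow> nat list \<Rightarrow> path_collection set" where
  "F_paths m l =
     {\<omega> \<in> path_collections m. (\<forall>i j. \<omega> ((i, j), (i + 1, j)) \<le> 1) \<and> row_signature m \<omega> = l}"

text \<open>The function \<open>F\<^sub>\<lambda>(v\<^sub>1, \<dots>, v\<^sub>m)\<close> for a signature \<open>\<lambda>\<close> of length \<open>m\<close>; the sum is finite because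
  the paths stay in the columns \<open>0, \<dots>, \<lambda>\<^sub>1\<close>.\<close>

definition F_fun ::
    "complex \<Rightarrow> complex \<Rightarrow> nat \<Rightarrow> nat list \<Rightarrow> (nat \<Rightarrow> complex) \<Rightarrow> complex" where
  "F_fun s q m l v = (\<Sum>\<omega>\<in>F_paths m l. collection_weight s q m v \<omega>)"

definition F_stair :: "complex \<Rightarrow> complex \<Rightarrow> nat \<Rightarrow> (nat \<Rightarrow> complex) \<Rightarrow> complex" where
  "F_stair s q k v = F_fun s q k (rev [0..<k]) v"

text \<open>The variables \<open>u\<^sub>I = (u\<^bsub>i\<^sub>1\<^esub>, \<dots>, u\<^bsub>i\<^sub>k\<^esub>)\<close> for \<open>I = {i\<^sub>1 < \<dots> < i\<^sub>k}\<close>.\<close>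

definition select_vars :: "nat set \<Rightarrow> (nat \<Rightarrow> complex) \<Rightarrow> nat \<Rightarrow> complex" where
  "select_vars I u = (\<lambda>j. u (sorted_list_of_set I ! (j - 1)))"

text \<open>The defining formula of \<open>D\<^sup>k\<^sub>m g\<close>; it is meaningful where \<open>u\<^sub>1, \<dots>, u\<^sub>m\<close> are pairwise distinct.
  Evaluating \<open>g\<close> at \<open>override_on u (\<lambda>_. s) I\<close> is the application of all \<open>T\<^bsub>u\<^sub>i,s\<^esub>\<close> with \<open>i \<in> I\<close>.\<close>

definition D_formula ::
    "complex \<Rightarrow> complex \<Rightarrow> nat \<Rightarrow> nat \<Rightarrow> ((nat \<Rightarrow> complex) \<Rightarrow> complex) \<Rightarrow> (nat \<Rightarrow> complex) \<Rightarrow> complex"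
  where
  "D_formula s q k m g u =
     (\<Sum>I | I \<subseteq> {1..m} \<and> card I = k.
        (\<Prod>i\<in>I. \<Prod>j\<in>{1..m} - I. (u j - q * u i) / (u j - u i)) *
        (\<Prod>j\<in>{1..m} - I. ((u j - s) / (u j - s * q)) ^ k) *
        (F_stair s q k (select_vars I u) / F_stair s q k (\<lambda>_. s)) *
        g (override_on u (\<lambda>_. s) I))"

text \<open>In a product of operators the inner function is evaluated at points with several variables
  equal to \<open>s\<close>, where single summands of \<^const>\<open>D_formula\<close> have a zero denominator \<open>u\<^sub>j - u\<^sub>i\<close>.
  The singularity is removable for the whole sum, and \<open>D_op\<close> fills it in by the limit along points
  with pairwise distinct \<open>u\<^sub>1, \<dots>, u\<^sub>m\<close>. The topology on \<open>nat \<Rightarrow> complex\<close> is the product topology.\<close>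

definition D_op ::
    "complex \<Rightarrow> complex \<Rightarrow> nat \<Rightarrow> nat \<Rightarrow> ((nat \<Rightarrow> complex) \<Rightarrow> complex) \<Rightarrow> (nat \<Rightarrow> complex) \<Rightarrow> complex"
  where
  "D_op s q k m g u =
     (if inj_on u {1..m} then D_formula s q k m g u
      else Lim (at u within {v. inj_on v {1..m}}) (D_formula s q k m g))"

text \<open>\<open>D\<^sup>1\<^bsub>m\<^sub>1\<^esub> (D\<^sup>2\<^bsub>m\<^sub>2\<^esub> (\<dots> (D\<^sup>k\<^bsub>m\<^sub>k\<^esub> g)))\<close>\<close>

definition D_product ::
    "complex \<Rightarrow> complex \<Rightarrow> nat \<Rightarrow> (nat \<Rightarrow> nat) \<Rightarrow> ((nat \<Rightarrow> complex) \<Rightarrow> complex) \<Rightarrow> (nat \<Rightarrow> complex) \<Rightarrow> complex"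
  where
  "D_product s q k m g = foldr (\<lambda>i. D_op s q i (m i)) [1..<k + 1] g"

end

theory Submission
  imports Defs "HOL-Combinatorics.Permutations"
begin

text \<open>Cut a collection at level \<open>m\<close>. Summing over the rows below the cut, \<open>Z\<^sup>f\<close> becomes a sum, over the
  part above it, of functions \<open>F\<^sub>\<lambda>(u\<^sub>1, \<dots>, u\<^sub>m)\<close> with coefficients that do not involve
  \<open>u\<^sub>1, \<dots>, u\<^sub>m\<close>; only \<open>\<lambda>\<close> with distinct parts occur. For such \<open>\<lambda>\<close> and \<open>q = s\<^sup>-\<^sup>2\<close> the coordinate Bethe
  ansatz writes \<open>F\<^sub>\<lambda>\<close> as a symmetrization. Hence \<open>F\<^sub>\<lambda>\<close> is symmetric, and splitting off the smallest
  \<open>k\<close> parts gives \<open>F\<^sub>\<lambda>\<close> as a sum over \<open>k\<close>-element sets \<open>I\<close>. On the other hand, setting \<open>u\<^sub>i = s\<close> for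
  \<open>i \<in> I\<close> freezes \<open>k\<close> rows: \<open>F\<^sub>\<lambda>\<close> then vanishes unless \<open>\<lambda>\<close> ends in \<open>k - 1, \<dots>, 0\<close>, and otherwise it is
  a multiple of a function of the remaining variables. Comparing the two, \<open>D\<^sup>k\<^sub>m F\<^sub>\<lambda>\<close> is \<open>F\<^sub>\<lambda>\<close> or \<open>0\<close>
  according to whether \<open>\<lambda>\<close> ends in \<open>k - 1, \<dots>, 0\<close>, so each operator inserts one of the conditions that
  define the event. Since \<open>m\<^sub>1 \<le> \<dots> \<le> m\<^sub>k\<close>, the conditions already inserted concern only the part above
  the cut. The series converge at the specialized points and depend continuously on them because only
  powers of \<open>(u - s) / (1 - s u)\<close> are unbounded along a row, and these are dominated by their values at a
  nearby point at which the series converges.\<close>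

subsection \<open>Finite sums, limits and point measures\<close>

text \<open>The obstacle is that the operators evaluate \<open>Z^f\<close> at points with several
  coordinates equal to \<open>s\<close>, possibly far from the neighbourhood of \<open>u\<close> in
  which convergence is assumed. In the coordinate \<open>hop u = (u - s) / (1 - s * u)\<close> the
  point \<open>s\<close> is the centre 0. A domain
  \<open>norm (hop (z j)) < norm (hop (w j))\<close> is therefore stable under these
  specializations, and every function that occurs in the product of operators is identified on one
  such domain with a restricted sum over configurations. The relation \<open>s * q = 1 / s\<close>
  has two effects. As \<open>1 - s^2 * q = 0\<close>, a vertical edge with two or more paths is
  never followed by one with at most one. And a horizontal path crosses an occupied column with the
  constant weight \<open>- 1 / s\<close>. This explains the operator: splitting off the
  \<open>k\<close> smallest parts moves the other parameters past \<open>k\<close> columns and gives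
  \<open>hop ^ k\<close>, while crossing \<open>k\<close> frozen columns gives
  \<open>(- 1 / s) ^ k\<close>; their quotient is
  \<open>((u - s) / (u - s * q)) ^ k\<close>.\<close>

lemma finite_bool_lists: "finite {xs :: bool list. length xs = n}"
  using finite_lists_length_eq[of "UNIV :: bool set" n] by simp

lemma sum_bool_lists_Suc:
  "(\<Sum>xs | length xs = Suc n. g xs)
     = (\<Sum>xs | length xs = n. g (False # xs)) + (\<Sum>xs | length xs = n. g (True # xs))"
  for g :: "bool list \<Rightarrow> complex"
proof -
  have eq: "{xs :: bool list. length xs = Suc n}
      = (Cons False) ` {xs. length xs = n} \<union> (Cons True) ` {xs. length xs = n}"
    by (auto simp: length_Suc_conv)
  show ?thesis
    unfolding eq
    by (subst sum.union_disjoint) (auto simp: finite_bool_lists sum.reindex)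
qed

text \<open>Exchanging the two summation variables shows that the sum is its own negative.\<close>

lemma antisymmetric_sum_zero:
  fixes T :: "'a \<Rightarrow> 'a \<Rightarrow> complex"
  assumes "finite K" and "\<And>j l. j \<in> K \<Longrightarrow> l \<in> K \<Longrightarrow> j \<noteq> l \<Longrightarrow> T j l + T l j = 0"
  shows "(\<Sum>j\<in>K. \<Sum>l\<in>K - {j}. T j l) = 0"
proof -
  have eq: "(\<Sum>l\<in>K - {j}. R j l) = (\<Sum>l\<in>K. if l = j then 0 else R j l)" if "j \<in> K"
    for j and R :: "'a \<Rightarrow> 'a \<Rightarrow> complex"
    using assms(1) by (intro sum.mono_neutral_cong_left) auto
  have "(\<Sum>j\<in>K. \<Sum>l\<in>K - {j}. T j l) = (\<Sum>j\<in>K. \<Sum>l\<in>K. if l = j then 0 else T j l)"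
    by (intro sum.cong eq) auto
  also have "\<dots> = (\<Sum>l\<in>K. \<Sum>j\<in>K. if l = j then 0 else T j l)" by (rule sum.swap)
  also have "\<dots> = (\<Sum>l\<in>K. \<Sum>j\<in>K. - (if j = l then 0 else T l j))"
    using assms(2) by (intro sum.cong) (auto simp: eq_neg_iff_add_eq_0)
  also have "\<dots> = - (\<Sum>l\<in>K. \<Sum>j\<in>K. if j = l then 0 else T l j)"
    by (simp add: sum_negf)
  also have "\<dots> = - (\<Sum>j\<in>K. \<Sum>l\<in>K - {j}. T j l)"
    by (intro arg_cong[where f = uminus] sum.cong eq[symmetric]) auto
  finally show ?thesis by simp
qed

lemma power_bound_step:
  fixes a b x y :: complex and C :: real
  assumes "1 \<le> C" "norm a \<le> C ^ i * norm b" "norm x \<le> C ^ j * norm y" "i + j \<le> n"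
  shows "norm (a * x) \<le> C ^ n * norm (b * y)"
proof -
  have "norm (a * x) \<le> (C ^ i * norm b) * (C ^ j * norm y)"
    unfolding norm_mult using assms(1-3) by (intro mult_mono) auto
  also have "\<dots> = C ^ (i + j) * norm (b * y)" by (simp add: norm_mult power_add)
  also have "\<dots> \<le> C ^ n * norm (b * y)"
    using assms(1,4) by (intro mult_right_mono power_increasing) auto
  finally show ?thesis .
qed

lemma count_list_distinct: "distinct xs \<Longrightarrow> count_list xs x = of_bool (x \<in> set xs)"
  by (induction xs) auto

lemma tendsto_fun:
  fixes g :: "'b \<Rightarrow> 'i \<Rightarrow> 'a::topological_space"
  assumes "\<And>i. ((\<lambda>e. g e i) \<longlongrightarrow> l i) F"
  shows "(g \<longlongrightarrow> l) F"
proof -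
  have "limitin (product_topology (\<lambda>i. euclidean) UNIV) g l F"
    unfolding limitin_componentwise using assms by simp
  then show ?thesis unfolding euclidean_product_topology by simp
qed

lemma tendsto_at_coordinate: "((\<lambda>z. z i) \<longlongrightarrow> z0 i) (at z0 within S)"
  for z0 :: "'i \<Rightarrow> 'a::topological_space"
  using continuous_on_product_coordinates[of i] unfolding continuous_on_def
  by (auto intro: tendsto_within_subset[OF _ subset_UNIV])

lemma tendsto_nhds_coordinate: "((\<lambda>z. z i) \<longlongrightarrow> z0 i) (nhds z0)"
  for z0 :: "'i \<Rightarrow> 'a::topological_space"
  using tendsto_at_coordinate[of i z0 UNIV] tendsto_at_iff_tendsto_nhds[of "\<lambda>z. z i" z0] by simp

lemma eventually_at_right_add_neq:
  fixes a b c d :: complex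
  assumes "c \<noteq> d"
  shows "\<forall>\<^sub>F e in at_right 0. a + of_real e * c \<noteq> b + of_real e * d"
proof (cases "a = b")
  case True
  have "\<forall>\<^sub>F e in at_right (0::real). 0 < e" by (simp add: eventually_at_right_less)
  then show ?thesis by eventually_elim (use True assms in simp)
next
  case False
  have "((\<lambda>e. (a + of_real e * c) - (b + of_real e * d)) \<longlongrightarrow> a - b) (at_right 0)"
    by (auto intro!: tendsto_eq_intros)
  then have "\<forall>\<^sub>F e in at_right 0. (a + of_real e * c) - (b + of_real e * d) \<noteq> 0"
    by (rule tendsto_imp_eventually_ne) (use False in simp)
  then show ?thesis by eventually_elim auto
qed

text \<open>This makes the filter in \<open>D_op\<close> nontrivial, so that convergence along it
  determines the value of \<open>Lim\<close>.\<close>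

lemma injective_points_limit:
  fixes z :: "nat \<Rightarrow> complex"
  assumes "\<not> inj_on z {1..m}"
  shows "at z within {v. inj_on v {1..m}} \<noteq> bot"
proof
  assume bot: "at z within {v. inj_on v {1..m}} = bot"
  \<comment> \<open>Coordinate \<open>j\<close> moves with speed \<open>j\<close>, so any two
    coordinates differ for all small \<open>e > 0\<close>.\<close>
  define g where "g e j = z j + of_real e * of_nat j" for e :: real and j
  have "((\<lambda>e. g e j) \<longlongrightarrow> z j) (at_right 0)" for j
    unfolding g_def by (auto intro!: tendsto_eq_intros)
  then have lim: "(g \<longlongrightarrow> z) (at_right 0)" by (rule tendsto_fun)
  have "\<forall>\<^sub>F e in at_right 0. \<forall>i\<in>{1..m}. \<forall>j\<in>{1..m}. i \<noteq> j \<longrightarrow> g e i \<noteq> g e j"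
  proof (intro eventually_ball_finite ballI finite_atLeastAtMost)
    fix i j
    show "\<forall>\<^sub>F e in at_right 0. i \<noteq> j \<longrightarrow> g e i \<noteq> g e j"
      using eventually_at_right_add_neq[of "of_nat i" "of_nat j" "z i" "z j"]
      by (cases "i = j") (simp_all add: g_def)
  qed
  then have inj: "\<forall>\<^sub>F e in at_right 0. inj_on (g e) {1..m}"
    by eventually_elim (auto simp: inj_on_def)
  then have "\<forall>\<^sub>F e in at_right 0. g e \<in> {v. inj_on v {1..m}} \<and> g e \<noteq> z"
    by eventually_elim (use assms in auto)
  then have "filterlim g (at z within {v. inj_on v {1..m}}) (at_right 0)"
    using lim by (simp add: filterlim_at)
  then have "filterlim g bot (at_right (0::real))" by (simp only: bot)
  then have "\<forall>\<^sub>F e in at_right (0::real). False"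
    by (rule eventually_compose_filterlim[rotated]) simp
  then show False by simp
qed

lemma has_sum_finite_sum:
  fixes g :: "'i \<Rightarrow> 'b \<Rightarrow> complex"
  assumes "finite I" "\<And>i. i \<in> I \<Longrightarrow> (g i has_sum S i) T"
  shows "((\<lambda>x. \<Sum>i\<in>I. g i x) has_sum (\<Sum>i\<in>I. S i)) T"
  using assms by (induction I rule: finite_induct) (auto intro!: has_sum_add has_sum_0)

lemma measure_point_measure_infsum:
  assumes "\<And>x. x \<in> A \<Longrightarrow> 0 \<le> p x" "(\<lambda>x. norm (p x)) summable_on A" "E \<subseteq> A"
  shows "measure (point_measure A (\<lambda>x. ennreal (p x))) E = (\<Sum>\<^sub>\<infinity>x\<in>E. p x)"
proof -
  have nn: "\<And>x. x \<in> E \<Longrightarrow> 0 \<le> p x" using assms by auto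
  have "(\<lambda>x. norm (p x)) summable_on E" using assms(2,3) summable_on_subset_banach by blast
  then have abs: "Infinite_Set_Sum.abs_summable_on p E" by (rule abs_summable_equivalent[THEN iffD1])
  have "emeasure (point_measure A (\<lambda>x. ennreal (p x))) E = (\<integral>\<^sup>+x. ennreal (p x) * indicator E x \<partial>count_space A)"
    unfolding point_measure_def using assms(3) by (subst emeasure_density) auto
  also have "\<dots> = (\<integral>\<^sup>+x. ennreal (p x) \<partial>count_space E)"
    using assms(3)
    by (auto simp: nn_integral_count_space_indicator intro!: nn_integral_cong split: split_indicator)
  also have "\<dots> = ennreal (infsetsum p E)"
    by (rule nn_integral_conv_infsetsum[OF abs nn])
  also have "infsetsum p E = (\<Sum>\<^sub>\<infinity>x\<in>E. p x)" by (rule infsetsum_infsum[OF abs])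
  finally show ?thesis using nn by (simp add: measure_def infsum_nonneg)
qed

lemma sorted_list_prefix:
  fixes R :: "nat set"
  assumes "finite R" "l \<le> card R"
  shows "(\<forall>t<l. sorted_list_of_set R ! t = t) \<longleftrightarrow> {..<l} \<subseteq> R"
proof
  assume *: "\<forall>t<l. sorted_list_of_set R ! t = t"
  show "{..<l} \<subseteq> R"
  proof
    fix t assume "t \<in> {..<l}"
    then have "t < length (sorted_list_of_set R)" "sorted_list_of_set R ! t = t" using * assms by auto
    then show "t \<in> R" using assms(1) by (metis nth_mem set_sorted_list_of_set)
  qed
next
  assume *: "{..<l} \<subseteq> R"
  have "sorted_list_of_set R = [0..<l] @ sorted_list_of_set (R - {..<l})"
    using assms(1) * by (intro sorted_distinct_set_unique) (auto simp: sorted_append)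
  then show "\<forall>t<l. sorted_list_of_set R ! t = t" by (simp add: nth_append)
qed

subsection \<open>Bethe sums and stacked rows\<close>

locale generic_spin =
  fixes s q :: complex
  assumes s_nonzero: "s \<noteq> 0" and s_square: "s\<^sup>2 \<noteq> 1" and q_eq: "q = 1 / s\<^sup>2"
begin

definition hop :: "complex \<Rightarrow> complex" where
  "hop u = (u - s) / (1 - s * u)"

definition emit :: "complex \<Rightarrow> complex" where
  "emit u = (1 - s\<^sup>2) * u / (1 - s * u)"

definition absorb :: "complex \<Rightarrow> complex" where
  "absorb u = (1 - q) / (1 - s * u)"

definition scat :: "complex \<Rightarrow> complex \<Rightarrow> complex" where
  "scat w z = (w - q * z) / (w - z)"

text \<open>Amplitude for exchanging the Bethe parameter \<open>z\<close> for the row parameter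
  \<open>v\<close>. For a single path that leaves the row in column \<open>y\<close> it comes from
  the geometric sum \<open>(hop v ^ y - hop z ^ y) / (hop v - hop z)\<close> over the columns in
  which the path enters the row from below.\<close>

definition kap :: "complex \<Rightarrow> complex \<Rightarrow> complex" where
  "kap z v = emit v * absorb v / (hop v - hop z)"

text \<open>The entries of the bool lists tell which vertical edges below and above the row are occupied,
  column by column; \<open>h\<close> is the horizontal edge entering from the left. With at most one path per edge
  and \<open>q = 1 / s\<^sup>2\<close> the vertex weights reduce to \<open>hop\<close>, \<open>emit\<close>, \<open>absorb\<close>, \<open>- 1 / s\<close> (two paths
  meeting) and \<open>- hop u / s\<close> (a path going straight up).\<close>

fun row_wt :: "complex \<Rightarrow> bool \<Rightarrow> bool list \<Rightarrow> bool list \<Rightarrow> complex" where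
  "row_wt u h (l # ls) (a # as) =
     (if h then
        (if l then (if a then - (1 / s) * row_wt u True ls as else 0)
         else (if a then absorb u * row_wt u False ls as else hop u * row_wt u True ls as))
      else
        (if l then (if a then - (1 / s) * hop u * row_wt u False ls as else emit u * row_wt u True ls as)
         else (if a then 0 else row_wt u False ls as)))"
| "row_wt u h [] [] = of_bool (\<not> h)"
| "row_wt u h _ _ = 0"

text \<open>Unrolled, this is the sum over all bijections \<open>\<sigma>\<close> from the positions of \<open>True\<close> in the list to
  \<open>K\<close> of \<open>\<Prod> hop (\<sigma> x) ^ x\<close> times the factors \<open>scat (\<sigma> y) (\<sigma> x)\<close>, \<open>x < y\<close>.\<close>

function (sequential) bethe :: "complex set \<Rightarrow> bool list \<Rightarrow> complex" where
  "bethe K [] = of_bool (K = {})"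
| "bethe K (False # bs) = (\<Prod>z\<in>K. hop z) * bethe K bs"
| "bethe K (True # bs) = (\<Sum>z\<in>K. (\<Prod>w\<in>K - {z}. scat w z * hop w) * bethe (K - {z}) bs)"
  by pat_completeness auto
termination by (relation "Wellfounded.measure (length \<circ> snd)") auto

text \<open>One row as an operator on functions of the configuration below it. With
  \<open>h = True\<close> it acts like a creation operator of the algebraic Bethe ansatz, which adds
  a parameter; with \<open>h = False\<close> like a diagonal operator, which reproduces a Bethe sum
  up to exchange terms.\<close>

definition row_sum :: "complex \<Rightarrow> bool \<Rightarrow> (bool list \<Rightarrow> complex) \<Rightarrow> bool list \<Rightarrow> complex" where
  "row_sum v h \<Psi> up = (\<Sum>low | length low = length up. \<Psi> low * row_wt v h low up)"

lemma row_sum_Nil: "row_sum v h \<Psi> [] = \<Psi> [] * of_bool (\<not> h)"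
proof -
  have "{low :: bool list. length low = length ([] :: bool list)} = {[]}" by auto
  then show ?thesis by (simp add: row_sum_def)
qed

lemma row_sum_Cons:
  "row_sum v True \<Psi> (True # up)
     = absorb v * row_sum v False (\<lambda>l. \<Psi> (False # l)) up - (1 / s) * row_sum v True (\<lambda>l. \<Psi> (True # l)) up"
  "row_sum v True \<Psi> (False # up) = hop v * row_sum v True (\<lambda>l. \<Psi> (False # l)) up"
  "row_sum v False \<Psi> (True # up) = - (1 / s) * hop v * row_sum v False (\<lambda>l. \<Psi> (True # l)) up"
  "row_sum v False \<Psi> (False # up)
     = row_sum v False (\<lambda>l. \<Psi> (False # l)) up + emit v * row_sum v True (\<lambda>l. \<Psi> (True # l)) up"
  unfolding row_sum_def length_Cons sum_bool_lists_Suc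
  by (simp_all add: sum_distrib_left sum_subtractf sum_negf ac_simps)

lemma row_sum_linear:
  "row_sum v h (\<lambda>l. c * \<Psi> l) up = c * row_sum v h \<Psi> up"
  "row_sum v h (\<lambda>l. \<Sum>z\<in>K. \<Phi> z l) up = (\<Sum>z\<in>K. row_sum v h (\<Phi> z) up)"
  unfolding row_sum_def
   apply (simp add: sum_distrib_left mult.assoc)
  apply (subst sum.swap)
  apply (simp add: sum_distrib_right)
  done

lemma row_sum_linear_combination:
  "row_sum v h (\<lambda>l. \<Sum>z\<in>K. c z * \<Phi> z l) up = (\<Sum>z\<in>K. c z * row_sum v h (\<Phi> z) up)"
  by (simp add: row_sum_linear)

section \<open>Scalar identities behind the Bethe ansatz\<close>

context
  fixes v z :: complex
  assumes vz: "s * v \<noteq> 1" "s * z \<noteq> 1" "v \<noteq> z"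
begin

lemma hop_diff: "hop v - hop z = (v - z) * (1 - s\<^sup>2) / ((1 - s * v) * (1 - s * z))"
  using vz by (simp add: hop_def divide_simps) (simp add: algebra_simps power2_eq_square)

lemma kap_eq: "kap z v = (1 - q) * v * (1 - s * z) / ((1 - s * v) * (v - z))"
  using vz s_square unfolding kap_def hop_diff emit_def absorb_def
  by (simp add: divide_simps) 

text \<open>Serves a row path that arrives at an occupied upper edge: it either turns up there or
  meets a path from below (the \<open>- 1 / s\<close>). Together the two cases give the factor of a
  Bethe sum in which \<open>z\<close> takes the current column and \<open>v\<close> moves
  on.\<close>

lemma kap_mult_hop: "hop z * kap z v - 1 / s = hop v * scat v z"
  using vz s_nonzero unfolding kap_eq hop_def scat_def unfolding q_eq
  by (simp add: divide_simps) (simp add: algebra_simps power2_eq_square)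

text \<open>The weight \<open>- hop v / s\<close> of a path going straight up splits into the part
  that keeps \<open>z\<close> and the part that exchanges it for \<open>v\<close>.\<close>

lemma scat_plus_kap: "scat z v + kap z v = - (1 / s) * hop v"
  using vz s_nonzero unfolding kap_eq hop_def scat_def unfolding q_eq
  by (simp add: divide_simps) (simp add: algebra_simps power2_eq_square)

text \<open>Clears the denominator of \<open>kap\<close>; this is the recursion of the geometric sum
  behind it when one more column is added.\<close>

lemma kap_hop_exchange: "hop z * kap z v + emit v * absorb v = kap z v * hop v"
proof -
  have "kap z v * (hop v - hop z) = emit v * absorb v"
    using vz s_square by (simp add: kap_def hop_diff)
  then show ?thesis by (simp add: algebra_simps)
qed

end

text \<open>By the identities above, the \<open>hop\<close> factors drop out of each bracket and
  leave \<open>scat y v * scat v x - q\<close>. What remains is a rational identity in three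
  parameters, which holds after clearing denominators.\<close>

lemma scat_exchange:
  assumes "s * v \<noteq> 1" "s * l \<noteq> 1" "s * j \<noteq> 1" "v \<noteq> l" "v \<noteq> j" "l \<noteq> j"
  shows "scat l j * (- (1 / s) * hop l * kap l v - kap j v * scat v l)
       + scat j l * (- (1 / s) * hop j * kap j v - kap l v * scat v j) = 0"
proof -
  have bracket: "- (1 / s) * hop x * kap x v - kap y v * scat v x = scat y v * scat v x - q"
    if "s * x \<noteq> 1" "s * y \<noteq> 1" "v \<noteq> x" "v \<noteq> y" for x y
  proof -
    have 1: "hop x * kap x v = hop v * scat v x + 1 / s"
      using kap_mult_hop[OF assms(1) that(1,3)] by (simp add: algebra_simps)
    have 2: "kap y v = - (1 / s) * hop v - scat y v"
      using scat_plus_kap[OF assms(1) that(2,4)] by (simp add: algebra_simps)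
    have "- (1 / s) * hop x * kap x v - kap y v * scat v x
        = - (1 / s) * (hop x * kap x v) - kap y v * scat v x" by simp
    also have "\<dots> = scat y v * scat v x - q"
      unfolding 1 2 unfolding q_eq using s_nonzero by (simp add: field_simps power2_eq_square)
    finally show ?thesis .
  qed
  have "scat l j * (scat j v * scat v l - q) + scat j l * (scat l v * scat v j - q) = 0"
    using assms(4-6) unfolding scat_def by (simp add: divide_simps) (simp add: algebra_simps)
  then show ?thesis
    using bracket[of l j] bracket[of j l] assms by simp
qed

text \<open>Distinguishes whether \<open>v\<close> or an element of \<open>K\<close> takes the
  current column; the two groups match the two kinds of terms in
  \<open>bethe_row_sum\<close>.\<close>

lemma bethe_insert_True:
  assumes "finite K" "v \<notin> K"
  shows "bethe (insert v K) (True # up)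
     = (\<Prod>w\<in>K. scat w v) * (\<Prod>w\<in>K. hop w) * bethe K up
     + (\<Sum>z\<in>K. scat v z * hop v * (\<Prod>w\<in>K - {z}. scat w z) * (\<Prod>w\<in>K - {z}. hop w)
          * bethe (insert v (K - {z})) up)"
proof -
  have "insert v K - {v} = K" using assms by auto
  moreover have "insert v K - {z} = insert v (K - {z})" if "z \<in> K" for z using that assms by auto
  ultimately show ?thesis
    using assms by (auto simp: prod.distrib ac_simps intro!: sum.cong)
qed

text \<open>The recursion strips off the first column. The terms that do not belong to a Bethe sum cancel
  in pairs by \<open>scat_exchange\<close>.\<close>

lemma bethe_row_sum:
  assumes "finite K" "v \<notin> K" "s * v \<noteq> 1" "\<And>z. z \<in> K \<Longrightarrow> s * z \<noteq> 1"
  shows "row_sum v True (bethe K) up = absorb v * bethe (insert v K) up"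
    and "row_sum v False (bethe K) up
       = (\<Prod>w\<in>K. scat w v) * bethe K up
       + (\<Sum>z\<in>K. kap z v * (\<Prod>w\<in>K - {z}. scat w z) * bethe (insert v (K - {z})) up)"
  using assms
\<comment> \<open>Both parts are proved together and for all \<open>K\<close>: a column may change
  the state of the horizontal edge and use up an element of \<open>K\<close>.\<close>
proof (induction up arbitrary: K)
  case Nil
  { case 1 show ?case by (simp add: row_sum_Nil) }
  { case 2 then show ?case by (simp add: row_sum_Nil) }
next
  case (Cons a up)
  define P where "P L = (\<Prod>z\<in>L. hop z)" for L
  define V where "V L = (\<Prod>w\<in>L. scat w v)" for L
  define Sg where "Sg L z = (\<Prod>w\<in>L - {z}. scat w z)" for L z
  define B where "B L = bethe (insert v L) up" for L
  have row_True: "row_sum v h (\<lambda>l. bethe K (True # l)) up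
      = (\<Sum>z\<in>K. Sg K z * P (K - {z}) * row_sum v h (bethe (K - {z})) up)" for h K
    unfolding Sg_def P_def bethe.simps prod.distrib by (rule row_sum_linear_combination)
  have row_False: "row_sum v h (\<lambda>l. bethe K (False # l)) up = P K * row_sum v h (bethe K) up" for h K
    unfolding P_def bethe.simps by (rule row_sum_linear)
  have IH1: "row_sum v True (bethe L) up = absorb v * B L"
    if "finite L" "v \<notin> L" "\<And>z. z \<in> L \<Longrightarrow> s * z \<noteq> 1" for L
    unfolding B_def using Cons.IH(1)[of L] that assms(3) by blast
  have IH2: "row_sum v False (bethe L) up = V L * bethe L up + (\<Sum>z\<in>L. kap z v * Sg L z * B (L - {z}))"
    if "finite L" "v \<notin> L" "\<And>z. z \<in> L \<Longrightarrow> s * z \<noteq> 1" for L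
    unfolding B_def V_def Sg_def using Cons.IH(2)[of L] that assms(3) by blast
  have ins_True: "bethe (insert v L) (True # up)
      = V L * P L * bethe L up + (\<Sum>z\<in>L. scat v z * hop v * Sg L z * P (L - {z}) * B (L - {z}))"
    if "finite L" "v \<notin> L" for L
    unfolding B_def V_def Sg_def P_def using that by (rule bethe_insert_True)
  have ins_False: "bethe (insert v L) (False # up) = hop v * P L * B L" if "finite L" "v \<notin> L" for L
    unfolding B_def P_def using that by simp
  have PK: "P K = hop z * P (K - {z})" "V K = scat z v * V (K - {z})" if "finite K" "z \<in> K" for z K
    using that by (simp_all add: P_def V_def prod.remove)
  have P_sum: "P L * (\<Sum>l\<in>L. X l) = (\<Sum>l\<in>L. hop l * P (L - {l}) * X l)" if "finite L" for L X
    unfolding sum_distrib_left by (intro sum.cong refl arg_cong2[where f = "(*)"] PK(1) that)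
  { case 1
    note K = 1
    have ne: "v \<noteq> z" if "z \<in> K" for z using that K by auto
    show ?case
    proof (cases a)
      case True
      have "row_sum v True (bethe K) (True # up)
          = absorb v * (P K * (V K * bethe K up + (\<Sum>z\<in>K. kap z v * Sg K z * B (K - {z}))))
            - (1 / s) * (\<Sum>z\<in>K. Sg K z * P (K - {z}) * (absorb v * B (K - {z})))"
        using K unfolding row_sum_Cons row_False row_True
        by (subst IH2) (use K in \<open>auto intro!: sum.cong IH1\<close>)
      also have "\<dots> = absorb v * (V K * P K * bethe K up)
          + absorb v * (\<Sum>z\<in>K. (hop z * kap z v - 1 / s) * Sg K z * P (K - {z}) * B (K - {z}))"
        using K by (simp add: sum_distrib_left algebra_simps sum_subtractf sum.distrib PK(1) cong: sum.cong)
      also have "\<dots> = absorb v * (V K * P K * bethe K up)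
          + absorb v * (\<Sum>z\<in>K. scat v z * hop v * Sg K z * P (K - {z}) * B (K - {z}))"
        using K ne by (intro arg_cong2[where f = "(+)"] arg_cong2[where f = "(*)"] sum.cong refl)
           (simp add: kap_mult_hop)
      also have "\<dots> = absorb v * bethe (insert v K) (True # up)"
        unfolding ins_True[OF K(1,2)] distrib_left ..
      finally show ?thesis using True by simp
    next
      case False
      have "row_sum v True (bethe K) (False # up) = hop v * (P K * (absorb v * B K))"
        using K unfolding row_sum_Cons row_False by (subst IH1) auto
      also have "\<dots> = absorb v * bethe (insert v K) (False # up)"
        unfolding ins_False[OF K(1,2)] by simp
      finally show ?thesis using False by simp
    qed }
  { case 2
    note K = 2
    have ne: "v \<noteq> z" if "z \<in> K" for z using that K by auto
    have fold: "(\<Prod>w\<in>K. scat w v) = V K" "(\<Prod>w\<in>K - {z}. scat w z) = Sg K z" for z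
      by (simp_all add: V_def Sg_def)
    show ?case
    proof (cases a)
      case True
      \<comment> \<open>Here \<open>j\<close> takes the current column and \<open>l\<close> is the
        parameter that is exchanged for \<open>v\<close> further to the right.\<close>
      let ?T = "\<lambda>j l. Sg K j * Sg (K - {j}) l * P (K - {j} - {l}) * B (K - {j} - {l})"
      have "row_sum v False (bethe K) (True # up)
          = - (1 / s) * hop v * (\<Sum>j\<in>K. Sg K j * P (K - {j}) * (V (K - {j}) * bethe (K - {j}) up
               + (\<Sum>l\<in>K - {j}. kap l v * Sg (K - {j}) l * B (K - {j} - {l}))))"
        using K unfolding row_sum_Cons row_True
        by (intro arg_cong2[where f = "(*)"] refl sum.cong IH2) auto
      also have "\<dots> = - (1 / s) * hop v * (\<Sum>j\<in>K. Sg K j * P (K - {j}) * V (K - {j}) * bethe (K - {j}) up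
               + Sg K j * (P (K - {j}) * (\<Sum>l\<in>K - {j}. kap l v * Sg (K - {j}) l * B (K - {j} - {l}))))"
        by (simp add: distrib_left mult.assoc)
      also have "\<dots> = (\<Sum>j\<in>K. - (1 / s) * hop v * (Sg K j * P (K - {j}) * V (K - {j}) * bethe (K - {j}) up))
          + hop v * (\<Sum>j\<in>K. \<Sum>l\<in>K - {j}. - (1 / s) * hop l * kap l v * ?T j l)"
        using K by (subst P_sum) (simp_all add: sum_distrib_left algebra_simps sum.distrib sum_negf)
      \<comment> \<open>The two double sums agree because their difference changes sign under
        swapping \<open>j\<close> and \<open>l\<close>: \<open>Sg K j\<close> contains the factor
        \<open>scat l j\<close> that \<open>scat_exchange\<close> asks for.\<close>
      also have "(\<Sum>j\<in>K. \<Sum>l\<in>K - {j}. - (1 / s) * hop l * kap l v * ?T j l)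
          = (\<Sum>j\<in>K. \<Sum>l\<in>K - {j}. kap j v * scat v l * ?T j l)"
      proof -
        have "(\<Sum>j\<in>K. \<Sum>l\<in>K - {j}. (- (1 / s) * hop l * kap l v - kap j v * scat v l) * ?T j l) = 0"
        proof (rule antisymmetric_sum_zero)
          fix j l assume jl: "j \<in> K" "l \<in> K" "j \<noteq> l"
          have sets: "K - {l} - {j} = K - {j} - {l}" by auto
          have Sg: "Sg K j = scat l j * Sg (K - {l}) j" if "j \<in> K" "l \<in> K" "j \<noteq> l" for j l
          proof -
            have "K - {j} = insert l (K - {l} - {j})" using that by auto
            then show ?thesis unfolding Sg_def using K by simp
          qed
          have "(- (1 / s) * hop l * kap l v - kap j v * scat v l) * ?T j l
              + (- (1 / s) * hop j * kap j v - kap l v * scat v j) * ?T l j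
              = (scat l j * (- (1 / s) * hop l * kap l v - kap j v * scat v l)
              + scat j l * (- (1 / s) * hop j * kap j v - kap l v * scat v j))
              * (Sg (K - {l}) j * Sg (K - {j}) l * P (K - {j} - {l}) * B (K - {j} - {l}))"
            using Sg[of j l] Sg[of l j] jl unfolding sets by (simp add: ring_distribs ac_simps)
          also have "\<dots> = 0"
            using scat_exchange[of v l j] K jl ne by simp
          finally show "(- (1 / s) * hop l * kap l v - kap j v * scat v l) * ?T j l
              + (- (1 / s) * hop j * kap j v - kap l v * scat v j) * ?T l j = 0" .
        qed (use K in auto)
        then show ?thesis by (simp only: left_diff_distrib sum_subtractf right_minus_eq)
      qed
      also have "(\<Sum>j\<in>K. - (1 / s) * hop v * (Sg K j * P (K - {j}) * V (K - {j}) * bethe (K - {j}) up))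
          = (\<Sum>j\<in>K. (scat j v + kap j v) * (Sg K j * P (K - {j}) * V (K - {j}) * bethe (K - {j}) up))"
        using K ne by (intro sum.cong refl arg_cong2[where f = "(*)"]) (use scat_plus_kap in metis)
      also have "\<dots> + hop v * (\<Sum>j\<in>K. \<Sum>l\<in>K - {j}. kap j v * scat v l * ?T j l)
          = V K * (\<Sum>j\<in>K. Sg K j * P (K - {j}) * bethe (K - {j}) up)
          + (\<Sum>j\<in>K. kap j v * Sg K j * (V (K - {j}) * P (K - {j}) * bethe (K - {j}) up
              + (\<Sum>l\<in>K - {j}. scat v l * hop v * Sg (K - {j}) l * P (K - {j} - {l}) * B (K - {j} - {l}))))"
        using K by (simp add: sum_distrib_left algebra_simps sum.distrib PK(2) cong: sum.cong)
      also have "\<dots> = V K * bethe K (True # up)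
          + (\<Sum>j\<in>K. kap j v * Sg K j * bethe (insert v (K - {j})) (True # up))"
        using K unfolding bethe.simps(3)[of K] prod.distrib fold P_def[symmetric]
        by (intro arg_cong2[where f = "(+)"] refl sum.cong arg_cong2[where f = "(*)"] ins_True[symmetric]) auto
      finally show ?thesis using True by (simp only: fold)
    next
      case False
      have "row_sum v False (bethe K) (False # up)
          = P K * (V K * bethe K up + (\<Sum>z\<in>K. kap z v * Sg K z * B (K - {z})))
            + emit v * (\<Sum>z\<in>K. Sg K z * P (K - {z}) * (absorb v * B (K - {z})))"
        using K unfolding row_sum_Cons row_False row_True
        by (subst IH2) (use K in \<open>auto intro!: sum.cong IH1\<close>)
      also have "\<dots> = V K * (P K * bethe K up)
          + (\<Sum>z\<in>K. (hop z * kap z v + emit v * absorb v) * Sg K z * (P (K - {z}) * B (K - {z})))"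
        using K by (simp add: sum_distrib_left algebra_simps sum.distrib PK(1) cong: sum.cong)
      also have "\<dots> = V K * (P K * bethe K up)
          + (\<Sum>z\<in>K. kap z v * Sg K z * (hop v * P (K - {z}) * B (K - {z})))"
        using K ne by (intro arg_cong2[where f = "(+)"] refl sum.cong)
           (simp_all add: kap_hop_exchange)
      also have "\<dots> = V K * bethe K (False # up)
          + (\<Sum>z\<in>K. kap z v * Sg K z * bethe (insert v (K - {z})) (False # up))"
        using K unfolding bethe.simps(2)[of K] P_def[symmetric]
        by (intro arg_cong2[where f = "(+)"] refl sum.cong arg_cong2[where f = "(*)"] ins_False[symmetric]) auto
      finally show ?thesis using False by (simp only: fold)
    qed }
qed

section \<open>Bethe sums: vanishing and concatenation\<close>

lemma bethe_empty: "bethe {} up = of_bool (True \<notin> set up)"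
proof (induction up)
  case (Cons a up)
  then show ?case by (cases a) auto
qed auto

text \<open>Every \<open>True\<close> uses up one element of \<open>K\<close>, and the end of the
  list requires that none is left.\<close>

lemma bethe_zero:
  "finite K \<Longrightarrow> card K \<noteq> count_list xs True \<Longrightarrow> bethe K xs = 0"
proof (induction xs arbitrary: K)
  case (Cons a xs)
  show ?case
  proof (cases a)
    case True
    have "bethe (K - {z}) xs = 0" if "z \<in> K" for z
    proof (rule Cons.IH)
      have "card K = Suc (card (K - {z}))" using that Cons.prems by (metis card.remove)
      then show "card (K - {z}) \<noteq> count_list xs True" using Cons.prems(2) True by simp
    qed (use Cons.prems in auto)
    then show ?thesis using True by simp
  next
    case False
    then show ?thesis using Cons by simp
  qed
qed auto

text \<open>\<open>I\<close> is the set of parameters placed in the first block. Every other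
  parameter passes all its columns, with one factor \<open>hop\<close> per column, and is scattered
  once against each element of \<open>I\<close>. This is the origin of the sum over sets in the
  operators.\<close>

lemma bethe_append:
  assumes "finite K"
  shows "bethe K (xs @ ys)
     = (\<Sum>I\<in>Pow K. (\<Prod>z\<in>I. \<Prod>w\<in>K - I. scat w z) * (\<Prod>w\<in>K - I. hop w) ^ length xs
          * bethe I xs * bethe (K - I) ys)"
  using assms
proof (induction xs arbitrary: K)
  case Nil
  have "(\<Sum>I\<in>Pow K. (\<Prod>z\<in>I. \<Prod>w\<in>K - I. scat w z) * bethe I [] * bethe (K - I) ys)
     = (\<Sum>I\<in>{{}}. (\<Prod>z\<in>I. \<Prod>w\<in>K - I. scat w z) * bethe I [] * bethe (K - I) ys)"
    using Nil by (intro sum.mono_neutral_right) auto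
  then show ?case by simp
next
  case (Cons a xs)
  define X where "X I J = (\<Prod>z\<in>I. \<Prod>w\<in>J. scat w z)" for I J
  define P where "P J = (\<Prod>w\<in>J. hop w)" for J
  have IH: "bethe K (xs @ ys) = (\<Sum>I\<in>Pow K. X I (K - I) * P (K - I) ^ length xs * bethe I xs * bethe (K - I) ys)"
    if "finite K" for K
    unfolding X_def P_def using Cons.IH that by blast
  have split: "P K = P I * P (K - I)" if "I \<subseteq> K" "finite K" for I K
    using that unfolding P_def by (metis prod.subset_diff mult.commute)
  show ?case
  proof (cases a)
    case False
    have "bethe K ((a # xs) @ ys)
        = (\<Sum>I\<in>Pow K. P K * (X I (K - I) * P (K - I) ^ length xs * bethe I xs * bethe (K - I) ys))"
      using False Cons.prems by (simp add: IH P_def[symmetric] sum_distrib_left)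
    also have "\<dots> = (\<Sum>I\<in>Pow K. X I (K - I) * P (K - I) ^ length (a # xs) * bethe I (a # xs) * bethe (K - I) ys)"
      using False Cons.prems
      by (intro sum.cong refl) (simp add: P_def[symmetric] split[of _ K])
    finally show ?thesis unfolding X_def P_def .
  next
    case True
    define C where "C L z = (\<Prod>w\<in>L - {z}. scat w z)" for L z
    have "bethe K ((a # xs) @ ys)
        = (\<Sum>z\<in>K. \<Sum>I\<in>Pow (K - {z}). C K z * P (K - {z}) * (X I (K - {z} - I) * P (K - {z} - I) ^ length xs
              * bethe I xs * bethe (K - {z} - I) ys))"
      using True Cons.prems by (simp add: IH P_def C_def prod.distrib sum_distrib_left)
    also have "\<dots> = (\<Sum>(z, I)\<in>Sigma K (\<lambda>z. Pow (K - {z})). C K z * P (K - {z})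
        * (X I (K - {z} - I) * P (K - {z} - I) ^ length xs * bethe I xs * bethe (K - {z} - I) ys))"
      using Cons.prems by (subst sum.Sigma) auto
    also have "\<dots> = (\<Sum>(J, z)\<in>Sigma (Pow K) (\<lambda>J. J). X J (K - J) * P (K - J) ^ Suc (length xs)
        * (C J z * P (J - {z}) * bethe (J - {z}) xs) * bethe (K - J) ys)"
    \<comment> \<open>Choosing \<open>z\<close> for the first column and then \<open>I\<close> for
      the rest of the block amounts to choosing \<open>J = insert z I\<close> and then
      \<open>z\<close> in \<open>J\<close>.\<close>
    proof (rule sum.reindex_bij_witness[of _ "\<lambda>(J, z). (z, J - {z})" "\<lambda>(z, I). (insert z I, z)"], goal_cases)
      case (5 p)
      then obtain z I where p: "p = (z, I)" "z \<in> K" "I \<subseteq> K - {z}" by auto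
      have fin: "finite I" "finite K" using p Cons.prems finite_subset by auto
      have zI: "z \<notin> I" using p by auto
      have sets: "K - {z} - I = K - insert z I" "insert z I - {z} = I" using zI by auto
      have "K - {z} = I \<union> (K - insert z I)" using p by auto
      then have C: "C K z = C (insert z I) z * (\<Prod>w\<in>K - insert z I. scat w z)"
        using fin unfolding C_def sets by (simp, subst prod.union_disjoint) auto
      have X: "X (insert z I) (K - insert z I) = (\<Prod>w\<in>K - insert z I. scat w z) * X I (K - insert z I)"
        unfolding X_def using fin zI by simp
      have P: "P (K - {z}) = P I * P (K - insert z I)"
        using split[of I "K - {z}"] p fin sets by simp
      show ?case unfolding p(1) by (simp add: sets C X P ac_simps)
    qed auto
    also have "\<dots> = (\<Sum>J\<in>Pow K. \<Sum>z\<in>J. X J (K - J) * P (K - J) ^ Suc (length xs)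
        * (C J z * P (J - {z}) * bethe (J - {z}) xs) * bethe (K - J) ys)"
      using Cons.prems by (subst sum.Sigma) (auto intro: finite_subset)
    also have "\<dots> = (\<Sum>I\<in>Pow K. X I (K - I) * P (K - I) ^ length (a # xs) * bethe I (a # xs) * bethe (K - I) ys)"
      using True by (simp add: P_def C_def prod.distrib sum_distrib_left sum_distrib_right)
    finally show ?thesis unfolding X_def P_def .
  qed
qed

text \<open>The list of spectral parameters starts with the topmost row.\<close>

fun stack_wt :: "complex list \<Rightarrow> bool list \<Rightarrow> complex" where
  "stack_wt [] up = of_bool (True \<notin> set up)"
| "stack_wt (u # us) up = row_sum u True (stack_wt us) up"

text \<open>Each row adds its own parameter to a Bethe sum, starting from the empty set. The
  parameters must be distinct, as \<open>bethe\<close> is indexed by a set.\<close>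

lemma stack_wt_bethe:
  assumes "distinct us" "\<And>u. u \<in> set us \<Longrightarrow> s * u \<noteq> 1"
  shows "stack_wt us up = (\<Prod>u\<in>set us. absorb u) * bethe (set us) up"
  using assms
proof (induction us arbitrary: up)
  case Nil
  then show ?case by (simp add: bethe_empty)
next
  case (Cons u us)
  have "stack_wt us = (\<lambda>l. (\<Prod>u\<in>set us. absorb u) * bethe (set us) l)"
    using Cons by auto
  then show ?case
    using Cons.prems by (simp add: row_sum_linear bethe_row_sum)
qed

lemma stack_wt_cong_set:
  assumes "distinct us" "distinct us'" "set us = set us'" "\<And>u. u \<in> set us \<Longrightarrow> s * u \<noteq> 1"
  shows "stack_wt us up = stack_wt us' up"
  using stack_wt_bethe[of us up] stack_wt_bethe[of us' up] assms by simp

section \<open>Continuity and symmetry in the spectral parameters\<close>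

lemma tendsto_hop:
  assumes "(g \<longlongrightarrow> u) F" "s * u \<noteq> 1"
  shows "((\<lambda>e. hop (g e)) \<longlongrightarrow> hop u) F" "((\<lambda>e. emit (g e)) \<longlongrightarrow> emit u) F"
    "((\<lambda>e. absorb (g e)) \<longlongrightarrow> absorb u) F"
  unfolding hop_def emit_def absorb_def using assms by (auto intro!: tendsto_intros)

lemma tendsto_row_wt:
  assumes "(g \<longlongrightarrow> u) F" "s * u \<noteq> 1"
  shows "((\<lambda>e. row_wt (g e) h low up) \<longlongrightarrow> row_wt u h low up) F"
proof (induction low arbitrary: h up)
  case Nil
  then show ?case by (cases up) auto
next
  case (Cons l low)
  then show ?case using s_nonzero by (cases up) (auto intro!: tendsto_intros tendsto_hop assms)
qed

lemma tendsto_stack_wt: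
  assumes "\<And>u. u \<in> set us \<Longrightarrow> ((\<lambda>e. g e u) \<longlongrightarrow> w u) F" "\<And>u. u \<in> set us \<Longrightarrow> s * w u \<noteq> 1"
  shows "((\<lambda>e. stack_wt (map (g e) us) up) \<longlongrightarrow> stack_wt (map w us) up) F"
  using assms
proof (induction us arbitrary: up)
  case (Cons u us)
  then show ?case
    unfolding list.map stack_wt.simps row_sum_def
    by (intro tendsto_intros tendsto_row_wt) auto
qed auto

text \<open>The Bethe sum over \<open>set us\<close> shows the symmetry for distinct variables; the general case is a
  limit.\<close>

lemma stack_wt_permute:
  assumes "mset us = mset us'" "\<And>u. u \<in> set us \<Longrightarrow> s * u \<noteq> 1"
  shows "stack_wt us up = stack_wt us' up"
proof -
  define n where "n = length us"
  obtain p where p: "p permutes {..<n}" "permute_list p us' = us"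
    using mset_eq_permutation[OF assms(1)] mset_eq_length[OF assms(1)] unfolding n_def by metis
  have len: "length us' = n" using mset_eq_length[OF assms(1)] n_def by simp
  define w where "w i = us' ! i" for i
  define g where "g e i = us' ! i + of_real e * of_nat i" for e :: real and i
  have us': "us' = map w [0..<n]" unfolding w_def len[symmetric] by (simp add: map_nth)
  have us: "us = map w (map p [0..<n])"
    using p(2) len unfolding permute_list_def w_def by auto
  have pn: "p i < n" if "i < n" for i using p(1) that by (simp add: permutes_in_image[of p "{..<n}" i, simplified])
  have pset: "p ` {..<n} = {..<n}" using permutes_image[OF p(1)] .
  have lim: "((\<lambda>e. g e i) \<longlongrightarrow> w i) (at_right 0)" for i
    unfolding g_def w_def by (auto intro!: tendsto_eq_intros)
  have ok: "s * w i \<noteq> 1" if "i < n" for i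
    using assms that len unfolding w_def by (metis mset_eq_setD nth_mem)
  have inj: "\<forall>\<^sub>F e in at_right 0. inj_on (g e) {..<n}"
  proof -
    have "\<forall>\<^sub>F e in at_right 0. \<forall>i\<in>{..<n}. \<forall>j\<in>{..<n}. i \<noteq> j \<longrightarrow> g e i \<noteq> g e j"
    proof (intro eventually_ball_finite ballI finite_lessThan)
      fix i j
      show "\<forall>\<^sub>F e in at_right 0. i \<noteq> j \<longrightarrow> g e i \<noteq> g e j"
        using eventually_at_right_add_neq[of "of_nat i" "of_nat j" "us' ! i" "us' ! j"]
        by (cases "i = j") (simp_all add: g_def)
    qed
    then show ?thesis by eventually_elim (auto simp: inj_on_def)
  qed
  have near: "\<forall>\<^sub>F e in at_right 0. \<forall>i\<in>{..<n}. s * g e i \<noteq> 1"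
  proof (intro eventually_ball_finite ballI finite_lessThan)
    fix i assume i: "i \<in> {..<n}"
    have "((\<lambda>e. s * g e i) \<longlongrightarrow> s * w i) (at_right 0)" by (intro tendsto_intros lim)
    then show "\<forall>\<^sub>F e in at_right 0. s * g e i \<noteq> 1"
      by (rule tendsto_imp_eventually_ne) (use ok i in auto)
  qed
  \<comment> \<open>For small \<open>e\<close> both lists have distinct entries and the same set of
    entries, so the Bethe sums coincide; the claim is the limit of this equality.\<close>
  have "\<forall>\<^sub>F e in at_right 0. stack_wt (map (g e) (map p [0..<n])) up = stack_wt (map (g e) [0..<n]) up"
    using inj near
  proof eventually_elim
    case (elim e)
    have set: "set (map (g e) (map p [0..<n])) = set (map (g e) [0..<n])"
      using pset by (simp add: image_image[symmetric] atLeast0LessThan)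
    have d1: "distinct (map (g e) (map p [0..<n]))"
      using comp_inj_on[OF permutes_inj_on[OF p(1)], of "g e" "{..<n}"] elim(1) pset
      by (simp add: distinct_map atLeast0LessThan)
    have d2: "distinct (map (g e) [0..<n])"
      using elim by (auto simp: distinct_map atLeast0LessThan)
    have ok: "s * z \<noteq> 1" if "z \<in> set (map (g e) [0..<n])" for z
      using elim(2) that by auto
    show ?case by (rule stack_wt_cong_set[OF d2 d1 set[symmetric] ok, symmetric])
  qed
  then have "((\<lambda>e. stack_wt (map (g e) [0..<n]) up) \<longlongrightarrow> stack_wt (map w (map p [0..<n])) up) (at_right 0)"
    by (rule Lim_transform_eventually[rotated]) (intro tendsto_stack_wt lim ok, auto simp: pn)
  moreover have "((\<lambda>e. stack_wt (map (g e) [0..<n]) up) \<longlongrightarrow> stack_wt (map w [0..<n]) up) (at_right 0)"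
    by (intro tendsto_stack_wt lim ok) auto
  ultimately have "stack_wt (map w (map p [0..<n])) up = stack_wt (map w [0..<n]) up"
    by (intro tendsto_unique[OF trivial_limit_at_right_real])
  then show ?thesis using us us' by simp
qed

section \<open>Rows with parameter \<open>s\<close> and the operator identity for one
  configuration\<close>

lemma row_wt_full_prefix:
  "row_wt u True (replicate k True @ low) up
     = (if take k up = replicate k True then (- (1 / s)) ^ k * row_wt u True low (drop k up) else 0)"
\<comment> \<open>In each column of the prefix, paths arrive from below and from the left, so they
  leave upwards and to the right, with weight \<open>- 1 / s\<close>.\<close>
proof (induction k arbitrary: up)
  case (Suc k)
  then show ?case by (cases up) auto
qed auto

lemma row_wt_empty: "row_wt u False (replicate r False) up = of_bool (up = replicate r False)"
proof (induction r arbitrary: up)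
  case 0
  then show ?case by (cases up) auto
next
  case (Suc r)
  then show ?case by (cases up) auto
qed

lemma row_wt_s_empty:
  "row_wt s True (replicate r False) up = (if 0 < r \<and> up = True # replicate (r - 1) False then absorb s else 0)"
proof (cases r)
  case 0
  then show ?thesis by (cases up) auto
next
  case (Suc r')
  then show ?thesis by (cases up) (auto simp: row_wt_empty hop_def)
qed

text \<open>This is the value \<open>F_k(S)\<close>: counted from 0 at the bottom, row
  \<open>j\<close> crosses \<open>j\<close> occupied columns and turns up in the next one. It agrees
  with the closed formula because \<open>(1 - q) / (1 - s^2) = - 1 / s^2\<close>.\<close>

definition stair_wt :: "nat \<Rightarrow> complex" where
  "stair_wt k = (\<Prod>j<k. absorb s * (- (1 / s)) ^ j)"

lemma absorb_nonzero: "s * u \<noteq> 1 \<Longrightarrow> absorb u \<noteq> 0"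
  unfolding absorb_def unfolding q_eq using s_square by (auto simp: divide_simps)

lemma stair_wt_nonzero: "stair_wt k \<noteq> 0"
  using absorb_nonzero[of s] s_square s_nonzero by (simp add: stair_wt_def power2_eq_square)

lemma stack_wt_stair:
  "stack_wt (replicate k s) up
     = (if k \<le> length up \<and> up = replicate k True @ replicate (length up - k) False then stair_wt k else 0)"
proof (induction k arbitrary: up)
  case 0
  have "True \<notin> set up \<longleftrightarrow> up = replicate (length up) False"
    by (metis (full_types) in_set_replicate replicate_eqI)
  then show ?case by (simp add: stair_wt_def)
next
  case (Suc k)
  let ?n = "length up"
  let ?l = "replicate k True @ replicate (?n - k) False"
  have "stack_wt (replicate (Suc k) s) up
      = (\<Sum>low | length low = ?n. if low = ?l then stair_wt k * of_bool (k \<le> ?n) * row_wt s True ?l up else 0)"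
    \<comment> \<open>By the induction hypothesis at most one configuration below the new row
      contributes.\<close>
    unfolding replicate_Suc stack_wt.simps row_sum_def by (intro sum.cong refl) (auto simp: Suc.IH)
  also have "\<dots> = stair_wt k * of_bool (k \<le> ?n) * row_wt s True ?l up"
    by (cases "k \<le> ?n") (simp_all add: sum.delta finite_bool_lists)
  also have "\<dots> = (if k \<le> ?n \<and> take k up = replicate k True \<and> 0 < ?n - k \<and> drop k up = True # replicate (?n - k - 1) False
      then stair_wt k * ((- (1 / s)) ^ k * absorb s) else 0)"
    by (simp add: row_wt_full_prefix row_wt_s_empty)
  also have "k \<le> ?n \<and> take k up = replicate k True \<and> 0 < ?n - k \<and> drop k up = True # replicate (?n - k - 1) False
      \<longleftrightarrow> Suc k \<le> ?n \<and> up = replicate (Suc k) True @ replicate (?n - Suc k) False" (is "?A \<longleftrightarrow> ?B")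
  proof
    assume ?A
    then have "up = replicate k True @ True # replicate (?n - k - 1) False" by (metis append_take_drop_id)
    then show ?B using \<open>?A\<close> by (simp add: replicate_app_Cons_same)
  next
    assume B: ?B
    then have "up = replicate k True @ True # replicate (?n - k - 1) False"
      by (simp add: replicate_app_Cons_same)
    then have "take k up = replicate k True \<and> drop k up = True # replicate (?n - k - 1) False"
      by (metis append_eq_conv_conj length_replicate)
    then show ?A using B by simp
  qed
  finally show ?case by (simp add: stair_wt_def lessThan_Suc ac_simps)
qed

text \<open>Since \<open>hop s = 0\<close>, a horizontal path in a row with parameter \<open>s\<close> turns up at the first empty
  column. This freezes the lowest \<open>k\<close> rows, and thereby the first \<open>k\<close> columns.\<close>

lemma stack_wt_over_stair:
  "stack_wt (us @ replicate k s) up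
     = (if take k up = replicate k True
        then stair_wt k * (- (1 / s)) ^ (k * length us) * stack_wt us (drop k up) else 0)"
proof (induction us arbitrary: up)
  case Nil
  have "k \<le> length up \<and> up = replicate k True @ replicate (length up - k) False
      \<longleftrightarrow> take k up = replicate k True \<and> True \<notin> set (drop k up)" (is "?A \<longleftrightarrow> ?B")
  proof
    assume ?A
    then have "take k up = replicate k True \<and> drop k up = replicate (length up - k) False"
      by (metis append_eq_conv_conj length_replicate)
    then show ?B by simp
  next
    assume B: ?B
    then have "drop k up = replicate (length up - k) False"
      by (metis (full_types) length_drop replicate_eqI)
    moreover have "k \<le> length up" using B by (metis length_replicate length_take min.absorb_iff2)
    ultimately show ?A using B by (metis append_take_drop_id)
  qed
  then show ?case by (auto simp: stack_wt_stair)
next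
  case (Cons u us)
  let ?n = "length up"
  let ?c = "stair_wt k * (- (1 / s)) ^ (k * length us)"
  have "stack_wt ((u # us) @ replicate k s) up
      = (\<Sum>low | length low = ?n \<and> take k low = replicate k True. ?c * stack_wt us (drop k low) * row_wt u True low up)"
    unfolding append_Cons stack_wt.simps row_sum_def
    by (intro sum.mono_neutral_cong_right) (auto simp: Cons.IH finite_bool_lists)
  also have "{low. length low = ?n \<and> take k low = replicate k True}
      = (if k \<le> ?n then (@) (replicate k True) ` {low. length low = ?n - k} else {})"
  proof -
    have "low \<in> (@) (replicate k True) ` {low. length low = ?n - k}"
      if "length low = ?n" "take k low = replicate k True" for low
      using that by (intro image_eqI[of _ _ "drop k low"]) (metis append_take_drop_id, simp)
    moreover have "k \<le> ?n" if "length low = ?n" "take k low = replicate k True" for low :: "bool list"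
      using that by (metis length_replicate length_take min.absorb_iff2)
    ultimately show ?thesis by auto
  qed
  also have "(\<Sum>low\<in>\<dots>. ?c * stack_wt us (drop k low) * row_wt u True low up)
      = (if k \<le> ?n then \<Sum>low | length low = ?n - k. ?c * stack_wt us low * row_wt u True (replicate k True @ low) up else 0)"
    by (simp add: sum.reindex inj_on_def)
  also have "\<dots> = (if take k up = replicate k True
        then ?c * (- (1 / s)) ^ k * (\<Sum>low | length low = ?n - k. stack_wt us low * row_wt u True low (drop k up)) else 0)"
  proof -
    have "k \<le> ?n" if "take k up = replicate k True"
      using that by (metis length_replicate length_take min.absorb_iff2)
    then show ?thesis by (auto simp: row_wt_full_prefix sum_distrib_left ac_simps intro!: sum.cong)
  qed
  finally show ?case by (simp add: row_sum_def power_add mult.assoc mult.commute mult.left_commute)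
qed

text \<open>Only the multiset of parameters matters, so the rows with parameter \<open>s\<close> can
  be moved to the end of the list, that is, to the bottom. Here the symmetry is needed for repeated
  parameters.\<close>

lemma stack_wt_override_s:
  assumes "finite A" "distinct xs" "set xs = A" "I \<subseteq> A" "\<And>j. j \<in> A \<Longrightarrow> s * v j \<noteq> 1"
  shows "stack_wt (map (override_on v (\<lambda>_. s) I) xs) up
     = stack_wt (map v (filter (\<lambda>j. j \<notin> I) xs) @ replicate (card I) s) up"
proof (rule stack_wt_permute)
  have "length (filter (\<lambda>j. j \<in> I) xs) = card I"
  proof -
    have "set (filter (\<lambda>j. j \<in> I) xs) = I" using assms by auto
    then show ?thesis using distinct_card[OF distinct_filter[OF assms(2)], of "\<lambda>j. j \<in> I"] by simp
  qed
  moreover have "mset (map (override_on v (\<lambda>_. s) I) xs)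
      = mset (map v (filter (\<lambda>j. j \<notin> I) xs)) + replicate_mset (length (filter (\<lambda>j. j \<in> I) xs)) s"
    by (induction xs) auto
  ultimately show "mset (map (override_on v (\<lambda>_. s) I) xs)
      = mset (map v (filter (\<lambda>j. j \<notin> I) xs) @ replicate (card I) s)"
    by simp
next
  fix u assume "u \<in> set (map (override_on v (\<lambda>_. s) I) xs)"
  then obtain j where "j \<in> A" "u = override_on v (\<lambda>_. s) I j" using assms(3) by auto
  then show "s * u \<noteq> 1"
    using assms(5) s_square by (auto simp: override_on_def power2_eq_square)
qed

text \<open>\<open>s * q = 1 / s\<close> gives \<open>u - s * q = - (1 - s * u) / s\<close>, so the
  denominator of the operator is that of \<open>hop\<close> up to a constant.\<close>

lemma hop_eq_shifted:
  assumes "s * u \<noteq> 1"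
  shows "(u - s) / (u - s * q) * (- (1 / s)) = hop u"
proof -
  have "s * q = 1 / s" unfolding q_eq using s_nonzero by (simp add: power2_eq_square)
  then have "u - s * q = (1 - s * u) * (- (1 / s))" using s_nonzero by (simp add: field_simps)
  then show ?thesis using s_nonzero by (simp add: hop_def)
qed

lemma stack_wt_difference:
  assumes A: "finite A" "distinct xs" "set xs = A" and v: "inj_on v A" "\<And>j. j \<in> A \<Longrightarrow> s * v j \<noteq> 1"
  shows "(\<Sum>I | I \<subseteq> A \<and> card I = k.
        (\<Prod>i\<in>I. \<Prod>j\<in>A - I. (v j - q * v i) / (v j - v i)) *
        (\<Prod>j\<in>A - I. ((v j - s) / (v j - s * q)) ^ k) *
        ((\<Prod>z\<in>v ` I. absorb z) * bethe (v ` I) (replicate k True) / stair_wt k) *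
        stack_wt (map (override_on v (\<lambda>_. s) I) xs) up)
     = (if take k up = replicate k True then stack_wt (map v xs) up else 0)"
    (is "(\<Sum>I | I \<subseteq> A \<and> card I = k. ?term I) = _")
proof -
  define Ab where "Ab J = (\<Prod>z\<in>J. absorb z)" for J
  define f where "f J = (\<Prod>z\<in>J. \<Prod>w\<in>v ` A - J. scat w z) * (\<Prod>w\<in>v ` A - J. hop w) ^ k
      * bethe J (replicate k True) * bethe (v ` A - J) (drop k up)" for J
  have over: "stack_wt (map (override_on v (\<lambda>_. s) I) xs) up
      = (if take k up = replicate k True then stair_wt k * (- (1 / s)) ^ (k * card (A - I))
          * (Ab (v ` (A - I)) * bethe (v ` (A - I)) (drop k up)) else 0)"
    if "I \<subseteq> A" "card I = k" for I
  proof -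
    have set: "set (filter (\<lambda>j. j \<notin> I) xs) = A - I" using A by auto
    have "length (filter (\<lambda>j. j \<notin> I) xs) = card (A - I)"
      using distinct_card[OF distinct_filter[OF A(2)], of "\<lambda>j. j \<notin> I"] set by simp
    moreover have "stack_wt (map v (filter (\<lambda>j. j \<notin> I) xs)) (drop k up)
        = Ab (v ` (A - I)) * bethe (v ` (A - I)) (drop k up)"
      using A v set unfolding Ab_def
      by (subst stack_wt_bethe) (auto simp: distinct_map intro: inj_on_subset)
    moreover have "stack_wt (map (override_on v (\<lambda>_. s) I) xs) up
        = stack_wt (map v (filter (\<lambda>j. j \<notin> I) xs) @ replicate k s) up"
      using stack_wt_override_s[OF A that(1) v(2)] that(2) by simp
    ultimately show ?thesis by (simp add: stack_wt_over_stair)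
  qed
  show ?thesis
  proof (cases "take k up = replicate k True")
    case False
    then show ?thesis by (simp add: over)
  next
    case True
    then have up: "up = replicate k True @ drop k up" by (metis append_take_drop_id)
    have vA: "\<And>u. u \<in> v ` A \<Longrightarrow> s * u \<noteq> 1" using v by auto
    have "stack_wt (map v xs) up = Ab (v ` A) * bethe (v ` A) up"
      using A v unfolding Ab_def by (subst stack_wt_bethe) (auto simp: distinct_map)
    also have "bethe (v ` A) up = (\<Sum>J\<in>Pow (v ` A). f J)"
      unfolding f_def by (subst up, subst bethe_append) (use A in auto)
    also have "\<dots> = (\<Sum>I\<in>Pow A. f (v ` I))"
      by (subst image_Pow_surj[OF refl, symmetric], subst sum.reindex) (auto simp: inj_on_image_Pow v)
    \<comment> \<open>The prefix has exactly \<open>k\<close> occupied columns, so only sets of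
      \<open>k\<close> parameters contribute.\<close>
    also have "\<dots> = (\<Sum>I | I \<subseteq> A \<and> card I = k. f (v ` I))"
    proof (rule sum.mono_neutral_right)
      show "\<forall>I\<in>Pow A - {I. I \<subseteq> A \<and> card I = k}. f (v ` I) = 0"
      proof
        fix I assume I: "I \<in> Pow A - {I. I \<subseteq> A \<and> card I = k}"
        then have "card (v ` I) = card I" using v(1) by (metis DiffD1 PowD card_image inj_on_subset)
        moreover have "count_list (replicate k True) True = k" by (induction k) auto
        ultimately have "bethe (v ` I) (replicate k True) = 0"
          using I A by (intro bethe_zero) (auto intro: finite_subset)
        then show "f (v ` I) = 0" by (simp add: f_def)
      qed
    qed (use A in auto)
    finally have rhs: "stack_wt (map v xs) up = Ab (v ` A) * (\<Sum>I | I \<subseteq> A \<and> card I = k. f (v ` I))" .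
    have "?term I = Ab (v ` A) * f (v ` I)" if I: "I \<subseteq> A" "card I = k" for I
    proof -
      have inj: "inj_on v I" "inj_on v (A - I)" using v(1) I by (auto intro: inj_on_subset)
      have diff: "v ` A - v ` I = v ` (A - I)"
        using v(1) I(1) by (simp add: inj_on_image_set_diff[of v A A I])
      have "Ab (v ` A) = Ab (v ` I) * Ab (v ` (A - I))"
        unfolding Ab_def diff[symmetric] using A I
        by (metis finite_imageI image_mono mult.commute prod.subset_diff)
      moreover have "(\<Prod>z\<in>v ` I. \<Prod>w\<in>v ` (A - I). scat w z) = (\<Prod>i\<in>I. \<Prod>j\<in>A - I. (v j - q * v i) / (v j - v i))"
        by (simp add: prod.reindex inj scat_def)
      moreover have "(\<Prod>j\<in>A - I. ((v j - s) / (v j - s * q)) ^ k) * (- (1 / s)) ^ (k * card (A - I))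
          = (\<Prod>w\<in>v ` (A - I). hop w) ^ k"
      proof -
        have "(\<Prod>j\<in>A - I. ((v j - s) / (v j - s * q)) ^ k) * (- (1 / s)) ^ (k * card (A - I))
            = (\<Prod>j\<in>A - I. ((v j - s) / (v j - s * q)) ^ k * (- (1 / s)) ^ k)"
          by (simp only: prod.distrib prod_constant power_mult)
        also have "\<dots> = (\<Prod>j\<in>A - I. hop (v j) ^ k)"
          by (intro prod.cong refl) (subst power_mult_distrib[symmetric], subst hop_eq_shifted, auto simp: v)
        finally show ?thesis by (simp add: prod.reindex inj prod_power_distrib)
      qed
      \<comment> \<open>The rearrangement in abstract letters: \<open>c\<close> stands for
        \<open>stair_wt k\<close>, and \<open>y * d = h\<close> for the identity between powers of
        \<open>hop\<close> just proved.\<close>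
      moreover have "x * y * (a * b / c) * (c * d * (e * g)) = a * e * (x * h * b * g)"
        if "c \<noteq> 0" "y * d = h" for x y a b c d e g h :: complex
        unfolding that(2)[symmetric] using that(1) by simp
      moreover have "stack_wt (map (override_on v (\<lambda>_. s) I) xs) up
          = stair_wt k * (- (1 / s)) ^ (k * card (A - I)) * (Ab (v ` (A - I)) * bethe (v ` (A - I)) (drop k up))"
        using over[OF I] True by simp
      ultimately show ?thesis
        using stair_wt_nonzero[of k] unfolding f_def diff Ab_def[symmetric]
        by (simp only:)
    qed
    then have "(\<Sum>I | I \<subseteq> A \<and> card I = k. ?term I) = (\<Sum>I | I \<subseteq> A \<and> card I = k. Ab (v ` A) * f (v ` I))"
      by (intro sum.cong) auto
    then show ?thesis using True by (simp add: rhs sum_distrib_left)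
  qed
qed

end

subsection \<open>Path collections as interlacing rows\<close>

lemma path_edges_simps [simp]:
  "path_edges [] = {}" "path_edges [a] = {}"
  "path_edges (a # b # xs) = insert (a, b) (path_edges (b # xs))"
  by (simp_all add: path_edges_def)

lemma path_edges_append:
  "xs \<noteq> [] \<Longrightarrow> ys \<noteq> [] \<Longrightarrow>
     path_edges (xs @ ys) = path_edges xs \<union> {(last xs, hd ys)} \<union> path_edges ys"
proof (induction xs rule: induct_list012)
  case (2 x)
  then show ?case by (cases ys) auto
qed auto

lemma path_edges_in_set: "(a, b) \<in> path_edges p \<Longrightarrow> a \<in> set p \<and> b \<in> set p"
  by (induction p rule: induct_list012) auto

lemma path_edges_step:
  "successively up_right_step p \<Longrightarrow> (a, b) \<in> path_edges p \<Longrightarrow> up_right_step a b"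
  by (induction p rule: induct_list012) auto

lemma finite_path_edges: "finite (path_edges p)"
  by (simp add: path_edges_def)

text \<open>Each step raises the sum of the coordinates by one, so a path never returns to a
  vertex.\<close>

lemma up_right_rank:
  "successively up_right_step (a # p) \<Longrightarrow> v \<in> set p \<Longrightarrow> fst a + snd a < fst v + snd v"
proof (induction p arbitrary: a)
  case (Cons b p)
  have "fst a + snd a < fst b + snd b"
    using Cons.prems(1) by (auto simp: up_right_step_def)
  then show ?case using Cons by fastforce
qed auto

lemma up_right_in_degree:
  assumes "successively up_right_step p" "(i, j) \<in> set p" "(i, j) \<noteq> hd p"
  shows "of_bool (((i, j - 1), (i, j)) \<in> path_edges p) + of_bool (((i - 1, j), (i, j)) \<in> path_edges p) = (1::nat)"
  using assms
proof (induction p rule: induct_list012)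
  case (3 a b xs)
  show ?case
  proof (cases "(i, j) = b")
    case True
    have no: "(c, (i, j)) \<notin> path_edges (b # xs)" for c
    proof
      assume e: "(c, (i, j)) \<in> path_edges (b # xs)"
      then have "up_right_step c (i, j)" using path_edges_step[OF _ e] "3.prems"(1) by simp
      then have "fst c + snd c < i + j" by (auto simp: up_right_step_def)
      moreover have "c = b \<or> fst b + snd b < fst c + snd c"
        using path_edges_in_set[OF e] up_right_rank[of b xs c] "3.prems"(1) by auto
      ultimately show False using True by auto
    qed
    have "up_right_step a (i, j)" using "3.prems"(1) True by auto
    then show ?thesis using no True by (cases a; cases b) (auto simp: up_right_step_def)
  next
    case False
    then show ?thesis using 3 by auto
  qed
qed auto

lemma up_right_out_degree:
  assumes "successively up_right_step p" "(i, j) \<in> set p" "(i, j) \<noteq> last p"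
  shows "of_bool (((i, j), (i, j + 1)) \<in> path_edges p) + of_bool (((i, j), (i + 1, j)) \<in> path_edges p) = (1::nat)"
  using assms
proof (induction p rule: induct_list012)
  case (3 a b xs)
  show ?case
  proof (cases "(i, j) = a")
    case True
    have "a \<notin> set (b # xs)" using up_right_rank[of a "b # xs" a] "3.prems"(1) by auto
    then have no: "((i, j), c) \<notin> path_edges (b # xs)" for c
      using path_edges_in_set[of "(i, j)" c "b # xs"] True by auto
    have "up_right_step a b" using 3 by auto
    then show ?thesis using no True by (cases a; cases b) (auto simp: up_right_step_def)
  next
    case False
    moreover have "of_bool (((i, j), (i, j + 1)) \<in> path_edges (b # xs))
        + of_bool (((i, j), (i + 1, j)) \<in> path_edges (b # xs)) = (1::nat)"
      using "3.prems" False by (intro "3.IH"(2)) auto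
    ultimately show ?thesis by simp
  qed
qed auto

lemma up_right_pathE:
  assumes "up_right_path M y p"
  obtains r x where "p = (-1, int y) # r @ [(x, int M + 1)]" "r \<noteq> []" "hd r = (0, int y)"
    "last r = (x, int M)" "set r \<subseteq> grid M" "successively up_right_step p"
proof -
  obtain r x where r: "p = (-1, int y) # r @ [(x, int M + 1)]" "r \<noteq> []" "hd r = (0, int y)"
    "last r = (x, int M)" "set r \<subseteq> grid M" "successively up_right_step r"
    using assms unfolding up_right_path_def by blast
  then have "successively up_right_step p"
    by (auto simp: successively_Cons successively_append_iff up_right_step_def)
  then show thesis using r that by blast
qed

lemma up_right_path_edges:
  assumes "up_right_path M y p"
  shows "((-1, int y'), (0, int y')) \<in> path_edges p \<longleftrightarrow> y' = y"
    and "(a, b) \<in> path_edges p \<Longrightarrow>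
      (\<exists>i j. 0 \<le> i \<and> 1 \<le> j \<and> j \<le> int M \<and> (a = (i, j) \<and> b = (i, j + 1) \<or> a = (i - 1, j) \<and> b = (i, j)))"
    and "1 \<le> j \<Longrightarrow> j \<le> int M \<Longrightarrow> 0 \<le> i \<Longrightarrow>
      of_bool (((i, j - 1), (i, j)) \<in> path_edges p) + of_bool (((i - 1, j), (i, j)) \<in> path_edges p)
      = of_bool (((i, j), (i, j + 1)) \<in> path_edges p) + (of_bool (((i, j), (i + 1, j)) \<in> path_edges p) :: nat)"
proof -
  obtain r x where r: "p = (-1, int y) # r @ [(x, int M + 1)]" "r \<noteq> []" "hd r = (0, int y)"
    "last r = (x, int M)" "set r \<subseteq> grid M" "successively up_right_step p"
    using assms by (rule up_right_pathE)
  have x: "0 \<le> x" using r(2,4,5) unfolding grid_def by (metis SigmaD1 atLeast_iff last_in_set subsetD)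
  have y: "1 \<le> y" "y \<le> M" using r(2,3,5) hd_in_set[of r] unfolding grid_def by auto
  have edges: "path_edges p = insert ((-1, int y), (0, int y)) (path_edges (r @ [(x, int M + 1)]))"
    using r(1-3) by (cases r) auto
  have top: "path_edges (r @ [(x, int M + 1)]) = insert ((x, int M), (x, int M + 1)) (path_edges r)"
    using r(2,4) by (subst path_edges_append) auto
  show "((-1, int y'), (0, int y')) \<in> path_edges p \<longleftrightarrow> y' = y"
    unfolding edges top using x path_edges_in_set[of "(-1, int y')" "(0, int y')" r] r(5)
    by (auto simp: grid_def)
  show "\<exists>i j. 0 \<le> i \<and> 1 \<le> j \<and> j \<le> int M \<and> (a = (i, j) \<and> b = (i, j + 1) \<or> a = (i - 1, j) \<and> b = (i, j))"
    if ab: "(a, b) \<in> path_edges p"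
  proof -
    have step: "up_right_step a b" using path_edges_step[OF r(6) ab] .
    consider "a = (-1, int y)" "b = (0, int y)" | "a = (x, int M)" "b = (x, int M + 1)"
      | "a \<in> grid M" "b \<in> grid M"
      using ab path_edges_in_set[of a b r] r(5) unfolding edges top by blast
    then show ?thesis
    proof cases
      case 1
      then show ?thesis using y by (intro exI[of _ 0] exI[of _ "int y"]) auto
    next
      case 2
      then show ?thesis using x y by (intro exI[of _ x] exI[of _ "int M"]) auto
    next
      case 3
      then show ?thesis using step unfolding up_right_step_def grid_def
        by (cases a; cases b) fastforce
    qed
  qed
  show "of_bool (((i, j - 1), (i, j)) \<in> path_edges p) + of_bool (((i - 1, j), (i, j)) \<in> path_edges p)
      = of_bool (((i, j), (i, j + 1)) \<in> path_edges p) + (of_bool (((i, j), (i + 1, j)) \<in> path_edges p) :: nat)"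
    if "1 \<le> j" "j \<le> int M" "0 \<le> i"
  proof (cases "(i, j) \<in> set p")
    case True
    have "(i, j) \<noteq> hd p" "(i, j) \<noteq> last p" using that r(1) by auto
    then show ?thesis using up_right_in_degree[OF r(6) True] up_right_out_degree[OF r(6) True] by simp
  next
    case False
    then show ?thesis using path_edges_in_set[of _ _ p] by auto
  qed
qed

text \<open>Steps never go left, so the exit column bounds the whole path. This later confines the
  staircase collections to a finite box.\<close>

lemma up_right_path_bounds:
  assumes "up_right_path M y p"
  obtains x where "0 \<le> x" "((x, int M), (x, int M + 1)) \<in> path_edges p"
    "set p \<subseteq> {-1..x} \<times> {0..int M + 1}"
proof -
  obtain r x where r: "p = (-1, int y) # r @ [(x, int M + 1)]" "r \<noteq> []" "hd r = (0, int y)"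
    "last r = (x, int M)" "set r \<subseteq> grid M" "successively up_right_step p"
    using assms by (rule up_right_pathE)
  have mono: "successively up_right_step w \<Longrightarrow> v \<in> set w \<Longrightarrow> fst v \<le> fst (last w)" for v w
  proof (induction w arbitrary: v rule: induct_list012)
    case (3 a b xs)
    have "fst b \<le> fst (last (a # b # xs))" using "3.IH"(2)[of b] "3.prems"(1) by simp
    moreover have "fst a \<le> fst b" using "3.prems"(1) by (auto simp: up_right_step_def)
    moreover have "fst v \<le> fst (last (a # b # xs))" if "v \<in> set (b # xs)"
      using "3.IH"(2) "3.prems"(1) that by simp
    ultimately show ?case using "3.prems"(2) by auto
  qed auto
  have hd: "(0, int y) \<in> grid M" "(x, int M) \<in> grid M"
    using r(2-5) by (metis hd_in_set subsetD, metis last_in_set subsetD)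
  have "((x, int M), (x, int M + 1)) \<in> path_edges p"
    using path_edges_append[of "(-1, int y) # r" "[(x, int M + 1)]"] r(1,2,4) by auto
  moreover have "set p \<subseteq> {-1..x} \<times> {0..int M + 1}"
  proof
    fix v assume v: "v \<in> set p"
    have "fst v \<le> x" using mono[OF r(6) v] r(1) by simp
    moreover have "v \<in> {-1..} \<times> {0..int M + 1}" using v r(1,5) hd by (auto simp: grid_def)
    ultimately show "v \<in> {-1..x} \<times> {0..int M + 1}" by (cases v) auto
  qed
  ultimately show thesis using that hd by (auto simp: grid_def)
qed

definition row_segment :: "nat \<Rightarrow> nat \<Rightarrow> nat \<Rightarrow> vertex list" where
  "row_segment a b y = map (\<lambda>x. (int x, int y)) [a..<Suc b]"

lemma row_segment:
  assumes "a \<le> b"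
  shows "row_segment a b y \<noteq> []" "hd (row_segment a b y) = (int a, int y)"
    "last (row_segment a b y) = (int b, int y)" "set (row_segment a b y) \<subseteq> {0..} \<times> {int y}"
    "successively up_right_step (row_segment a b y)"
    "((x, j), (x, j + 1)) \<notin> path_edges (row_segment a b y)"
proof -
  show set: "set (row_segment a b y) \<subseteq> {0..} \<times> {int y}" by (auto simp: row_segment_def)
  show "((x, j), (x, j + 1)) \<notin> path_edges (row_segment a b y)"
    using path_edges_in_set[of "(x, j)" "(x, j + 1)" "row_segment a b y"]
      subsetD[OF set, of "(x, j)"] subsetD[OF set, of "(x, j + 1)"] by auto
  show "row_segment a b y \<noteq> []" using assms by (simp add: row_segment_def)
  show "hd (row_segment a b y) = (int a, int y)" "last (row_segment a b y) = (int b, int y)"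
    using assms by (simp_all add: row_segment_def hd_map last_map del: upt_Suc)
  show "successively up_right_step (row_segment a b y)"
    unfolding row_segment_def successively_conv_nth by (auto simp: up_right_step_def simp del: upt_Suc)
qed

text \<open>\<open>c j\<close> is the column in which the path leaves row \<open>j\<close>. Adding a
  row on top, the head of the old exit arrow becomes the first vertex of a new horizontal
  segment.\<close>

lemma up_right_path_exists:
  assumes "1 \<le> y" "y \<le> N" "\<And>j. y \<le> j \<Longrightarrow> j < N \<Longrightarrow> c j \<le> c (Suc j)"
  shows "\<exists>p. up_right_path N y p \<and> last p = (int (c N), int N + 1) \<and>
    (\<forall>x j. ((x, j), (x, j + 1)) \<in> path_edges p \<longleftrightarrow> (\<exists>j'\<in>{y..N}. j = int j' \<and> x = int (c j')))"
  using assms(2,3)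
proof (induction N rule: dec_induct)
  case base
  let ?S = "row_segment 0 (c y) y"
  let ?p = "(-1, int y) # ?S @ [(int (c y), int y + 1)]"
  have seg: "?S \<noteq> []" "hd ?S = (0, int y)" "last ?S = (int (c y), int y)" "set ?S \<subseteq> {0..} \<times> {int y}"
    "successively up_right_step ?S" "\<And>x j. ((x, j), (x, j + 1)) \<notin> path_edges ?S"
    using row_segment[where a = 0 and b = "c y" and y = y] by auto
  have "up_right_path y y ?p"
    unfolding up_right_path_def grid_def using seg assms(1)
    by (intro exI[of _ ?S] exI[of _ "int (c y)"]) auto
  moreover have "path_edges ?p = insert ((-1, int y), (0, int y))
      (insert ((int (c y), int y), (int (c y), int y + 1)) (path_edges ?S))"
    using path_edges_append[of "[(-1, int y)]" "?S @ [(int (c y), int y + 1)]"]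
      path_edges_append[of ?S "[(int (c y), int y + 1)]"] seg by auto
  ultimately show ?case using seg(6) by (intro exI[of _ ?p]) auto
next
  case (step N)
  obtain p where p: "up_right_path N y p" "last p = (int (c N), int N + 1)"
    "\<And>x j. ((x, j), (x, j + 1)) \<in> path_edges p \<longleftrightarrow> (\<exists>j'\<in>{y..N}. j = int j' \<and> x = int (c j'))"
    using step.IH step.prems step.hyps by fastforce
  obtain r x where r: "p = (-1, int y) # r @ [(x, int N + 1)]" "r \<noteq> []" "hd r = (0, int y)"
    "last r = (x, int N)" "set r \<subseteq> grid N" "successively up_right_step p"
    using p(1) by (rule up_right_pathE)
  have x: "x = int (c N)" using p(2) r(1) by simp
  let ?S = "row_segment (c N) (c (Suc N)) (Suc N)"
  let ?t = "(int (c (Suc N)), int (Suc N) + 1)"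
  let ?p = "(-1, int y) # (r @ ?S) @ [?t]"
  have "c N \<le> c (Suc N)" using step by auto
  then have seg: "?S \<noteq> []" "hd ?S = (x, int N + 1)" "last ?S = (int (c (Suc N)), int (Suc N))"
    "set ?S \<subseteq> {0..} \<times> {int (Suc N)}"
    "successively up_right_step ?S" "\<And>x j. ((x, j), (x, j + 1)) \<notin> path_edges ?S"
    using row_segment[where a = "c N" and b = "c (Suc N)" and y = "Suc N"] x by auto
  have "successively up_right_step r"
    using r(6) unfolding r(1) by (auto simp: successively_Cons successively_append_iff)
  then have "successively up_right_step (r @ ?S)"
    using seg r(2,4) by (auto simp: successively_append_iff up_right_step_def)
  moreover have "set (r @ ?S) \<subseteq> grid (Suc N)"
    using r(5) seg(4) unfolding grid_def by auto
  ultimately have "up_right_path (Suc N) y ?p"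
    unfolding up_right_path_def using seg(1,3) r(2,3)
    by (intro exI[of _ "r @ ?S"] exI[of _ "int (c (Suc N))"]) auto
  moreover have "path_edges ?p = insert (last ?S, ?t) (path_edges ?S \<union> path_edges p)"
  proof -
    have "path_edges ?p = path_edges ((-1, int y) # r) \<union> {(last r, hd ?S)} \<union> path_edges ?S \<union> {(last ?S, ?t)}"
      using path_edges_append[of "(-1, int y) # r" "?S @ [?t]"] path_edges_append[of ?S "[?t]"] seg(1) r(2)
      by (auto simp: hd_append)
    moreover have "path_edges p = path_edges ((-1, int y) # r) \<union> {(last r, (x, int N + 1))}"
      using path_edges_append[of "(-1, int y) # r" "[(x, int N + 1)]"] r(1,2) by auto
    ultimately show ?thesis using seg(2) by auto
  qed
  moreover have "(\<exists>j'\<in>{y..Suc N}. j = int j' \<and> x = int (c j')) \<longleftrightarrow>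
      j = int (Suc N) \<and> x = int (c (Suc N)) \<or> (\<exists>j'\<in>{y..N}. j = int j' \<and> x = int (c j'))" for x j
  proof -
    have "{y..Suc N} = insert (Suc N) {y..N}" using step.hyps by auto
    then show ?thesis by simp
  qed
  ultimately show ?case using seg(3,6) p(3) by (intro exI[of _ ?p]) auto
qed

text \<open>The statements about single paths, summed over all paths, become laws for edge counts:
  one arrow enters each row, and flow is conserved at each vertex.\<close>

lemma path_collection_flow:
  assumes "\<omega> \<in> path_collections M"
  shows "finite {e. \<omega> e \<noteq> 0}"
    and "\<omega> (a, b) \<noteq> 0 \<Longrightarrow>
      (\<exists>i j. 0 \<le> i \<and> 1 \<le> j \<and> j \<le> int M \<and> (a = (i, j) \<and> b = (i, j + 1) \<or> a = (i - 1, j) \<and> b = (i, j)))"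
    and "1 \<le> y \<Longrightarrow> y \<le> M \<Longrightarrow> \<omega> ((-1, int y), (0, int y)) = 1"
    and "1 \<le> j \<Longrightarrow> j \<le> int M \<Longrightarrow> 0 \<le> i \<Longrightarrow>
      \<omega> ((i, j - 1), (i, j)) + \<omega> ((i - 1, j), (i, j)) = \<omega> ((i, j), (i, j + 1)) + \<omega> ((i, j), (i + 1, j))"
proof -
  obtain p where \<omega>: "\<omega> = (\<lambda>e. card {y \<in> {1..M}. e \<in> path_edges (p y)})"
    and p: "\<And>y. y \<in> {1..M} \<Longrightarrow> up_right_path M y (p y)"
    using assms unfolding path_collections_def by blast
  have sum: "\<omega> e = (\<Sum>y\<in>{1..M}. of_bool (e \<in> path_edges (p y)))" for e
    unfolding \<omega> by (simp add: sum.If_cases of_bool_def Int_def)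
  have pos: "\<exists>y\<in>{1..M}. e \<in> path_edges (p y)" if "\<omega> e \<noteq> 0" for e
    using that unfolding sum by (meson of_bool_eq_0_iff sum.neutral)
  have "{e. \<omega> e \<noteq> 0} \<subseteq> (\<Union>y\<in>{1..M}. path_edges (p y))" using pos by auto
  then show "finite {e. \<omega> e \<noteq> 0}" by (rule finite_subset) (simp add: finite_path_edges)
  show "\<exists>i j. 0 \<le> i \<and> 1 \<le> j \<and> j \<le> int M \<and> (a = (i, j) \<and> b = (i, j + 1) \<or> a = (i - 1, j) \<and> b = (i, j))"
    if "\<omega> (a, b) \<noteq> 0"
    using pos[OF that] up_right_path_edges(2)[OF p] by blast
  show "\<omega> ((-1, int y), (0, int y)) = 1" if "1 \<le> y" "y \<le> M"
  proof -
    have "{y' \<in> {1..M}. ((-1, int y), (0, int y)) \<in> path_edges (p y')} = {y}"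
      using up_right_path_edges(1)[OF p] that by auto
    then show ?thesis unfolding \<omega> by simp
  qed
  show "\<omega> ((i, j - 1), (i, j)) + \<omega> ((i - 1, j), (i, j)) = \<omega> ((i, j), (i, j + 1)) + \<omega> ((i, j), (i + 1, j))"
    if "1 \<le> j" "j \<le> int M" "0 \<le> i"
    unfolding sum sum.distrib[symmetric]
    using up_right_path_edges(3)[OF p that] by (intro sum.cong) auto
qed

section \<open>Counting functions and interlacing of consecutive rows\<close>

definition count_below :: "nat set \<Rightarrow> nat \<Rightarrow> nat" where
  "count_below U x = card (U \<inter> {..<x})"

lemma count_below_0 [simp]: "count_below U 0 = 0"
  by (simp add: count_below_def)

lemma count_below_Suc: "count_below U (Suc x) = count_below U x + of_bool (x \<in> U)"
proof -
  have "U \<inter> {..<Suc x} = (if x \<in> U then insert x (U \<inter> {..<x}) else U \<inter> {..<x})"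
    by (auto simp: less_Suc_eq)
  then show ?thesis by (simp add: count_below_def)
qed

lemma count_below_eq_card: "U \<subseteq> {..<x} \<Longrightarrow> count_below U x = card U"
  by (simp add: count_below_def Int_absorb2)

text \<open>The path collection whose vertical edges leaving row \<open>y\<close> are those in the columns \<open>R y\<close>.\<close>

definition row_collection :: "nat \<Rightarrow> (nat \<Rightarrow> nat set) \<Rightarrow> path_collection" where
  "row_collection N R e =
     (let (x, y) = fst e; (x', y') = snd e in
      if x' = x \<and> y' = y + 1 \<and> 0 \<le> x \<and> 1 \<le> y \<and> y \<le> int N then of_bool (nat x \<in> R (nat y))
      else if y' = y \<and> x' = x + 1 \<and> 0 \<le> x' \<and> 1 \<le> y \<and> y \<le> int N
        then 1 + count_below (R (nat y - 1)) (nat x') - count_below (R (nat y)) (nat x')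
      else 0)"

lemma row_collection_simps:
  "1 \<le> j \<Longrightarrow> j \<le> N \<Longrightarrow> row_collection N R ((int x, int j), (int x, int j + 1)) = of_bool (x \<in> R j)"
  "1 \<le> j \<Longrightarrow> j \<le> N \<Longrightarrow> row_collection N R ((int x - 1, int j), (int x, int j))
     = 1 + count_below (R (j - 1)) x - count_below (R j) x"
  by (simp_all add: row_collection_def)

text \<open>Conservation at the vertices, summed from the left end of the row: the horizontal flow
  is the entering arrow plus what came from below minus what left upwards. The form without
  subtraction avoids truncation in \<open>nat\<close>.\<close>

lemma path_collection_horizontal:
  assumes \<omega>: "\<omega> \<in> path_collections N" and R0: "R 0 = {}"
    and vert: "\<And>x j. 1 \<le> j \<Longrightarrow> j \<le> N \<Longrightarrow> \<omega> ((int x, int j), (int x, int j + 1)) = of_bool (x \<in> R j)"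
    and j: "1 \<le> j" "j \<le> N"
  shows "\<omega> ((int x - 1, int j), (int x, int j)) + count_below (R j) x = 1 + count_below (R (j - 1)) x"
proof (induction x)
  case 0
  then show ?case using path_collection_flow(3)[OF \<omega> j] by simp
next
  case (Suc x)
  have "\<omega> ((int x, int j - 1), (int x, int j)) = of_bool (x \<in> R (j - 1))"
  proof (cases "j = 1")
    case True
    have "\<omega> ((int x, 0), (int x, 1)) = 0"
      by (rule ccontr) (use path_collection_flow(2)[OF \<omega>, of "(int x, 0)" "(int x, 1)"] in auto)
    then show ?thesis using True R0 by simp
  next
    case False
    then obtain j' where j': "j = Suc j'" "1 \<le> j'" using j by (cases j) auto
    then show ?thesis using vert[of j' x] j by (simp add: add.commute)
  qed
  moreover have "\<omega> ((int x, int j), (int x, int j + 1)) = of_bool (x \<in> R j)" using vert j by auto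
  moreover have "\<omega> ((int x, int j - 1), (int x, int j)) + \<omega> ((int x - 1, int j), (int x, int j))
      = \<omega> ((int x, int j), (int x, int j + 1)) + \<omega> ((int (Suc x) - 1, int j), (int (Suc x), int j))"
  proof -
    have "int (Suc x) - 1 = int x" "int (Suc x) = int x + 1" by auto
    then show ?thesis using path_collection_flow(4)[OF \<omega>, of "int j" "int x"] j by (simp add: add.commute[of 1])
  qed
  ultimately show ?case using Suc.IH unfolding count_below_Suc by linarith
qed

lemma path_collection_eq_row_collection:
  assumes \<omega>: "\<omega> \<in> path_collections N" and R0: "R 0 = {}"
    and vert: "\<And>x j. 1 \<le> j \<Longrightarrow> j \<le> N \<Longrightarrow> \<omega> ((int x, int j), (int x, int j + 1)) = of_bool (x \<in> R j)"
  shows "\<omega> = row_collection N R"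
proof
  fix e :: edge
  obtain x y x' y' where e: "e = ((x, y), (x', y'))" by (metis surj_pair)
  consider (v) "x' = x" "y' = y + 1" "0 \<le> x" "1 \<le> y" "y \<le> int N"
    | (h) "y' = y" "x' = x + 1" "0 \<le> x'" "1 \<le> y" "y \<le> int N"
    | (n) "\<not> (x' = x \<and> y' = y + 1 \<and> 0 \<le> x \<and> 1 \<le> y \<and> y \<le> int N)"
      "\<not> (y' = y \<and> x' = x + 1 \<and> 0 \<le> x' \<and> 1 \<le> y \<and> y \<le> int N)" by blast
  then show "\<omega> e = row_collection N R e"
  proof cases
    case v
    then show ?thesis using vert[of "nat y" "nat x"] by (simp add: e row_collection_def nat_le_iff)
  next
    case h
    then have "1 \<le> nat y" "nat y \<le> N" by linarith+
    from path_collection_horizontal[OF assms this, of "nat x'"]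
    have "\<omega> ((int (nat x') - 1, int (nat y)), (int (nat x'), int (nat y)))
        = 1 + count_below (R (nat y - 1)) (nat x') - count_below (R (nat y)) (nat x')"
      by linarith
    then show ?thesis using h by (simp add: e row_collection_def)
  next
    case n
    then have "\<omega> e = 0" using path_collection_flow(2)[OF \<omega>, of "(x, y)" "(x', y')"] e by fastforce
    moreover have "row_collection N R e = 0" using n by (auto simp: e row_collection_def)
    ultimately show ?thesis by simp
  qed
qed

text \<open>The bounds say that \<open>1 + count_below D x - count_below U x\<close>, the number of
  paths on the horizontal edge into column \<open>x\<close>, is 0 or 1; the cardinalities say that
  it is 0 far to the right.\<close>

definition interlaced :: "nat set \<Rightarrow> nat set \<Rightarrow> bool" where
  "interlaced D U \<longleftrightarrow> finite D \<and> finite U \<and> card U = Suc (card D) \<and>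
     (\<forall>x. count_below D x \<le> count_below U x \<and> count_below U x \<le> Suc (count_below D x))"

text \<open>Let \<open>x\<close> be the element of \<open>D\<close> with index \<open>i\<close> in
  decreasing order. If that of \<open>U\<close> were below \<open>x\<close>, then \<open>U\<close>
  would have at least \<open>card U - i\<close> elements below \<open>x\<close> and \<open>D\<close>
  at most \<open>card D - Suc i\<close>, a difference of at least two.\<close>

lemma interlaced_positions:
  assumes "interlaced D U" "i < card D"
  shows "rev (sorted_list_of_set D) ! i \<le> rev (sorted_list_of_set U) ! i"
proof -
  have fin: "finite D" "finite U" and card: "card U = Suc (card D)"
    using assms by (auto simp: interlaced_def)
  have above: "card (A \<inter> {..<x}) \<le> card A - Suc i" if "finite A" "i < card A" "x \<le> rev (sorted_list_of_set A) ! i"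
    for A and x :: nat
  proof -
    let ?l = "rev (sorted_list_of_set A)"
    have len: "length ?l = card A" by simp
    have "sorted_wrt (>) ?l" by (simp add: sorted_wrt_rev)
    then have anti: "?l ! i \<le> ?l ! i'" if "i' \<le> i" for i'
      using that \<open>i < card A\<close> len by (cases "i' = i") (auto simp: sorted_wrt_iff_nth_less intro: less_imp_le)
    have "(\<lambda>i'. ?l ! i') ` {..i} \<subseteq> A - {..<x}"
    proof
      fix a assume "a \<in> (\<lambda>i'. ?l ! i') ` {..i}"
      then obtain i' where i': "i' \<le> i" "a = ?l ! i'" by auto
      then have "a \<in> set ?l" using that(2) len by (metis le_less_trans nth_mem)
      then show "a \<in> A - {..<x}" using that(1,3) anti[OF i'(1)] i'(2) by auto
    qed
    moreover have "inj_on (\<lambda>i'. ?l ! i') {..i}"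
      using that(2) len by (intro inj_on_nth) auto
    ultimately have "Suc i \<le> card (A - {..<x})"
      using that(1) by (metis card_atMost card_image card_mono finite_Diff)
    moreover have "card A = card (A \<inter> {..<x}) + card (A - {..<x})"
      using that(1) by (metis Int_Diff_Un Int_Diff_disjoint card_Un_disjoint finite_Diff finite_Int)
    ultimately show ?thesis by linarith
  qed
  have below: "card A - i \<le> card (A \<inter> {..<x})" if "finite A" "i < card A" "rev (sorted_list_of_set A) ! i < x"
    for A and x :: nat
  proof -
    let ?l = "rev (sorted_list_of_set A)"
    have len: "length ?l = card A" by simp
    have "sorted_wrt (>) ?l" by (simp add: sorted_wrt_rev)
    then have anti: "?l ! i' \<le> ?l ! i" if "i \<le> i'" "i' < card A" for i'
      using that len by (cases "i' = i") (auto simp: sorted_wrt_iff_nth_less intro: less_imp_le)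
    have "(\<lambda>i'. ?l ! i') ` {i..<card A} \<subseteq> A \<inter> {..<x}"
    proof
      fix a assume "a \<in> (\<lambda>i'. ?l ! i') ` {i..<card A}"
      then obtain i' where i': "i \<le> i'" "i' < card A" "a = ?l ! i'" by auto
      then have "a \<in> set ?l" using len by (metis nth_mem)
      then show "a \<in> A \<inter> {..<x}" using that(1,3) anti[OF i'(1,2)] i'(3) by auto
    qed
    moreover have "inj_on (\<lambda>i'. ?l ! i') {i..<card A}"
      using len by (intro inj_on_nth) auto
    ultimately have "card {i..<card A} \<le> card (A \<inter> {..<x})"
      using that(1) by (metis card_image card_mono finite_Int)
    then show ?thesis by simp
  qed
  show ?thesis
  proof (rule ccontr)
    let ?x = "rev (sorted_list_of_set D) ! i"
    assume "\<not> ?thesis"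
    then have "card U - i \<le> count_below U ?x"
      unfolding count_below_def using below[OF fin(2)] assms(2) card by simp
    moreover have "count_below D ?x \<le> card D - Suc i"
      unfolding count_below_def using above[OF fin(1) assms(2)] by simp
    moreover have "count_below U ?x \<le> Suc (count_below D ?x)"
      using assms(1) by (auto simp: interlaced_def)
    ultimately show False using card assms(2) by linarith
  qed
qed

definition interlaced_rows :: "nat \<Rightarrow> (nat \<Rightarrow> nat set) \<Rightarrow> bool" where
  "interlaced_rows N R \<longleftrightarrow> R 0 = {} \<and> (\<forall>j. 1 \<le> j \<and> j \<le> N \<longrightarrow> interlaced (R (j - 1)) (R j))"

lemma interlaced_rows_card:
  assumes "interlaced_rows N R" "j \<le> N"
  shows "finite (R j)" "card (R j) = j"
proof -
  have "finite (R j) \<and> card (R j) = j"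
    using assms(2)
  proof (induction j)
    case 0
    then show ?case using assms(1) by (simp add: interlaced_rows_def)
  next
    case (Suc j)
    have "interlaced (R j) (R (Suc j))"
      using assms(1) Suc.prems unfolding interlaced_rows_def by (metis Suc_le_eq diff_Suc_1 le_add1 plus_1_eq_Suc)
    then show ?case using Suc by (simp add: interlaced_def)
  qed
  then show "finite (R j)" "card (R j) = j" by auto
qed

text \<open>The definition of collections asks for actual paths. The path entering in row
  \<open>y\<close> is made to leave each row \<open>j >= y\<close> through the \<open>y\<close>-th
  largest column of \<open>R j\<close>, so that meeting paths touch and do not cross; interlacing
  ensures that it never has to go left.\<close>

lemma row_collection_in_path_collections:
  assumes R: "interlaced_rows N R"
  shows "row_collection N R \<in> path_collections N"
proof -
  define c where "c y j = rev (sorted_list_of_set (R j)) ! (y - 1)" for y j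
  have "\<exists>p. up_right_path N y p \<and>
    (\<forall>x j. ((x, j), (x, j + 1)) \<in> path_edges p \<longleftrightarrow> (\<exists>j'\<in>{y..N}. j = int j' \<and> x = int (c y j')))"
    if "y \<in> {1..N}" for y
  proof -
    have "c y j \<le> c y (Suc j)" if "y \<le> j" "j < N" for j
    proof -
      have "interlaced (R j) (R (Suc j))"
        using R that unfolding interlaced_rows_def by (metis Suc_le_eq diff_Suc_1 le_add1 plus_1_eq_Suc)
      then show ?thesis
        unfolding c_def using that \<open>y \<in> {1..N}\<close> interlaced_rows_card[OF R, of j]
        by (intro interlaced_positions) auto
    qed
    then show ?thesis using up_right_path_exists[of y N "c y"] that by auto
  qed
  then obtain p where p: "\<And>y. y \<in> {1..N} \<Longrightarrow> up_right_path N y (p y)"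
    "\<And>y x j. y \<in> {1..N} \<Longrightarrow>
       ((x, j), (x, j + 1)) \<in> path_edges (p y) \<longleftrightarrow> (\<exists>j'\<in>{y..N}. j = int j' \<and> x = int (c y j'))"
    by metis
  define \<omega> where "\<omega> = (\<lambda>e. card {y \<in> {1..N}. e \<in> path_edges (p y)})"
  have \<omega>: "\<omega> \<in> path_collections N"
    unfolding \<omega>_def path_collections_def using p(1) by blast
  have "\<omega> = row_collection N R"
  proof (rule path_collection_eq_row_collection[OF \<omega>])
    show "R 0 = {}" using R by (simp add: interlaced_rows_def)
    fix x j :: nat
    assume j: "1 \<le> j" "j \<le> N"
    let ?l = "rev (sorted_list_of_set (R j))"
    have fin: "finite (R j)" and card: "card (R j) = j" using interlaced_rows_card[OF R j(2)] by auto
    have "{y \<in> {1..N}. ((int x, int j), (int x, int j + 1)) \<in> path_edges (p y)} = {y \<in> {1..j}. ?l ! (y - 1) = x}"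
      using j p(2) by (auto simp: c_def)
    also have "card \<dots> = of_bool (x \<in> R j)"
    proof (cases "x \<in> R j")
      case True
      then have "x \<in> set ?l" using fin by simp
      then obtain i where i: "i < length ?l" "?l ! i = x" by (metis in_set_conv_nth)
      have "y = Suc i" if "y \<in> {1..j}" "?l ! (y - 1) = x" for y
      proof -
        have "y - 1 < length ?l" using that(1) card by auto
        then have "y - 1 = i" using i that(2) nth_eq_iff_index_eq[of ?l "y - 1" i] by simp
        then show ?thesis using that(1) by auto
      qed
      then have "{y \<in> {1..j}. ?l ! (y - 1) = x} = {Suc i}" using i card by auto
      then show ?thesis using True by simp
    next
      case False
      have "?l ! (y - 1) \<in> R j" if "y \<in> {1..j}" for y
      proof -
        have "y - 1 < length ?l" using that card by auto
        then show ?thesis using nth_mem fin by (metis set_rev set_sorted_list_of_set)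
      qed
      then have "{y \<in> {1..j}. ?l ! (y - 1) = x} = {}" using False by blast
      then show ?thesis using False by simp
    qed
    finally show "\<omega> ((int x, int j), (int x, int j + 1)) = of_bool (x \<in> R j)" unfolding \<omega>_def .
  qed
  then show ?thesis using \<omega> by simp
qed

lemma row_collection_in_paths_P:
  assumes R: "interlaced_rows N R"
  shows "row_collection N R \<in> paths_P N"
proof -
  have le: "1 + count_below (R (j - 1)) x - count_below (R j) x \<le> 1" if "1 \<le> j" "j \<le> N" for x j
    using R that unfolding interlaced_rows_def interlaced_def by (metis diff_le_self le_diff_conv add_le_cancel_left)
  have "row_collection N R e \<le> 1" for e
  proof -
    obtain x y x' y' where e: "e = ((x, y), (x', y'))" by (metis surj_pair)
    show ?thesis
      using le[of "nat y" "nat x'"] by (auto simp: e row_collection_def nat_le_iff le_nat_iff)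
  qed
  then show ?thesis
    using row_collection_in_path_collections[OF R] by (simp add: paths_P_def)
qed

section \<open>From edge-disjoint collections to rows and signatures\<close>

definition collection_rows :: "nat \<Rightarrow> path_collection \<Rightarrow> nat \<Rightarrow> nat set" where
  "collection_rows N \<omega> j = {x. 1 \<le> j \<and> j \<le> N \<and> \<omega> ((int x, int j), (int x, int j + 1)) \<noteq> 0}"

lemma paths_P_eq_row_collection:
  assumes "\<omega> \<in> paths_P N"
  shows "interlaced_rows N (collection_rows N \<omega>)" "row_collection N (collection_rows N \<omega>) = \<omega>"
proof -
  let ?R = "collection_rows N \<omega>"
  have \<omega>: "\<omega> \<in> path_collections N" and le: "\<And>e. \<omega> e \<le> 1" using assms unfolding paths_P_def by blast+
  have vert: "\<omega> ((int x, int j), (int x, int j + 1)) = of_bool (x \<in> ?R j)" if "1 \<le> j" "j \<le> N" for x j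
    using le[of "((int x, int j), (int x, int j + 1))"] that by (auto simp: collection_rows_def)
  have R0: "?R 0 = {}" by (simp add: collection_rows_def)
  show "row_collection N ?R = \<omega>"
    using path_collection_eq_row_collection[OF \<omega> R0 vert] by simp
  have fin: "finite (?R j)" for j
  proof (rule finite_imageD)
    show "inj_on (\<lambda>x. ((int x, int j), (int x, int j + 1))) (?R j)" by (auto simp: inj_on_def)
    have "(\<lambda>x. ((int x, int j), (int x, int j + 1))) ` ?R j \<subseteq> {e. \<omega> e \<noteq> 0}"
      by (auto simp: collection_rows_def)
    then show "finite ((\<lambda>x. ((int x, int j), (int x, int j + 1))) ` ?R j)"
      using path_collection_flow(1)[OF \<omega>] by (rule finite_subset)
  qed
  show "interlaced_rows N ?R"
    unfolding interlaced_rows_def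
  proof (intro conjI allI impI)
    show "?R 0 = {}" by (rule R0)
    fix j assume j: "1 \<le> j \<and> j \<le> N"
    have hor: "\<omega> ((int x - 1, int j), (int x, int j)) + count_below (?R j) x = 1 + count_below (?R (j - 1)) x" for x
      by (rule path_collection_horizontal[OF \<omega> R0 vert]) (use j in auto)
    have "count_below (?R (j - 1)) x \<le> count_below (?R j) x \<and> count_below (?R j) x \<le> Suc (count_below (?R (j - 1)) x)" for x
      using hor[of x] le[of "((int x - 1, int j), (int x, int j))"] by linarith
    \<comment> \<open>Far to the right the horizontal edge is empty, and both counting functions
      have reached the cardinalities.\<close>
    moreover have "card (?R j) = Suc (card (?R (j - 1)))"
    proof -
      have "finite ((\<lambda>x. ((int x - 1, int j), (int x, int j))) -` {e. \<omega> e \<noteq> 0})"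
        by (rule finite_vimageI[OF path_collection_flow(1)[OF \<omega>]]) (auto simp: inj_on_def)
      then obtain x where x: "?R j \<union> ?R (j - 1) \<union> (\<lambda>x. ((int x - 1, int j), (int x, int j))) -` {e. \<omega> e \<noteq> 0} \<subseteq> {..<x}"
        using finite_nat_bounded[OF finite_UnI[OF finite_UnI[OF fin fin]]] by blast
      then have "x \<notin> (\<lambda>x. ((int x - 1, int j), (int x, int j))) -` {e. \<omega> e \<noteq> 0}" by blast
      then have "\<omega> ((int x - 1, int j), (int x, int j)) = 0" by simp
      then show ?thesis using hor[of x] x by (simp add: count_below_eq_card)
    qed
    ultimately show "interlaced (?R (j - 1)) (?R j)" using fin by (simp add: interlaced_def)
  qed
qed

lemma row_signature_eqI:
  assumes "sorted_wrt (\<ge>) l" "\<And>x. count_list l x = \<omega> ((int x, int j), (int x, int j + 1))"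
  shows "row_signature j \<omega> = l"
  unfolding row_signature_def
proof (rule the_equality)
  fix l' assume l': "sorted_wrt (\<ge>) l' \<and> (\<forall>x. count_list l' x = \<omega> ((int x, int j), (int x, int j + 1)))"
  have "mset l' = mset l" by (intro multiset_eqI) (use assms l' in \<open>simp add: count_mset\<close>)
  then have "mset (rev l') = mset (rev l)" by simp
  moreover have "sorted (rev l')" "sorted (rev l)" using l' assms by (simp_all add: sorted_wrt_rev)
  ultimately have "rev l' = rev l" by (metis properties_for_sort)
  then show "l' = l" by simp
qed (use assms in auto)

lemma row_signature_count:
  assumes "\<omega> \<in> path_collections M"
  shows "count_list (row_signature j \<omega>) x = \<omega> ((int x, int j), (int x, int j + 1))"
proof -
  define f where "f x = \<omega> ((int x, int j), (int x, int j + 1))" for x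
  have "finite ((\<lambda>x. ((int x, int j), (int x, int j + 1))) -` {e. \<omega> e \<noteq> 0})"
    by (rule finite_vimageI[OF path_collection_flow(1)[OF assms]]) (auto simp: inj_on_def)
  then have "finite {x. 0 < f x}" by (simp add: f_def vimage_def)
  then have f: "count (Abs_multiset f) = f" by (rule count_Abs_multiset)
  let ?l = "rev (sorted_list_of_multiset (Abs_multiset f))"
  have count: "count_list ?l x = f x" for x
    by (metis count_list_rev count_mset f mset_sorted_list_of_multiset)
  have "row_signature j \<omega> = ?l"
    using count by (intro row_signature_eqI) (auto simp: f_def sorted_wrt_rev sorted_sorted_list_of_multiset)
  then show ?thesis using count by (simp add: f_def)
qed

lemma row_signature_row_collection:
  assumes "finite (R j)" "1 \<le> j" "j \<le> N"
  shows "row_signature j (row_collection N R) = rev (sorted_list_of_set (R j))"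
  by (rule row_signature_eqI)
    (use assms in \<open>simp_all add: sorted_wrt_rev count_list_distinct row_collection_simps\<close>)

text \<open>A row given by a set has distinct parts, and the last \<open>l\<close> entries of its
  decreasing list are its \<open>l\<close> smallest elements.\<close>

lemma rev_sorted_list_in_Sign_star:
  assumes "finite R" "card R = M" "l \<le> M"
  shows "rev (sorted_list_of_set R) \<in> Sign_star M l \<longleftrightarrow> {..<l} \<subseteq> R"
proof -
  have "rev (sorted_list_of_set R) ! (M - 1 - t) = sorted_list_of_set R ! t" if "t < l" for t
    using that assms by (subst rev_nth) auto
  moreover have "sorted_wrt (>) (rev (sorted_list_of_set R))" "sorted_wrt (\<ge>) (rev (sorted_list_of_set R))"
    by (simp_all add: sorted_wrt_rev)
  ultimately show ?thesis
    using sorted_list_prefix[OF assms(1), of l] assms by (auto simp: Sign_star_def Sign_def)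
qed

subsection \<open>Weights of rows\<close>

definition bits :: "nat \<Rightarrow> nat set \<Rightarrow> bool list" where
  "bits X U = map (\<lambda>x. x \<in> U) [0..<X]"

lemma length_bits [simp]: "length (bits X U) = X"
  by (simp add: bits_def)

lemma bits_Suc: "bits (Suc X) U = bits X U @ [X \<in> U]"
  by (simp add: bits_def)

lemma bits_extend:
  assumes "U \<subseteq> {..<X}"
  shows "bits (X + n) U = bits X U @ replicate n False"
proof (induction n)
  case (Suc n)
  have "X + n \<notin> U" using assms by auto
  then show ?case using Suc by (simp add: bits_Suc replicate_append_same)
qed simp

lemma count_list_take_bits: "x \<le> X \<Longrightarrow> count_list (take x (bits X U)) True = count_below U x"
proof (induction x)
  case (Suc x)
  have "take (Suc x) (bits X U) = take x (bits X U) @ [x \<in> U]"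
    using Suc.prems by (subst take_Suc_conv_app_nth) (auto simp: bits_def)
  then show ?case using Suc by (simp add: count_below_Suc)
qed simp

lemma take_bits_eq_replicate:
  assumes "U \<subseteq> {..<X}"
  shows "take k (bits X U) = replicate k True \<longleftrightarrow> {..<k} \<subseteq> U"
proof
  assume *: "take k (bits X U) = replicate k True"
  have "length (take k (bits X U)) = k" by (simp only: *) simp
  then have "k \<le> X" by simp
  show "{..<k} \<subseteq> U"
  proof
    fix x assume x: "x \<in> {..<k}"
    then have "take k (bits X U) ! x" by (simp add: *)
    then show "x \<in> U" using x \<open>k \<le> X\<close> by (simp add: bits_def)
  qed
next
  assume *: "{..<k} \<subseteq> U"
  then have "{..<k} \<subseteq> {..<X}" using assms by (rule subset_trans)
  then have "k \<le> X" by (simp add: lessThan_subset_iff)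
  then show "take k (bits X U) = replicate k True"
    using * by (intro nth_equalityI) (auto simp: bits_def)
qed

lemma bij_betw_bits: "bij_betw (bits X) (Pow {..<X}) {xs. length xs = X}"
proof (rule bij_betw_byWitness[where f' = "\<lambda>xs. {x. x < X \<and> xs ! x}"])
  show "\<forall>U\<in>Pow {..<X}. {x. x < X \<and> bits X U ! x} = U" by (auto simp: bits_def)
  show "\<forall>xs\<in>{xs. length xs = X}. bits X {x. x < X \<and> xs ! x} = xs"
    by (auto simp: bits_def intro!: nth_equalityI)
qed auto

definition column_bound :: "nat set \<Rightarrow> nat" where
  "column_bound U = Suc (Max (insert 0 U))"

lemma column_bound: "finite U \<Longrightarrow> U \<subseteq> {..<column_bound U}"
  unfolding column_bound_def by (auto simp: less_Suc_eq_le intro: Max_ge)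

lemma interlaced_subset:
  assumes "interlaced D U" "U \<subseteq> {..<X}"
  shows "D \<subseteq> {..<X}"
proof -
  have fin: "finite D" and card: "card U = Suc (card D)"
    and le: "count_below U X \<le> Suc (count_below D X)"
    using assms(1) by (auto simp: interlaced_def)
  have "card D \<le> card (D \<inter> {..<X})"
    using le card assms(2) by (simp add: count_below_eq_card count_below_def[of D])
  then have "D \<inter> {..<X} = D" using fin by (intro card_seteq) auto
  then show ?thesis by auto
qed

section \<open>Lists of interlacing rows\<close>

definition top_row :: "nat set list \<Rightarrow> nat set" where
  "top_row rs = (case rs of [] \<Rightarrow> {} | U # _ \<Rightarrow> U)"

lemma top_row_simps [simp]: "top_row [] = {}" "top_row (U # rs) = U"
  by (simp_all add: top_row_def)

text \<open>A list of rows starts with the topmost row.\<close>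

fun interlaced_list :: "nat set list \<Rightarrow> bool" where
  "interlaced_list [] = True"
| "interlaced_list (U # rs) \<longleftrightarrow> interlaced (top_row rs) U \<and> interlaced_list rs"

definition rows_list :: "nat \<Rightarrow> (nat \<Rightarrow> nat set) \<Rightarrow> nat set list" where
  "rows_list N R = map R (rev [1..<Suc N])"

lemma rows_list_simps [simp]:
  "rows_list 0 R = []" "rows_list (Suc N) R = R (Suc N) # rows_list N R"
  by (simp_all add: rows_list_def)

lemma length_rows_list [simp]: "length (rows_list N R) = N"
  by (simp add: rows_list_def)

lemma top_rows_list: "R 0 = {} \<Longrightarrow> top_row (rows_list N R) = R N"
  by (cases N) auto

lemma rows_list_nth: "i < N \<Longrightarrow> rows_list N R ! i = R (N - i)"
  by (induction N arbitrary: i) (auto simp: nth_Cons split: nat.split)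

lemma drop_rows_list: "n \<le> N \<Longrightarrow> drop (N - n) (rows_list N R) = rows_list n R"
  by (intro nth_equalityI) (auto simp: rows_list_nth)

lemma interlaced_rows_Suc:
  "interlaced_rows (Suc N) R \<longleftrightarrow> interlaced_rows N R \<and> interlaced (R N) (R (Suc N))"
proof -
  have "(\<forall>j. 1 \<le> j \<and> j \<le> Suc N \<longrightarrow> P j) \<longleftrightarrow> (\<forall>j. 1 \<le> j \<and> j \<le> N \<longrightarrow> P j) \<and> P (Suc N)" for P
    by (auto simp: le_Suc_eq)
  then show ?thesis unfolding interlaced_rows_def by simp
qed

lemma interlaced_list_rows_list:
  "R 0 = {} \<Longrightarrow> interlaced_list (rows_list N R) \<longleftrightarrow> interlaced_rows N R"
proof (induction N)
  case 0
  then show ?case by (simp add: interlaced_rows_def)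
next
  case (Suc N)
  then show ?case by (auto simp: interlaced_rows_Suc top_rows_list)
qed

definition row_lists :: "nat \<Rightarrow> nat set list set" where
  "row_lists N = {rs. length rs = N \<and> interlaced_list rs}"

lemma interlaced_list_top_row: "interlaced_list rs \<Longrightarrow> finite (top_row rs) \<and> card (top_row rs) = length rs"
  by (induction rs) (auto simp: interlaced_def)

lemma interlaced_list_drop: "interlaced_list rs \<Longrightarrow> interlaced_list (drop n rs)"
proof (induction rs arbitrary: n)
  case (Cons U rs)
  then show ?case by (cases n) auto
qed simp

lemma top_row_append: "top_row (us @ ls) = (if us = [] then top_row ls else hd us)"
  by (cases us) auto

lemma interlaced_list_append_cong:
  "interlaced_list (us @ ls') \<Longrightarrow> interlaced_list ls \<Longrightarrow> top_row ls = top_row ls' \<Longrightarrow> interlaced_list (us @ ls)"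
  by (induction us) (auto simp: top_row_append)

lemma collection_rows_row_collection:
  "collection_rows N (row_collection N R) j = (if 1 \<le> j \<and> j \<le> N then R j else {})"
  by (auto simp: collection_rows_def row_collection_simps)

text \<open>A collection is determined by its vertical edges, and all interlacing rows arise. Sums
  over collections thus become sums over lists, which can be cut at any level.\<close>

lemma bij_betw_rows_list:
  "bij_betw (\<lambda>\<omega>. rows_list N (collection_rows N \<omega>)) (paths_P N) (row_lists N)"
proof (rule bij_betw_byWitness)
  \<comment> \<open>Row \<open>j\<close> is entry \<open>N - j\<close> of the list; row 0, which the
    list does not contain, is empty.\<close>
  let ?g = "\<lambda>rs. row_collection N (\<lambda>j. if j = 0 \<or> N < j then {} else rs ! (N - j))"
  have R0: "collection_rows N \<omega> 0 = {}" for \<omega> by (simp add: collection_rows_def)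
  have cong: "row_collection N R = row_collection N R'" if RR: "\<And>j. j \<le> N \<Longrightarrow> R j = R' j" for R R'
  proof
    fix e :: edge
    obtain x y x' y' where e: "e = ((x, y), (x', y'))" by (metis surj_pair)
    have "R (nat y) = R' (nat y) \<and> R (nat y - 1) = R' (nat y - 1)" if "y \<le> int N"
      using RR[of "nat y"] RR[of "nat y - 1"] that by auto
    then show "row_collection N R e = row_collection N R' e"
      by (auto simp: row_collection_def e)
  qed
  show "\<forall>\<omega>\<in>paths_P N. ?g (rows_list N (collection_rows N \<omega>)) = \<omega>"
  proof
    fix \<omega> assume \<omega>: "\<omega> \<in> paths_P N"
    have "?g (rows_list N (collection_rows N \<omega>)) = row_collection N (collection_rows N \<omega>)"
      by (rule cong) (auto simp: rows_list_nth R0)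
    then show "?g (rows_list N (collection_rows N \<omega>)) = \<omega>"
      using paths_P_eq_row_collection(2)[OF \<omega>] by simp
  qed
  have rl: "rows_list N (\<lambda>j. if j = 0 \<or> N < j then {} else rs ! (N - j)) = rs" if "length rs = N" for rs
    using that by (intro nth_equalityI) (auto simp: rows_list_nth)
  have int: "interlaced_rows N (\<lambda>j. if j = 0 \<or> N < j then {} else rs ! (N - j))" if "rs \<in> row_lists N" for rs
    using that rl[of rs] interlaced_list_rows_list[of "\<lambda>j. if j = 0 \<or> N < j then {} else rs ! (N - j)" N]
    by (simp add: row_lists_def)
  show "\<forall>rs\<in>row_lists N. rows_list N (collection_rows N (?g rs)) = rs"
  proof
    fix rs assume rs: "rs \<in> row_lists N"
    have "rows_list N (collection_rows N (?g rs)) = rows_list N (\<lambda>j. if j = 0 \<or> N < j then {} else rs ! (N - j))"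
      by (rule nth_equalityI) (auto simp: rows_list_nth collection_rows_row_collection)
    then show "rows_list N (collection_rows N (?g rs)) = rs" using rl rs by (simp add: row_lists_def)
  qed
  show "(\<lambda>\<omega>. rows_list N (collection_rows N \<omega>)) ` paths_P N \<subseteq> row_lists N"
    using paths_P_eq_row_collection(1) R0 by (auto simp: row_lists_def interlaced_list_rows_list)
  show "?g ` row_lists N \<subseteq> paths_P N"
    using row_collection_in_paths_P[OF int] by blast
qed

text \<open>The exit columns lie below \<open>k\<close>, so no path leaves a finite box, and every
  edge carries at most \<open>k\<close> paths.\<close>

lemma finite_F_paths: "finite (F_paths k (rev [0..<k]))"
proof -
  define V :: "vertex set" where "V = {-1..int k} \<times> {0..int k + 1}"
  have "F_paths k (rev [0..<k]) \<subseteq> {\<omega>. \<forall>e. (e \<in> V \<times> V \<longrightarrow> \<omega> e \<in> {..k}) \<and> (e \<notin> V \<times> V \<longrightarrow> \<omega> e = 0)}"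
  proof
    fix \<omega> assume F: "\<omega> \<in> F_paths k (rev [0..<k])"
    then have pc: "\<omega> \<in> path_collections k" and stair: "row_signature k \<omega> = rev [0..<k]"
      by (auto simp: F_paths_def)
    obtain p where \<omega>: "\<omega> = (\<lambda>e. card {y \<in> {1..k}. e \<in> path_edges (p y)})"
      and p: "\<And>y. y \<in> {1..k} \<Longrightarrow> up_right_path k y (p y)"
      using pc unfolding path_collections_def by blast
    have pos: "\<omega> e \<noteq> 0 \<longleftrightarrow> (\<exists>y\<in>{1..k}. e \<in> path_edges (p y))" for e
      by (auto simp: \<omega>)
    have sub: "set (p y) \<subseteq> V" if y: "y \<in> {1..k}" for y
    proof -
      obtain x where x: "0 \<le> x" "((x, int k), (x, int k + 1)) \<in> path_edges (p y)"
          "set (p y) \<subseteq> {-1..x} \<times> {0..int k + 1}"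
        using up_right_path_bounds[OF p[OF y]] .
      have "\<omega> ((int (nat x), int k), (int (nat x), int k + 1)) \<noteq> 0" using x y pos by auto
      then have "count_list (rev [0..<k]) (nat x) \<noteq> 0"
        using row_signature_count[OF pc, of k "nat x"] stair by simp
      then have "nat x < k" by (simp add: count_list_0_iff)
      then show ?thesis using x(1,3) unfolding V_def by fastforce
    qed
    have "\<omega> e = 0" if "e \<notin> V \<times> V" for e
    proof (rule ccontr)
      assume "\<omega> e \<noteq> 0"
      then obtain y where y: "y \<in> {1..k}" "e \<in> path_edges (p y)" using pos by blast
      then have "e \<in> set (p y) \<times> set (p y)" using path_edges_in_set by (cases e) auto
      then show False using sub[OF y(1)] that by blast
    qed
    moreover have "\<omega> e \<le> k" for e
    proof -
      have "\<omega> e \<le> card {1..k}" unfolding \<omega> by (intro card_mono) auto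
      then show ?thesis by simp
    qed
    ultimately show "\<omega> \<in> {\<omega>. \<forall>e. (e \<in> V \<times> V \<longrightarrow> \<omega> e \<in> {..k}) \<and> (e \<notin> V \<times> V \<longrightarrow> \<omega> e = 0)}" by auto
  qed
  moreover have "finite \<dots>"
    by (rule finite_set_of_finite_funs) (auto simp: V_def)
  ultimately show ?thesis by (rule finite_subset)
qed

context generic_spin
begin

lemma row_wt_trailing:
  "length low = length up \<Longrightarrow>
     row_wt u h (low @ replicate n False) (up @ replicate n False) = row_wt u h low up"
proof (induction low up arbitrary: h rule: list_induct2)
  case Nil
  show ?case by (induction n) auto
qed auto

text \<open>Vertices conserve paths and horizontal edges hold at most one, so a nonzero weight
  forces interlacing. Sums over interlacing rows may therefore be extended to all bit lists.\<close>

lemma row_wt_nonzero_count: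
  assumes "row_wt u h low up \<noteq> 0"
  shows "of_bool h + count_list low True = count_list up True"
    and "count_list (take n up) True \<le> of_bool h + count_list (take n low) True"
    and "of_bool h + count_list (take n low) True \<le> Suc (count_list (take n up) True)"
proof -
  have "of_bool h + count_list low True = count_list up True \<and>
    (\<forall>n. count_list (take n up) True \<le> of_bool h + count_list (take n low) True
       \<and> of_bool h + count_list (take n low) True \<le> Suc (count_list (take n up) True))"
    using assms
  proof (induction u h low up rule: row_wt.induct)
    case (1 u h l ls a as)
    show ?case
      using 1 by (cases h; cases l; cases a) (auto simp: take_Cons split: nat.splits)
  qed auto
  then show "of_bool h + count_list low True = count_list up True"
    "count_list (take n up) True \<le> of_bool h + count_list (take n low) True"
    "of_bool h + count_list (take n low) True \<le> Suc (count_list (take n up) True)"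
    by blast+
qed

definition row_weight :: "complex \<Rightarrow> nat set \<Rightarrow> nat set \<Rightarrow> complex" where
  "row_weight u D U =
     (let X = column_bound (D \<union> U) in row_wt u True (bits X D) (bits X U))"

text \<open>Empty columns on the right do not change the weight, so two windows are compared inside
  the one whose width is the sum of theirs.\<close>

lemma row_weight_eq:
  assumes "D \<subseteq> {..<X}" "U \<subseteq> {..<X}"
  shows "row_weight u D U = row_wt u True (bits X D) (bits X U)"
proof -
  let ?Y = "column_bound (D \<union> U)"
  have "finite (D \<union> U)" using assms finite_subset by blast
  then have DU: "D \<subseteq> {..<?Y}" "U \<subseteq> {..<?Y}" using column_bound[of "D \<union> U"] by auto
  have "row_wt u True (bits (X + ?Y) D) (bits (X + ?Y) U) = row_wt u True (bits X D) (bits X U)"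
    using assms by (simp add: bits_extend row_wt_trailing)
  moreover have "row_wt u True (bits (?Y + X) D) (bits (?Y + X) U) = row_wt u True (bits ?Y D) (bits ?Y U)"
    using DU by (simp add: bits_extend row_wt_trailing)
  ultimately show ?thesis by (simp add: row_weight_def Let_def add.commute)
qed

lemma row_weight_nonzero:
  assumes "finite D" "finite U" "row_weight u D U \<noteq> 0"
  shows "interlaced D U"
proof -
  obtain X where X: "D \<subseteq> {..<X}" "U \<subseteq> {..<X}"
    using finite_nat_bounded[of "D \<union> U"] assms by auto
  have nz: "row_wt u True (bits Y D) (bits Y U) \<noteq> 0" if "X \<le> Y" for Y
  proof -
    have "{..<X} \<subseteq> {..<Y}" using that by auto
    then have "D \<subseteq> {..<Y}" "U \<subseteq> {..<Y}" using X(1,2) subset_trans by metis+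
    then show ?thesis using assms(3) row_weight_eq[of D Y U u] by simp
  qed
  have "count_below D x \<le> count_below U x \<and> count_below U x \<le> Suc (count_below D x)" for x
    using row_wt_nonzero_count(2,3)[OF nz[of "max X x"], of x] by (simp add: count_list_take_bits)
  moreover have "card U = Suc (card D)"
    using row_wt_nonzero_count(1)[OF nz[of X]] count_list_take_bits[of X X] X
    by (simp add: count_below_eq_card)
  ultimately show ?thesis using assms by (simp add: interlaced_def)
qed

text \<open>Uses \<open>s * q = 1 / s\<close>: then \<open>u - s * q = - (1 - s * u) / s\<close> and
  \<open>1 - s * q * u = - (u - s) / s\<close>.\<close>

lemma vertex_weight_simps:
  assumes "s * u \<noteq> 1"
  shows "vertex_weight s q u (0, 0, 0, 0) = 1"
    "vertex_weight s q u (Suc 0, 0, Suc 0, 0) = - (1 / s) * hop u"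
    "vertex_weight s q u (Suc 0, 0, 0, Suc 0) = emit u"
    "vertex_weight s q u (0, Suc 0, 0, Suc 0) = hop u"
    "vertex_weight s q u (Suc 0, Suc 0, Suc 0, Suc 0) = - (1 / s)"
    "vertex_weight s q u (0, Suc 0, Suc 0, 0) = absorb u"
proof -
  have sq: "s * q = 1 / s" unfolding q_eq using s_nonzero by (simp add: power2_eq_square)
  show "vertex_weight s q u (Suc 0, 0, Suc 0, 0) = - (1 / s) * hop u"
    "vertex_weight s q u (Suc 0, Suc 0, Suc 0, Suc 0) = - (1 / s)"
    using s_nonzero assms by (auto simp: sq hop_def divide_simps)
qed (use assms in \<open>auto simp: hop_def emit_def absorb_def\<close>)

text \<open>The only admissible drop of this kind is from 2 to 1, whose weight contains the factor
  \<open>1 - s^2 * q = 0\<close>.\<close>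

lemma vertex_weight_descend_zero: "2 \<le> i \<Longrightarrow> i' \<le> 1 \<Longrightarrow> vertex_weight s q u (i, j, i', j') = 0"
  using s_nonzero q_eq by (cases "i' = 1") auto

declare vertex_weight.simps [simp del]

lemma row_wt_prod:
  assumes "s * u \<noteq> 1"
    and "\<And>x. x < X \<Longrightarrow> of_bool (lo x) + hs x = of_bool (up x) + hs (Suc x)"
    and "\<And>x. hs x \<le> 1" "hs X = 0"
  shows "row_wt u (hs 0 = 1) (map lo [0..<X]) (map up [0..<X])
    = (\<Prod>x<X. vertex_weight s q u (of_bool (lo x), hs x, of_bool (up x), hs (Suc x)))"
  using assms(2-)
proof (induction X arbitrary: lo hs up)
  case 0
  then show ?case by simp
next
  case (Suc X)
  have IH: "row_wt u (hs (Suc 0) = 1) (map (lo \<circ> Suc) [0..<X]) (map (up \<circ> Suc) [0..<X])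
    = (\<Prod>x<X. vertex_weight s q u (of_bool (lo (Suc x)), hs (Suc x), of_bool (up (Suc x)), hs (Suc (Suc x))))"
    using Suc.IH[of "lo \<circ> Suc" "hs \<circ> Suc" "up \<circ> Suc"] Suc.prems by (simp add: o_def)
  have shift: "map g [0..<Suc X] = g 0 # map (g \<circ> Suc) [0..<X]" for g :: "nat \<Rightarrow> bool"
    by (simp add: upt_conv_Cons map_Suc_upt[symmetric] del: upt_Suc)
  have "hs 0 = 0 \<or> hs 0 = 1" "hs 1 = 0 \<or> hs 1 = 1" using Suc.prems(2)[of 0] Suc.prems(2)[of 1] by auto
  moreover have "of_bool (lo 0) + hs 0 = of_bool (up 0) + hs 1" using Suc.prems(1)[of 0] by simp
  ultimately show ?case
    unfolding shift prod.lessThan_Suc_shift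
    using IH vertex_weight_simps[OF assms(1)]
    by (cases "lo 0"; cases "up 0") (auto simp del: vertex_weight.simps)
qed

lemma row_weight_prod:
  assumes "interlaced D U" "U \<subseteq> {..<X}" "s * u \<noteq> 1"
  shows "row_weight u D U = (\<Prod>x<X. vertex_weight s q u
     (of_bool (x \<in> D), 1 + count_below D x - count_below U x,
      of_bool (x \<in> U), 1 + count_below D (Suc x) - count_below U (Suc x)))"
proof -
  have D: "D \<subseteq> {..<X}" using interlaced_subset[OF assms(1,2)] .
  have le: "count_below D x \<le> count_below U x" "count_below U x \<le> Suc (count_below D x)" for x
    using assms(1) by (auto simp: interlaced_def)
  define hs where "hs x = 1 + count_below D x - count_below U x" for x
  have "row_weight u D U = row_wt u (hs 0 = 1) (map (\<lambda>x. x \<in> D) [0..<X]) (map (\<lambda>x. x \<in> U) [0..<X])"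
    using row_weight_eq[OF D assms(2)] by (simp add: bits_def hs_def)
  also have "\<dots> = (\<Prod>x<X. vertex_weight s q u (of_bool (x \<in> D), hs x, of_bool (x \<in> U), hs (Suc x)))"
  proof (rule row_wt_prod[OF assms(3)])
    show "of_bool (x \<in> D) + hs x = of_bool (x \<in> U) + hs (Suc x)" for x
      using le[of x] le[of "Suc x"] unfolding hs_def count_below_Suc by linarith
    show "hs x \<le> 1" for x using le[of x] unfolding hs_def by linarith
    show "hs X = 0" using assms(1,2) D by (simp add: hs_def count_below_eq_card interlaced_def)
  qed
  finally show ?thesis unfolding hs_def .
qed

fun rows_wt :: "(nat \<Rightarrow> complex) \<Rightarrow> nat set list \<Rightarrow> complex" where
  "rows_wt z [] = 1"
| "rows_wt z (U # rs) = row_weight (z (Suc (length rs))) (top_row rs) U * rows_wt z rs"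

lemma rows_wt_rows_list:
  "R 0 = {} \<Longrightarrow> rows_wt z (rows_list N R) = (\<Prod>j = 1..N. row_weight (z j) (R (j - 1)) (R j))"
  by (induction N) (auto simp: top_rows_list mult.commute)

text \<open>Only finitely many edges are used, and empty vertices have weight 1. Stating this for
  all large \<open>Y\<close> lets the bound be combined with others.\<close>

lemma collection_weight_prodinf:
  assumes "\<omega> \<in> path_collections M" "\<And>j. j \<in> {1..M} \<Longrightarrow> s * z j \<noteq> 1"
  shows "\<exists>X. \<forall>Y\<ge>X. collection_weight s q M z \<omega>
    = (\<Prod>i<Y. \<Prod>j = 1..M. vertex_weight s q (z j) (arrows \<omega> (int i) (int j)))"
proof -
  let ?E = "{e. \<omega> e \<noteq> 0}"
  have fin: "finite ((\<lambda>e. nat (fst (fst e))) ` ?E \<union> (\<lambda>e. nat (fst (snd e))) ` ?E)"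
    using path_collection_flow(1)[OF assms(1)] by simp
  obtain X where X: "(\<lambda>e. nat (fst (fst e))) ` ?E \<union> (\<lambda>e. nat (fst (snd e))) ` ?E \<subseteq> {..<X}"
    using finite_nat_bounded[OF fin] by blast
  have zero: "arrows \<omega> (int i) (int j) = (0, 0, 0, 0)" if "X \<le> i" for i j
  proof -
    have "\<omega> e = 0" if "nat (fst (fst e)) = i \<or> nat (fst (snd e)) = i" for e
    proof (rule ccontr)
      assume "\<omega> e \<noteq> 0"
      then have "nat (fst (fst e)) \<in> {..<X}" "nat (fst (snd e)) \<in> {..<X}" using subsetD[OF X] by auto
      then show False using that \<open>X \<le> i\<close> by auto
    qed
    then show ?thesis by (simp add: arrows_def)
  qed
  have "collection_weight s q M z \<omega>
      = (\<Prod>i<Y. \<Prod>j = 1..M. vertex_weight s q (z j) (arrows \<omega> (int i) (int j)))" if "X \<le> Y" for Y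
    unfolding collection_weight_def
  proof (rule prodinf_finite)
    fix i assume "i \<notin> {..<Y}"
    then show "(\<Prod>j = 1..M. vertex_weight s q (z j) (arrows \<omega> (int i) (int j))) = 1"
      using zero[of i] that assms(2) by (intro prod.neutral) (auto simp: vertex_weight_simps)
  qed simp
  then show ?thesis by blast
qed

lemma collection_weight_rows:
  assumes \<omega>: "\<omega> \<in> paths_P M" and z: "\<And>j. j \<in> {1..M} \<Longrightarrow> s * z j \<noteq> 1"
  shows "collection_weight s q M z \<omega> = rows_wt z (rows_list M (collection_rows M \<omega>))"
proof -
  define R where "R = collection_rows M \<omega>"
  have R: "interlaced_rows M R" "row_collection M R = \<omega>"
    using paths_P_eq_row_collection[OF \<omega>] by (simp_all add: R_def)
  have R0: "R 0 = {}" using R(1) by (simp add: interlaced_rows_def)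
  obtain X where X: "\<And>Y. X \<le> Y \<Longrightarrow> collection_weight s q M z \<omega>
      = (\<Prod>i<Y. \<Prod>j = 1..M. vertex_weight s q (z j) (arrows \<omega> (int i) (int j)))"
    using collection_weight_prodinf[of \<omega> M z] \<omega> z unfolding paths_P_def by blast
  have "finite (\<Union>j\<le>M. R j)" using interlaced_rows_card(1)[OF R(1)] by auto
  then obtain X' where X': "(\<Union>j\<le>M. R j) \<subseteq> {..<X'}" using finite_nat_bounded by blast
  define Y where "Y = max X X'"
  have arrows: "arrows \<omega> (int i) (int j)
      = (of_bool (i \<in> R (j - 1)), 1 + count_below (R (j - 1)) i - count_below (R j) i,
         of_bool (i \<in> R j), 1 + count_below (R (j - 1)) (Suc i) - count_below (R j) (Suc i))"
    if j: "j \<in> {1..M}" for i j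
  proof -
    have "\<omega> ((int i, int j - 1), (int i, int j)) = of_bool (i \<in> R (j - 1))"
    proof (cases "j = 1")
      case True
      then show ?thesis using R0 by (simp add: R(2)[symmetric] row_collection_def)
    next
      case False
      then obtain j' where "j = Suc j'" "1 \<le> j'" using j by (cases j) auto
      then show ?thesis
        using row_collection_simps(1)[of j' M R i] j by (simp add: R(2) add.commute)
    qed
    moreover have "\<omega> ((int i, int j), (int i + 1, int j))
        = 1 + count_below (R (j - 1)) (Suc i) - count_below (R j) (Suc i)"
      using row_collection_simps(2)[of j M R "Suc i"] j by (simp add: R(2) add.commute)
    ultimately show ?thesis
      using row_collection_simps[of j M R i] j by (simp add: arrows_def R(2))
  qed
  have "collection_weight s q M z \<omega>
      = (\<Prod>j = 1..M. \<Prod>i<Y. vertex_weight s q (z j) (arrows \<omega> (int i) (int j)))"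
    by (subst X[of Y]) (simp add: Y_def, rule prod.swap)
  also have "\<dots> = (\<Prod>j = 1..M. row_weight (z j) (R (j - 1)) (R j))"
  proof (intro prod.cong refl)
    fix j assume j: "j \<in> {1..M}"
    have "R j \<subseteq> (\<Union>j\<le>M. R j)" using j by auto
    then have "R j \<subseteq> {..<X'}" using X' by (rule subset_trans)
    then have sub: "R j \<subseteq> {..<Y}" unfolding Y_def by (rule subset_trans) auto
    have "interlaced (R (j - 1)) (R j)" using R(1) j by (auto simp: interlaced_rows_def)
    then show "(\<Prod>i<Y. vertex_weight s q (z j) (arrows \<omega> (int i) (int j))) = row_weight (z j) (R (j - 1)) (R j)"
      using row_weight_prod[OF _ sub z[OF j]] by (simp add: arrows[OF j])
  qed
  finally show ?thesis using rows_wt_rows_list[of R z M] R0 by (simp add: R_def)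
qed

lemma finite_row_lists_top: "finite {rs \<in> row_lists n. top_row rs \<subseteq> {..<X}}"
proof (induction n)
  case 0
  have "{rs \<in> row_lists 0. top_row rs \<subseteq> {..<X}} \<subseteq> {[]}" by (auto simp: row_lists_def)
  then show ?case by (rule finite_subset) simp
next
  case (Suc n)
  have "{rs \<in> row_lists (Suc n). top_row rs \<subseteq> {..<X}}
      \<subseteq> (\<lambda>(U, rs). U # rs) ` (Pow {..<X} \<times> {rs \<in> row_lists n. top_row rs \<subseteq> {..<X}})"
  proof
    fix rs assume rs: "rs \<in> {rs \<in> row_lists (Suc n). top_row rs \<subseteq> {..<X}}"
    then obtain U rs' where U: "rs = U # rs'" by (auto simp: row_lists_def length_Suc_conv)
    moreover have "top_row rs' \<subseteq> {..<X}"
      using rs interlaced_subset[of "top_row rs'" U X] by (auto simp: U row_lists_def)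
    ultimately show "rs \<in> (\<lambda>(U, rs). U # rs) ` (Pow {..<X} \<times> {rs \<in> row_lists n. top_row rs \<subseteq> {..<X}})"
      using rs by (intro image_eqI[of _ _ "(U, rs')"]) (auto simp: row_lists_def)
  qed
  then show ?case by (rule finite_subset) (use Suc in auto)
qed

lemma finite_row_lists_top_eq: "finite {rs \<in> row_lists n. top_row rs = U}"
proof (cases "finite U")
  case True
  then show ?thesis
    using finite_subset[OF _ finite_row_lists_top[of n "column_bound U"], of "{rs \<in> row_lists n. top_row rs = U}"]
      column_bound[of U] by auto
next
  case False
  then have "{rs \<in> row_lists n. top_row rs = U} = {}"
    using interlaced_list_top_row by (auto simp: row_lists_def)
  then show ?thesis by (metis finite.emptyI)
qed

text \<open>The part below a cut, summed with its upper boundary \<open>U\<close> fixed, is the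
  function \<open>F\<close> of the signature given by \<open>U\<close>; it is finite because the top
  row bounds all lower ones.\<close>

lemma sum_rows_wt:
  assumes "U \<subseteq> {..<X}"
  shows "(\<Sum>rs | rs \<in> row_lists n \<and> top_row rs = U. rows_wt z rs)
    = stack_wt (map z (rev [1..<Suc n])) (bits X U)"
  using assms
proof (induction n arbitrary: U)
  case 0
  have "{rs. rs \<in> row_lists 0 \<and> top_row rs = U} = (if U = {} then {[]} else {})"
    by (auto simp: row_lists_def)
  moreover have "True \<notin> set (bits X U) \<longleftrightarrow> U = {}" using 0 by (auto simp: bits_def image_iff)
  ultimately show ?case by simp
next
  case (Suc n)
  let ?L = "\<lambda>D. {rs. rs \<in> row_lists n \<and> top_row rs = D}"
  have fin: "finite U" using Suc.prems finite_subset by blast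
  have "{rs. rs \<in> row_lists (Suc n) \<and> top_row rs = U}
      = (\<lambda>rs. U # rs) ` (\<Union>D\<in>{D \<in> Pow {..<X}. interlaced D U}. ?L D)"
    using interlaced_subset[OF _ Suc.prems] by (auto simp: row_lists_def length_Suc_conv)
  then have "(\<Sum>rs | rs \<in> row_lists (Suc n) \<and> top_row rs = U. rows_wt z rs)
      = (\<Sum>rs\<in>(\<Union>D\<in>{D \<in> Pow {..<X}. interlaced D U}. ?L D). rows_wt z (U # rs))"
    by (simp add: sum.reindex)
  also have "\<dots> = (\<Sum>D\<in>{D \<in> Pow {..<X}. interlaced D U}. \<Sum>rs\<in>?L D. rows_wt z (U # rs))"
    using finite_row_lists_top_eq by (intro sum.UNION_disjoint) auto
  also have "\<dots> = (\<Sum>D\<in>{D \<in> Pow {..<X}. interlaced D U}. row_weight (z (Suc n)) D U * (\<Sum>rs\<in>?L D. rows_wt z rs))"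
    unfolding sum_distrib_left by (intro sum.cong refl) (auto simp: row_lists_def)
  \<comment> \<open>Rows that do not interlace with \<open>U\<close> have weight zero and may be
    added.\<close>
  also have "\<dots> = (\<Sum>D\<in>Pow {..<X}. row_weight (z (Suc n)) D U * (\<Sum>rs\<in>?L D. rows_wt z rs))"
  proof (intro sum.mono_neutral_left ballI)
    fix D assume "D \<in> Pow {..<X} - {D \<in> Pow {..<X}. interlaced D U}"
    then have "row_weight (z (Suc n)) D U = 0"
      using row_weight_nonzero[of D U] fin finite_subset[of D "{..<X}"] by auto
    then show "row_weight (z (Suc n)) D U * (\<Sum>rs\<in>?L D. rows_wt z rs) = 0" by simp
  qed auto
  also have "\<dots> = (\<Sum>D\<in>Pow {..<X}. stack_wt (map z (rev [1..<Suc n])) (bits X D)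
      * row_wt (z (Suc n)) True (bits X D) (bits X U))"
    using Suc by (intro sum.cong refl) (simp add: row_weight_eq[of _ X] mult.commute)
  also have "\<dots> = (\<Sum>low | length low = X. stack_wt (map z (rev [1..<Suc n])) low * row_wt (z (Suc n)) True low (bits X U))"
    by (rule sum.reindex_bij_betw[OF bij_betw_bits])
  also have "\<dots> = stack_wt (map z (rev [1..<Suc (Suc n)])) (bits X U)"
    by (simp add: row_sum_def)
  finally show ?case .
qed

text \<open>\<open>F_paths\<close> also admits shared vertical edges, which rows given by sets
  cannot describe. Such collections have weight zero: the exits are distinct, so above a shared edge
  some vertex must reduce two or more paths to at most one.\<close>

lemma F_stair_eq_stack_wt:
  assumes k: "1 \<le> k" and v: "\<And>j. j \<in> {1..k} \<Longrightarrow> s * v j \<noteq> 1"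
  shows "F_stair s q k v = stack_wt (map v (rev [1..<Suc k])) (replicate k True)"
proof -
  let ?g = "\<lambda>\<omega>. rows_list k (collection_rows k \<omega>)"
  define P where "P = {\<omega> \<in> paths_P k. top_row (?g \<omega>) = {..<k}}"
  have top: "top_row (?g \<omega>) = collection_rows k \<omega> k" for \<omega>
    by (rule top_rows_list) (simp add: collection_rows_def)
  have sig: "row_signature k \<omega> = rev (sorted_list_of_set (collection_rows k \<omega> k))" "finite (collection_rows k \<omega> k)"
    if "\<omega> \<in> paths_P k" for \<omega>
    using row_signature_row_collection[of "collection_rows k \<omega>" k k] paths_P_eq_row_collection[OF that]
      interlaced_rows_card(1)[of k _ k] k by auto
  have up: "sorted_list_of_set {..<k} = [0..<k]" by (simp add: atLeast0LessThan[symmetric])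
  have "F_stair s q k v = (\<Sum>\<omega>\<in>P. collection_weight s q k v \<omega>)"
    unfolding F_stair_def F_fun_def
  proof (rule sum.mono_neutral_right[OF finite_F_paths])
    show "P \<subseteq> F_paths k (rev [0..<k])"
      using sig up by (auto simp: P_def F_paths_def paths_P_def top)
    show "\<forall>\<omega>\<in>F_paths k (rev [0..<k]) - P. collection_weight s q k v \<omega> = 0"
    proof
      fix \<omega> assume \<omega>: "\<omega> \<in> F_paths k (rev [0..<k]) - P"
      have pc: "\<omega> \<in> path_collections k" and hor: "\<And>i j. \<omega> ((i, j), (i + 1, j)) \<le> 1"
        and stair: "row_signature k \<omega> = rev [0..<k]"
        using \<omega> by (auto simp: F_paths_def)
      have "\<omega> \<notin> paths_P k"
      proof
        assume "\<omega> \<in> paths_P k"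
        then have "rev (sorted_list_of_set (collection_rows k \<omega> k)) = rev [0..<k]"
          using sig(1) stair by simp
        then have "set (sorted_list_of_set (collection_rows k \<omega> k)) = {..<k}"
          by (simp add: atLeast0LessThan)
        then have "collection_rows k \<omega> k = {..<k}"
          using sig(2)[OF \<open>\<omega> \<in> paths_P k\<close>] by simp
        then show False using \<omega> \<open>\<omega> \<in> paths_P k\<close> by (auto simp: P_def top)
      qed
      then obtain e where "\<not> \<omega> e \<le> 1" using pc unfolding paths_P_def by blast
      then have e: "2 \<le> \<omega> e" by simp
      obtain i j where ij: "0 \<le> i" "1 \<le> j" "j \<le> int k" "2 \<le> \<omega> ((i, j), (i, j + 1))"
      proof -
        obtain a b where ab: "e = (a, b)" by (metis surj_pair)
        obtain i j where ij: "0 \<le> i" "1 \<le> j" "j \<le> int k"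
            "a = (i, j) \<and> b = (i, j + 1) \<or> a = (i - 1, j) \<and> b = (i, j)"
          using path_collection_flow(2)[OF pc, of a b] e ab by auto
        moreover have "\<not> (a = (i - 1, j) \<and> b = (i, j))"
          using hor[of "i - 1" j] e ab by auto
        ultimately show thesis using that e ab by auto
      qed
      define x where "x = nat i"
      \<comment> \<open>The levels at which column \<open>x\<close> has a shared vertical edge; the
        vertex just above the highest of them has weight zero.\<close>
      define J where "J = {j \<in> {1..k}. 2 \<le> \<omega> ((int x, int j), (int x, int j + 1))}"
      have "nat j \<in> J" using ij by (auto simp: J_def x_def nat_le_iff le_nat_iff)
      then have mx: "Max J \<in> J" by (intro Max_in) (auto simp: J_def)
      have "\<omega> ((int x, int k), (int x, int k + 1)) \<le> 1"
        using row_signature_count[OF pc, of k x] count_list_distinct[of "rev [0..<k]" x]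
        by (simp add: stair)
      then have "Max J \<noteq> k" using mx by (auto simp: J_def)
      then have lt: "Max J < k" using mx by (auto simp: J_def)
      have "finite J" by (auto simp: J_def)
      then have "Suc (Max J) \<notin> J" using Max_ge[of J "Suc (Max J)"] Suc_n_not_le_n by blast
      then have "\<omega> ((int x, int (Suc (Max J))), (int x, int (Suc (Max J)) + 1)) \<le> 1"
        using lt by (auto simp: J_def)
      moreover have "2 \<le> \<omega> ((int x, int (Suc (Max J)) - 1), (int x, int (Suc (Max J))))"
        using mx by (simp add: J_def add.commute)
      ultimately have "vertex_weight s q (v (Suc (Max J))) (arrows \<omega> (int x) (int (Suc (Max J)))) = 0"
        unfolding arrows_def by (intro vertex_weight_descend_zero)
      moreover have "Suc (Max J) \<in> {1..k}" using lt by auto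
      ultimately have x0: "(\<Prod>j = 1..k. vertex_weight s q (v j) (arrows \<omega> (int x) (int j))) = 0"
        by (intro prod_zero bexI[of _ "Suc (Max J)"]) simp_all
      obtain X where X: "\<And>Y. X \<le> Y \<Longrightarrow> collection_weight s q k v \<omega>
          = (\<Prod>i<Y. \<Prod>j = 1..k. vertex_weight s q (v j) (arrows \<omega> (int i) (int j)))"
        using collection_weight_prodinf[of \<omega> k v] pc v by blast
      have "(\<Prod>i<max X (Suc x). \<Prod>j = 1..k. vertex_weight s q (v j) (arrows \<omega> (int i) (int j))) = 0"
        by (rule prod_zero[OF _ bexI[of _ x]]) (use x0 in simp_all)
      then show "collection_weight s q k v \<omega> = 0"
        using X[of "max X (Suc x)"] by simp
    qed
  qed
  also have "\<dots> = (\<Sum>\<omega>\<in>P. rows_wt v (?g \<omega>))"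
    using v by (intro sum.cong refl collection_weight_rows) (auto simp: P_def)
  also have "\<dots> = (\<Sum>rs | rs \<in> row_lists k \<and> top_row rs = {..<k}. rows_wt v rs)"
  proof (rule sum.reindex_bij_betw)
    show "bij_betw ?g P {rs. rs \<in> row_lists k \<and> top_row rs = {..<k}}"
    proof (rule bij_betw_imageI)
      show "inj_on ?g P"
        by (rule inj_on_subset[OF bij_betw_imp_inj_on[OF bij_betw_rows_list]]) (auto simp: P_def)
      show "?g ` P = {rs. rs \<in> row_lists k \<and> top_row rs = {..<k}}"
        unfolding P_def bij_betw_imp_surj_on[OF bij_betw_rows_list[of k], symmetric] by auto
    qed
  qed
  also have "\<dots> = stack_wt (map v (rev [1..<Suc k])) (bits k {..<k})"
    by (rule sum_rows_wt) simp
  also have "bits k {..<k} = replicate k True"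
    by (intro nth_equalityI) (auto simp: bits_def)
  finally show ?thesis .
qed

lemma F_stair_select:
  assumes v: "inj_on v {1..m}" "\<And>j. j \<in> {1..m} \<Longrightarrow> s * v j \<noteq> 1" and I: "I \<subseteq> {1..m}" "card I = k" and k: "1 \<le> k"
  shows "F_stair s q k (select_vars I v) / F_stair s q k (\<lambda>_. s)
    = (\<Prod>z\<in>v ` I. absorb z) * bethe (v ` I) (replicate k True) / stair_wt k"
proof -
  have fin: "finite I" using I(1) finite_subset by blast
  have nth: "sorted_list_of_set I ! (j - 1) \<in> I" if "j \<in> {1..k}" for j
    using that I(2) fin nth_mem[of "j - 1" "sorted_list_of_set I"] by auto
  have "stack_wt (map (\<lambda>_. s) (rev [1..<Suc k])) (replicate k True) = stair_wt k"
    by (simp add: map_replicate_const stack_wt_stair del: upt_Suc)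
  then have den: "F_stair s q k (\<lambda>_. s) = stair_wt k"
    using F_stair_eq_stack_wt[OF k, of "\<lambda>_. s"] s_square by (simp add: power2_eq_square)
  have map: "map (select_vars I v) [1..<Suc k] = map v (sorted_list_of_set I)"
    using I(2) fin by (intro nth_equalityI) (auto simp: select_vars_def simp del: upt_Suc)
  have "F_stair s q k (select_vars I v) = stack_wt (rev (map v (sorted_list_of_set I))) (replicate k True)"
    using F_stair_eq_stack_wt[OF k, of "select_vars I v"] nth I(1) v(2) unfolding map[symmetric]
    by (simp add: select_vars_def rev_map subset_iff del: upt_Suc)
  also have "\<dots> = (\<Prod>z\<in>v ` I. absorb z) * bethe (v ` I) (replicate k True)"
    using fin I(1) v by (subst stack_wt_bethe) (auto simp: distinct_map intro: inj_on_subset)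
  finally show ?thesis by (simp add: den)
qed

end

subsection \<open>Absolute convergence and continuity\<close>

context generic_spin
begin

lemma hop_s [simp]: "hop s = 0"
  by (simp add: hop_def)

text \<open>Each \<open>emit\<close> vertex uses a lower \<open>True\<close> and each
  \<open>absorb\<close> vertex an upper one, so the exponent of \<open>C\<close> is bounded by the
  occupied edges; the \<open>hop\<close> factors are compared without any loss.\<close>

lemma row_wt_bound:
  assumes "norm (hop u) \<le> norm (hop w)" "1 \<le> C"
    "norm (emit u) \<le> C * norm (emit w)" "norm (absorb u) \<le> C * norm (absorb w)"
  shows "norm (row_wt u h low up) \<le> C ^ (count_list low True + count_list up True) * norm (row_wt w h low up)"
proof (induction low arbitrary: h up)
  case Nil
  then show ?case by (cases up) auto
next
  case (Cons l ls)
  show ?case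
  proof (cases up)
    case (Cons a as)
    note IH = Cons.IH[of _ as]
    let ?n = "count_list ls True + count_list as True"
    have nn: "norm (hop u) \<le> C ^ 0 * norm (hop w)"
      "norm (emit u) \<le> C ^ 1 * norm (emit w)" "norm (absorb u) \<le> C ^ 1 * norm (absorb w)"
      using assms by simp_all
    have div: "norm (x / s) \<le> C ^ Suc (Suc ?n) * norm (y / s)" if "norm x \<le> C ^ ?n * norm y" for x y
      using power_bound_step[OF assms(2) _ that, of "1 / s" 0 "1 / s" "Suc (Suc ?n)"] by simp
    have hop: "norm (hop u * row_wt u False ls as) \<le> C ^ ?n * norm (hop w * row_wt w False ls as)"
      by (rule power_bound_step[OF assms(2) nn(1) IH]) simp
    show ?thesis unfolding Cons
      by (cases h; cases l; cases a)
        (simp_all del: power_Suc norm_mult add: IH div[OF IH] div[OF hop]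
          power_bound_step[OF assms(2) nn(1) IH] power_bound_step[OF assms(2) nn(2) IH]
          power_bound_step[OF assms(2) nn(3) IH])
  qed simp
qed

lemma row_weight_bound:
  assumes "norm (hop u) \<le> norm (hop w)" "1 \<le> C"
    "norm (emit u) \<le> C * norm (emit w)" "norm (absorb u) \<le> C * norm (absorb w)" "finite D" "finite U"
  shows "norm (row_weight u D U) \<le> C ^ (card D + card U) * norm (row_weight w D U)"
proof -
  obtain X where X: "D \<subseteq> {..<X}" "U \<subseteq> {..<X}" using finite_nat_bounded[of "D \<union> U"] assms by auto
  have "count_list (bits X V) True = card V" if "V \<subseteq> {..<X}" for V
    using count_list_take_bits[of X X V] count_below_eq_card[OF that] by simp
  then show ?thesis
    using row_wt_bound[OF assms(1-4), of True "bits X D" "bits X U"] X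
    by (simp add: row_weight_eq[OF X])
qed

text \<open>Among at most \<open>N\<close> rows, each touches at most \<open>2 * N\<close> occupied
  vertical edges. The constant is thus the same for all configurations, however wide.\<close>

lemma rows_wt_bound:
  assumes "1 \<le> C" "\<And>j. j \<in> {1..N} \<Longrightarrow> norm (hop (z j)) \<le> norm (hop (w j))"
    "\<And>j. j \<in> {1..N} \<Longrightarrow> norm (emit (z j)) \<le> C * norm (emit (w j))"
    "\<And>j. j \<in> {1..N} \<Longrightarrow> norm (absorb (z j)) \<le> C * norm (absorb (w j))"
    "interlaced_list rs" "length rs \<le> N"
  shows "norm (rows_wt z rs) \<le> C ^ (2 * N * length rs) * norm (rows_wt w rs)"
  using assms(5,6)
proof (induction rs)
  case (Cons U rs)
  have int: "interlaced (top_row rs) U" "interlaced_list rs" using Cons.prems by auto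
  then have fin: "finite (top_row rs)" "finite U" and card: "card (top_row rs) = length rs" "card U = Suc (length rs)"
    using interlaced_list_top_row[OF int(2)] by (auto simp: interlaced_def)
  have "Suc (length rs) \<in> {1..N}" using Cons.prems by auto
  then have "norm (row_weight (z (Suc (length rs))) (top_row rs) U)
      \<le> C ^ (card (top_row rs) + card U) * norm (row_weight (w (Suc (length rs))) (top_row rs) U)"
    using assms(1-4) fin by (intro row_weight_bound) auto
  moreover have "norm (rows_wt z rs) \<le> C ^ (2 * N * length rs) * norm (rows_wt w rs)"
    using Cons int by auto
  moreover have "card (top_row rs) + card U + 2 * N * length rs \<le> 2 * N * length (U # rs)"
    using card Cons.prems by simp
  ultimately show ?case
    unfolding rows_wt.simps using power_bound_step[OF assms(1)] by blast
qed simp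

definition term_f :: "(nat list \<Rightarrow> real) \<Rightarrow> (nat \<Rightarrow> complex) \<Rightarrow> nat set list \<Rightarrow> complex" where
  "term_f f z rs = rows_wt z rs * complex_of_real (f (rev (sorted_list_of_set (top_row rs))))"

definition rows_sum :: "(nat list \<Rightarrow> real) \<Rightarrow> nat set list set \<Rightarrow> (nat \<Rightarrow> complex) \<Rightarrow> complex" where
  "rows_sum f A z = (\<Sum>\<^sub>\<infinity>rs\<in>A. term_f f z rs)"

text \<open>A polydisc in the coordinates \<open>hop (z j)\<close>. Its centre is
  \<open>z j = s\<close>, so coordinates may be replaced by \<open>s\<close>; the strict inequality
  keeps nearby points inside.\<close>

definition region :: "nat \<Rightarrow> (nat \<Rightarrow> complex) \<Rightarrow> (nat \<Rightarrow> complex) set" where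
  "region N w = {z. \<forall>j\<in>{1..N}. s * z j \<noteq> 1 \<and> norm (hop (z j)) < norm (hop (w j))}"

text \<open>The horizontal weight \<open>hop\<close> is the only vertex weight that may occur an unbounded number of
  times, so the series at \<open>z\<close> is dominated by a multiple of the series at \<open>w\<close>.\<close>

definition bounded_region :: "nat \<Rightarrow> (nat \<Rightarrow> complex) \<Rightarrow> real \<Rightarrow> (nat \<Rightarrow> complex) set" where
  "bounded_region N w C = {z \<in> region N w. \<forall>j\<in>{1..N}.
     norm (emit (z j)) < C * norm (emit (w j)) \<and> norm (absorb (z j)) < C * norm (absorb (w j))}"

text \<open>\<open>hop\<close> is a Moebius map with determinant \<open>1 - s^2\<close>, and
  changing the sign of \<open>s\<close> inverts it.\<close>

lemma hop_inverse:
  assumes "s * u \<noteq> 1"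
  shows "1 + s * hop u \<noteq> 0" "(hop u + s) / (1 + s * hop u) = u"
proof -
  have e: "1 + s * hop u = (1 - s\<^sup>2) / (1 - s * u)" "hop u + s = (1 - s\<^sup>2) * u / (1 - s * u)"
    using assms by (simp_all add: hop_def divide_simps) (simp_all add: algebra_simps power2_eq_square)
  show "1 + s * hop u \<noteq> 0" "(hop u + s) / (1 + s * hop u) = u"
    unfolding e using assms s_square by auto
qed

lemma hop_of_inverse:
  assumes "1 + s * x \<noteq> 0"
  shows "hop ((x + s) / (1 + s * x)) = x" "s * ((x + s) / (1 + s * x)) \<noteq> 1"
proof -
  let ?u = "(x + s) / (1 + s * x)"
  have e: "1 - s * ?u = (1 - s\<^sup>2) / (1 + s * x)" "?u - s = (1 - s\<^sup>2) * x / (1 + s * x)"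
    using assms by (simp_all add: divide_simps) (simp_all add: algebra_simps power2_eq_square)
  have "1 - s * ?u \<noteq> 0" unfolding e using assms s_square by simp
  then show "s * ?u \<noteq> 1" by (metis right_minus_eq)
  show "hop ?u = x" unfolding hop_def e using assms s_square by simp
qed

text \<open>Moving the values \<open>hop (u j)\<close> radially outwards leads to points \<open>w\<close> near \<open>u\<close> with
  \<open>u \<in> region N w\<close>.\<close>

lemma exists_dominating_point:
  assumes u: "\<And>j. j \<in> {1..N} \<Longrightarrow> s * u j \<noteq> 1" and P: "\<forall>\<^sub>F z in nhds u. P z"
  obtains w where "P w" "u \<in> region N w" "\<And>j. j \<in> {1..N} \<Longrightarrow> s * w j \<noteq> 1 \<and> emit (w j) \<noteq> 0"
proof -
  \<comment> \<open>If \<open>hop (u j) = 0\<close> there is no radial direction, and any nonzero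
    one increases the norm.\<close>
  define c where "c j = (if hop (u j) = 0 then 1 else hop (u j))" for j
  define x where "x e j = hop (u j) + of_real e * c j" for e :: real and j
  define g where "g e j = (if j \<in> {1..N} then (x e j + s) / (1 + s * x e j) else u j)" for e j
  have c: "c j \<noteq> 0" for j by (simp add: c_def)
  have x: "((\<lambda>e. x e j) \<longlongrightarrow> hop (u j)) (at_right 0)" for j
    unfolding x_def by (auto intro!: tendsto_eq_intros)
  have "((\<lambda>e. g e j) \<longlongrightarrow> u j) (at_right 0)" for j
  proof (cases "j \<in> {1..N}")
    case True
    have "((\<lambda>e. (x e j + s) / (1 + s * x e j)) \<longlongrightarrow> (hop (u j) + s) / (1 + s * hop (u j))) (at_right 0)"
      by (intro tendsto_intros x hop_inverse u True)
    then show ?thesis using True hop_inverse(2)[OF u[OF True]] by (simp add: g_def)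
  next
    case False
    then have "(\<lambda>e. g e j) = (\<lambda>_. u j)" by (auto simp: g_def)
    then show ?thesis by simp
  qed
  then have "(g \<longlongrightarrow> u) (at_right 0)" by (rule tendsto_fun)
  with P have "\<forall>\<^sub>F e in at_right 0. P (g e)" by (rule eventually_compose_filterlim)
  moreover have "\<forall>\<^sub>F e in at_right 0. \<forall>j\<in>{1..N}. 1 + s * x e j \<noteq> 0 \<and> x e j \<noteq> - s \<and> norm (hop (u j)) < norm (x e j)"
  proof (intro eventually_ball_finite ballI)
    fix j assume j: "j \<in> {1..N}"
    have pos: "\<forall>\<^sub>F e in at_right (0::real). 0 < e" by (simp add: eventually_at_right_less)
    have "((\<lambda>e. 1 + s * x e j) \<longlongrightarrow> 1 + s * hop (u j)) (at_right 0)" by (intro tendsto_intros x)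
    then have "\<forall>\<^sub>F e in at_right 0. 1 + s * x e j \<noteq> 0"
      by (rule tendsto_imp_eventually_ne) (use hop_inverse(1) u j in auto)
    \<comment> \<open>The value \<open>- s\<close> is \<open>hop 0\<close>; avoiding it keeps the
      new point away from the zero of \<open>emit\<close>.\<close>
    moreover have "\<forall>\<^sub>F e in at_right 0. x e j \<noteq> - s"
    proof (cases "hop (u j) = - s")
      case True
      show ?thesis
        using pos by eventually_elim (use c True in \<open>simp add: x_def\<close>)
    next
      case False
      then show ?thesis by (rule tendsto_imp_eventually_ne[OF x])
    qed
    moreover have "\<forall>\<^sub>F e in at_right 0. norm (hop (u j)) < norm (x e j)"
      using pos
    proof eventually_elim
      case (elim e)
      show ?case
      proof (cases "hop (u j) = 0")
        case False
        have "x e j = of_real (1 + e) * hop (u j)" using False by (simp add: x_def c_def algebra_simps)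
        then have "norm (x e j) = (1 + e) * norm (hop (u j))"
          using elim by (simp only: norm_mult norm_of_real)
        then show ?thesis using False elim by simp
      qed (use elim in \<open>simp add: x_def c_def\<close>)
    qed
    ultimately show "\<forall>\<^sub>F e in at_right 0. 1 + s * x e j \<noteq> 0 \<and> x e j \<noteq> - s \<and> norm (hop (u j)) < norm (x e j)"
      by eventually_elim auto
  qed simp
  ultimately have "\<forall>\<^sub>F e in at_right 0. P (g e) \<and> (\<forall>j\<in>{1..N}. 1 + s * x e j \<noteq> 0 \<and> x e j \<noteq> - s \<and> norm (hop (u j)) < norm (x e j))"
    by (rule eventually_conj)
  then obtain e where e: "P (g e)"
    "\<And>j. j \<in> {1..N} \<Longrightarrow> 1 + s * x e j \<noteq> 0 \<and> x e j \<noteq> - s \<and> norm (hop (u j)) < norm (x e j)"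
    using eventually_happens'[OF trivial_limit_at_right_real] by blast
  have hop: "hop (g e j) = x e j" "s * g e j \<noteq> 1" if "j \<in> {1..N}" for j
    using hop_of_inverse[of "x e j"] e(2)[OF that] that by (simp_all add: g_def)
  show thesis
  proof (rule that[OF e(1)])
    show "u \<in> region N (g e)" using u e(2) hop(1) by (simp add: region_def)
    fix j assume j: "j \<in> {1..N}"
    have "x e j + s \<noteq> 0" using e(2)[OF j] by (simp add: add_eq_0_iff2)
    then have "g e j \<noteq> 0" using e(2)[OF j] j by (simp add: g_def)
    then have "emit (g e j) \<noteq> 0" using hop(2)[OF j] s_square by (simp add: emit_def)
    then show "s * g e j \<noteq> 1 \<and> emit (g e j) \<noteq> 0" using hop(2)[OF j] by simp
  qed
qed

text \<open>\<open>D\<close> is the row at the cut, which is all that the upper part sees of the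
  rows below.\<close>

fun upper_wt :: "(nat \<Rightarrow> complex) \<Rightarrow> nat \<Rightarrow> nat set list \<Rightarrow> nat set \<Rightarrow> complex" where
  "upper_wt z m [] D = 1"
| "upper_wt z m (U # us) D = row_weight (z (Suc (length us + m))) (if us = [] then D else hd us) U * upper_wt z m us D"

lemma rows_wt_append: "rows_wt z (us @ ls) = upper_wt z (length ls) us (top_row ls) * rows_wt z ls"
  by (induction us) (auto simp: top_row_append)

lemma upper_wt_cong: "(\<And>j. m < j \<Longrightarrow> z j = z' j) \<Longrightarrow> upper_wt z m us D = upper_wt z' m us D"
  by (induction us) auto

lemma override_region:
  assumes "z \<in> region N w"
  shows "override_on z (\<lambda>_. s) I \<in> region N w"
  unfolding region_def
proof (intro CollectI ballI)
  fix j assume j: "j \<in> {1..N}"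
  then have zj: "s * z j \<noteq> 1" "norm (hop (z j)) < norm (hop (w j))" using assms by (auto simp: region_def)
  then have "0 < norm (hop (w j))" by (meson norm_ge_zero le_less_trans)
  then show "s * override_on z (\<lambda>_. s) I j \<noteq> 1 \<and> norm (hop (override_on z (\<lambda>_. s) I j)) < norm (hop (w j))"
    using zj s_square by (cases "j \<in> I") (auto simp: power2_eq_square)
qed

end

text \<open>\<open>w\<close> is the dominating point. Since neither \<open>emit\<close> (by
  assumption) nor \<open>absorb\<close> (always) vanishes there, these weights at \<open>z\<close>
  are bounded by multiples of those at \<open>w\<close>.\<close>

locale dominated_series = generic_spin +
  fixes N :: nat and w :: "nat \<Rightarrow> complex" and f :: "nat list \<Rightarrow> real"
  assumes w: "\<And>j. j \<in> {1..N} \<Longrightarrow> s * w j \<noteq> 1 \<and> emit (w j) \<noteq> 0"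
    and summable: "(\<lambda>rs. norm (term_f f w rs)) summable_on row_lists N"
begin

lemma eventually_region:
  assumes "z \<in> region N w"
  shows "\<forall>\<^sub>F z' in nhds z. z' \<in> region N w"
proof -
  have "\<forall>\<^sub>F z' in nhds z. s * z' j \<noteq> 1 \<and> norm (hop (z' j)) < norm (hop (w j))" if j: "j \<in> {1..N}" for j
  proof -
    have zj: "s * z j \<noteq> 1" "norm (hop (z j)) < norm (hop (w j))" using assms j by (auto simp: region_def)
    have "((\<lambda>z'. s * z' j) \<longlongrightarrow> s * z j) (nhds z)" by (intro tendsto_intros tendsto_nhds_coordinate)
    then have "\<forall>\<^sub>F z' in nhds z. s * z' j \<noteq> 1" by (rule tendsto_imp_eventually_ne) (use zj in auto)
    moreover have "((\<lambda>z'. norm (hop (z' j))) \<longlongrightarrow> norm (hop (z j))) (nhds z)"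
      by (intro tendsto_norm tendsto_hop tendsto_nhds_coordinate zj)
    then have "\<forall>\<^sub>F z' in nhds z. norm (hop (z' j)) < norm (hop (w j))"
      using zj(2) by (rule order_tendstoD(2))
    ultimately show ?thesis by eventually_elim auto
  qed
  then have "\<forall>\<^sub>F z' in nhds z. \<forall>j\<in>{1..N}. s * z' j \<noteq> 1 \<and> norm (hop (z' j)) < norm (hop (w j))"
    by (intro eventually_ball_finite) auto
  then show ?thesis by (simp add: region_def)
qed

lemma region_imp_bounded:
  assumes "z \<in> region N w"
  obtains C where "1 \<le> C" "z \<in> bounded_region N w C" "\<forall>\<^sub>F z' in nhds z. z' \<in> bounded_region N w C"
proof -
  have wpos: "0 < norm (emit (w j))" "0 < norm (absorb (w j))" if "j \<in> {1..N}" for j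
    using w[OF that] absorb_nonzero[of "w j"] by auto
  \<comment> \<open>One more than the sum of all ratios exceeds each of them strictly, and hence
    also near \<open>z\<close>.\<close>
  define C where "C = 1 + (\<Sum>j\<in>{1..N}. norm (emit (z j)) / norm (emit (w j)) + norm (absorb (z j)) / norm (absorb (w j)))"
  have C: "norm (emit (z j)) < C * norm (emit (w j)) \<and> norm (absorb (z j)) < C * norm (absorb (w j))"
    if j: "j \<in> {1..N}" for j
  proof -
    have "norm (emit (z j)) / norm (emit (w j)) + norm (absorb (z j)) / norm (absorb (w j)) \<le> C - 1"
      unfolding C_def using j by (simp, intro member_le_sum) auto
    moreover have "0 \<le> norm (emit (z j)) / norm (emit (w j))" "0 \<le> norm (absorb (z j)) / norm (absorb (w j))"
      by simp_all
    ultimately have "norm (emit (z j)) / norm (emit (w j)) < C" "norm (absorb (z j)) / norm (absorb (w j)) < C"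
      by linarith+
    then show ?thesis using wpos[OF j] by (simp add: divide_less_eq)
  qed
  have "1 \<le> C" unfolding C_def by (simp add: sum_nonneg)
  moreover have "z \<in> bounded_region N w C" using assms C by (auto simp: bounded_region_def)
  moreover have "\<forall>\<^sub>F z' in nhds z. z' \<in> bounded_region N w C"
  proof -
    have "\<forall>\<^sub>F z' in nhds z. norm (emit (z' j)) < C * norm (emit (w j)) \<and> norm (absorb (z' j)) < C * norm (absorb (w j))"
      if j: "j \<in> {1..N}" for j
    proof -
      have zj: "s * z j \<noteq> 1" using assms j by (auto simp: region_def)
      have "((\<lambda>z'. norm (emit (z' j))) \<longlongrightarrow> norm (emit (z j))) (nhds z)"
        "((\<lambda>z'. norm (absorb (z' j))) \<longlongrightarrow> norm (absorb (z j))) (nhds z)"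
        by (intro tendsto_norm tendsto_hop tendsto_nhds_coordinate zj)+
      then have "\<forall>\<^sub>F z' in nhds z. norm (emit (z' j)) < C * norm (emit (w j))"
        "\<forall>\<^sub>F z' in nhds z. norm (absorb (z' j)) < C * norm (absorb (w j))"
        using C[OF j] by (auto dest: order_tendstoD(2))
      then show ?thesis by eventually_elim auto
    qed
    then have "\<forall>\<^sub>F z' in nhds z. \<forall>j\<in>{1..N}.
        norm (emit (z' j)) < C * norm (emit (w j)) \<and> norm (absorb (z' j)) < C * norm (absorb (w j))"
      by (intro eventually_ball_finite) auto
    with eventually_region[OF assms] show ?thesis
      by eventually_elim (auto simp: bounded_region_def)
  qed
  ultimately show thesis using that by blast
qed

lemma term_f_bound:
  assumes "1 \<le> C" "z \<in> bounded_region N w C" "rs \<in> row_lists N"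
  shows "norm (term_f f z rs) \<le> C ^ (2 * N * N) * norm (term_f f w rs)"
proof -
  have "norm (rows_wt z rs) \<le> C ^ (2 * N * length rs) * norm (rows_wt w rs)"
    using assms by (intro rows_wt_bound) (auto simp: bounded_region_def region_def row_lists_def intro: less_imp_le)
  then show ?thesis
    using assms(3) by (auto simp: term_f_def norm_mult row_lists_def mult.assoc[symmetric] intro!: mult_right_mono)
qed

lemma term_f_abs_summable:
  assumes "z \<in> region N w" "A \<subseteq> row_lists N"
  shows "(\<lambda>rs. norm (term_f f z rs)) summable_on A"
proof -
  obtain C where C: "1 \<le> C" "z \<in> bounded_region N w C" using region_imp_bounded[OF assms(1)] by metis
  have "(\<lambda>rs. C ^ (2 * N * N) * norm (term_f f w rs)) summable_on A"
    by (intro summable_on_cmult_right summable_on_subset_banach[OF summable assms(2)])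
  then show ?thesis
    by (rule Infinite_Sum.abs_summable_on_comparison_test') (use C assms(2) term_f_bound in blast)
qed

lemma tendsto_rows_wt:
  assumes "\<And>j. j \<in> {1..length rs} \<Longrightarrow> ((\<lambda>e. g e j) \<longlongrightarrow> z j) F \<and> s * z j \<noteq> 1"
  shows "((\<lambda>e. rows_wt (g e) rs) \<longlongrightarrow> rows_wt z rs) F"
  using assms
proof (induction rs)
  case (Cons U rs)
  then show ?case
    unfolding rows_wt.simps row_weight_def Let_def by (intro tendsto_intros tendsto_row_wt Cons.IH) auto
qed simp

text \<open>On an open neighbourhood the terms have a common summable bound, so the series is a
  uniform limit of continuous finite sums.\<close>

lemma rows_sum_tendsto:
  assumes z: "z \<in> region N w" and A: "A \<subseteq> row_lists N"
  shows "(rows_sum f A \<longlongrightarrow> rows_sum f A z) (at z within S)"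
proof -
  obtain C where C: "1 \<le> C" "z \<in> bounded_region N w C" "\<forall>\<^sub>F z' in nhds z. z' \<in> bounded_region N w C"
    using region_imp_bounded[OF z] .
  then obtain T where T: "open T" "z \<in> T" "T \<subseteq> bounded_region N w C"
    unfolding eventually_nhds by blast
  have unif: "uniform_limit T (\<lambda>X z. \<Sum>rs\<in>X. term_f f z rs) (rows_sum f A) (finite_subsets_at_top A)"
    unfolding rows_sum_def
  proof (rule Weierstrass_m_test_general)
    show "norm (term_f f z rs) \<le> C ^ (2 * N * N) * norm (term_f f w rs)" if "rs \<in> A" "z \<in> T" for rs z
      using term_f_bound[OF C(1)] that T A by blast
    show "(\<lambda>rs. C ^ (2 * N * N) * norm (term_f f w rs)) summable_on A"
      by (intro summable_on_cmult_right summable_on_subset_banach[OF summable A])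
  qed
  have cont: "\<forall>\<^sub>F X in finite_subsets_at_top A. continuous_on T (\<lambda>z. \<Sum>rs\<in>X. term_f f z rs)"
  proof (rule eventually_finite_subsets_at_top_weakI)
    fix X assume X: "finite X" "X \<subseteq> A"
    show "continuous_on T (\<lambda>z. \<Sum>rs\<in>X. term_f f z rs)"
      unfolding continuous_on_def
    proof (intro ballI tendsto_sum)
      fix z rs assume z: "z \<in> T" and rs: "rs \<in> X"
      have "z \<in> bounded_region N w C" "length rs = N" using z T A rs X by (auto simp: row_lists_def)
      then have "((\<lambda>z. rows_wt z rs) \<longlongrightarrow> rows_wt z rs) (at z within T)"
        by (intro tendsto_rows_wt conjI tendsto_at_coordinate) (auto simp: bounded_region_def region_def)
      then show "((\<lambda>z. term_f f z rs) \<longlongrightarrow> term_f f z rs) (at z within T)"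
        unfolding term_f_def by (intro tendsto_intros)
    qed
  qed
  have "continuous_on T (rows_sum f A)"
    by (rule uniform_limit_theorem[OF cont unif]) (rule finite_subsets_at_top_neq_bot)
  then have "(rows_sum f A \<longlongrightarrow> rows_sum f A z) (at z within T)"
    using T(2) unfolding continuous_on_def by blast
  then have "(rows_sum f A \<longlongrightarrow> rows_sum f A z) (at z within UNIV)"
    unfolding at_within_open[OF T(2,1)] .
  then show ?thesis by (rule tendsto_within_subset) (rule subset_UNIV)
qed

subsection \<open>The difference operators\<close>

text \<open>Membership in \<open>A\<close> leaves the rows below level \<open>m\<close> free once
  row \<open>m\<close> is fixed; this allows them to be summed out.\<close>

definition lower_rows_free :: "nat \<Rightarrow> nat set list set \<Rightarrow> bool" where
  "lower_rows_free m A \<longleftrightarrow> (\<forall>rs\<in>A. \<forall>ls\<in>row_lists m.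
     top_row ls = top_row (drop (N - m) rs) \<longrightarrow> take (N - m) rs @ ls \<in> A)"

definition split_rows :: "nat \<Rightarrow> nat set list \<Rightarrow> nat set list \<times> nat set" where
  "split_rows m rs = (take (N - m) rs, top_row (drop (N - m) rs))"

text \<open>For \<open>m = N\<close> the upper part is empty and the row \<open>D\<close> at the cut
  is itself the top row, which is the argument of \<open>f\<close>.\<close>

definition upper_term :: "nat \<Rightarrow> (nat \<Rightarrow> complex) \<Rightarrow> nat set list \<times> nat set \<Rightarrow> complex" where
  "upper_term m z = (\<lambda>(us, D). upper_wt z m us D
     * complex_of_real (f (rev (sorted_list_of_set (if us = [] then D else hd us)))))"

text \<open>The terms are grouped by the part above the cut. Each group is a finite sum over all
  admissible lower parts, and only its \<open>stack_wt\<close> factor involves the first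
  \<open>m\<close> variables.\<close>

lemma rows_sum_fibers:
  assumes z: "z \<in> region N w" and A: "A \<subseteq> row_lists N" "lower_rows_free m A" and m: "m \<le> N"
  shows "((\<lambda>p. upper_term m z p * stack_wt (map z (rev [1..<Suc m])) (bits (column_bound (snd p)) (snd p)))
    has_sum rows_sum f A z) (split_rows m ` A)"
proof -
  define B where "B p = {ls. ls \<in> row_lists m \<and> top_row ls = snd p}" for p :: "nat set list \<times> nat set"
  have len: "length (take (N - m) rs) = N - m" if "rs \<in> A" for rs
    using that A(1) by (auto simp: row_lists_def)
  have drop: "drop (N - m) rs \<in> row_lists m" if "rs \<in> A" for rs
    using that A(1) m interlaced_list_drop by (auto simp: row_lists_def)
  have bij: "bij_betw (\<lambda>(p, ls). fst p @ ls) (Sigma (split_rows m ` A) B) A"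
  proof (rule bij_betw_byWitness[where f' = "\<lambda>rs. (split_rows m rs, drop (N - m) rs)"])
    show "\<forall>x\<in>Sigma (split_rows m ` A) B. (\<lambda>rs. (split_rows m rs, drop (N - m) rs)) ((\<lambda>(p, ls). fst p @ ls) x) = x"
    proof
      fix x assume "x \<in> Sigma (split_rows m ` A) B"
      then obtain rs ls where x: "x = (split_rows m rs, ls)" "rs \<in> A" "ls \<in> B (split_rows m rs)" by blast
      then show "(\<lambda>rs. (split_rows m rs, drop (N - m) rs)) ((\<lambda>(p, ls). fst p @ ls) x) = x"
        using len[OF x(2)] by (simp add: split_rows_def B_def)
    qed
    show "\<forall>rs\<in>A. (\<lambda>(p, ls). fst p @ ls) ((\<lambda>rs. (split_rows m rs, drop (N - m) rs)) rs) = rs"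
      by (simp add: split_rows_def)
    show "(\<lambda>(p, ls). fst p @ ls) ` Sigma (split_rows m ` A) B \<subseteq> A"
    proof
      fix y assume "y \<in> (\<lambda>(p, ls). fst p @ ls) ` Sigma (split_rows m ` A) B"
      then obtain rs ls where "y = fst (split_rows m rs) @ ls" "rs \<in> A" "ls \<in> B (split_rows m rs)" by auto
      then show "y \<in> A" using A(2) unfolding lower_rows_free_def split_rows_def B_def by simp
    qed
    show "(\<lambda>rs. (split_rows m rs, drop (N - m) rs)) ` A \<subseteq> Sigma (split_rows m ` A) B"
    proof
      fix y assume "y \<in> (\<lambda>rs. (split_rows m rs, drop (N - m) rs)) ` A"
      then obtain rs where "y = (split_rows m rs, drop (N - m) rs)" "rs \<in> A" by blast
      then show "y \<in> Sigma (split_rows m ` A) B" using drop[of rs] by (simp add: split_rows_def B_def)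
    qed
  qed
  have "(term_f f z has_sum rows_sum f A z) A"
    unfolding rows_sum_def
    by (rule has_sum_infsum[OF abs_summable_summable[OF term_f_abs_summable[OF z A(1)]]])
  then have sum: "((\<lambda>x. term_f f z (case x of (p, ls) \<Rightarrow> fst p @ ls)) has_sum rows_sum f A z)
      (Sigma (split_rows m ` A) B)"
    by (simp add: has_sum_reindex_bij_betw[OF bij])
  show ?thesis
  proof (rule has_sum_SigmaD[OF sum])
    fix p assume p: "p \<in> split_rows m ` A"
    then obtain rs where rs: "rs \<in> A" "p = split_rows m rs" by blast
    have "finite (snd p)"
      using interlaced_list_top_row[of "drop (N - m) rs"] drop[OF rs(1)] rs(2) by (simp add: split_rows_def row_lists_def)
    then have sub: "snd p \<subseteq> {..<column_bound (snd p)}" by (rule column_bound)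
    have "(\<Sum>ls\<in>B p. term_f f z (fst p @ ls)) = (\<Sum>ls\<in>B p. upper_term m z p * rows_wt z ls)"
      by (intro sum.cong refl)
        (auto simp: B_def term_f_def upper_term_def rows_wt_append top_row_append row_lists_def case_prod_beta)
    also have "\<dots> = upper_term m z p * stack_wt (map z (rev [1..<Suc m])) (bits (column_bound (snd p)) (snd p))"
      unfolding sum_distrib_left[symmetric] B_def by (simp only: sum_rows_wt[OF sub])
    finally show "((\<lambda>ls. term_f f z (case (p, ls) of (p, ls) \<Rightarrow> fst p @ ls)) has_sum
        upper_term m z p * stack_wt (map z (rev [1..<Suc m])) (bits (column_bound (snd p)) (snd p))) (B p)"
      using finite_row_lists_top_eq[of m "snd p"] by (intro has_sum_finiteI) (auto simp: B_def)
  qed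
qed

lemma lower_rows_free_stair:
  assumes "A \<subseteq> row_lists N" "lower_rows_free m A"
  shows "lower_rows_free m {rs \<in> A. {..<k} \<subseteq> top_row (drop (N - m) rs)}"
  unfolding lower_rows_free_def
proof (intro ballI impI)
  fix rs ls assume rs: "rs \<in> {rs \<in> A. {..<k} \<subseteq> top_row (drop (N - m) rs)}"
    and ls: "ls \<in> row_lists m" "top_row ls = top_row (drop (N - m) rs)"
  have "length rs = N" using rs assms(1) by (auto simp: row_lists_def)
  then have "drop (N - m) (take (N - m) rs @ ls) = ls" by simp
  then show "take (N - m) rs @ ls \<in> {rs \<in> A. {..<k} \<subseteq> top_row (drop (N - m) rs)}"
    using assms(2) rs ls unfolding lower_rows_free_def by simp
qed

text \<open>The finite sum over \<open>I\<close> is moved inside the series. Overriding variables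
  with index at most \<open>m\<close> leaves \<open>upper_term\<close> unchanged, and
  \<open>stack_wt_difference\<close> turns the remaining combination into the original term or
  zero.\<close>

lemma D_formula_rows_sum:
  assumes z: "z \<in> region N w" "inj_on z {1..m}" and A: "A \<subseteq> row_lists N" "lower_rows_free m A"
    and m: "m \<le> N" and k: "1 \<le> k" and g: "\<And>z. z \<in> region N w \<Longrightarrow> g z = rows_sum f A z"
  shows "D_formula s q k m g z = rows_sum f {rs \<in> A. {..<k} \<subseteq> top_row (drop (N - m) rs)} z"
proof -
  let ?T = "split_rows m ` A"
  let ?A' = "{rs \<in> A. {..<k} \<subseteq> top_row (drop (N - m) rs)}"
  let ?st = "\<lambda>z p. stack_wt (map z (rev [1..<Suc m])) (bits (column_bound (snd p)) (snd p))"
  let ?ov = "\<lambda>I. override_on z (\<lambda>_. s) I"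
  define coef where "coef I = (\<Prod>i\<in>I. \<Prod>j\<in>{1..m} - I. (z j - q * z i) / (z j - z i)) *
        (\<Prod>j\<in>{1..m} - I. ((z j - s) / (z j - s * q)) ^ k) *
        (F_stair s q k (select_vars I z) / F_stair s q k (\<lambda>_. s))" for I
  have zs: "s * z j \<noteq> 1" if "j \<in> {1..m}" for j using z(1) that m by (auto simp: region_def)
  have "((\<lambda>p. \<Sum>I | I \<subseteq> {1..m} \<and> card I = k. coef I * (upper_term m (?ov I) p * ?st (?ov I) p))
      has_sum (\<Sum>I | I \<subseteq> {1..m} \<and> card I = k. coef I * rows_sum f A (?ov I))) ?T"
    by (intro has_sum_finite_sum has_sum_cmult_right rows_sum_fibers override_region z(1) A m)
      (simp add: finite_subset[OF _ finite_Pow_iff[THEN iffD2, OF finite_atLeastAtMost[of 1 m]]])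
  also have "(\<Sum>I | I \<subseteq> {1..m} \<and> card I = k. coef I * rows_sum f A (?ov I)) = D_formula s q k m g z"
    unfolding D_formula_def coef_def using g override_region[OF z(1)] by simp
  finally have D: "((\<lambda>p. \<Sum>I | I \<subseteq> {1..m} \<and> card I = k. coef I * (upper_term m (?ov I) p * ?st (?ov I) p))
      has_sum D_formula s q k m g z) ?T" .
  have eq: "(\<Sum>I | I \<subseteq> {1..m} \<and> card I = k. coef I * (upper_term m (?ov I) p * ?st (?ov I) p))
      = (if {..<k} \<subseteq> snd p then upper_term m z p * ?st z p else 0)" if p: "p \<in> ?T" for p
  proof -
    obtain rs where rs: "rs \<in> A" "p = split_rows m rs" using p by blast
    have "interlaced_list (drop (N - m) rs)" using rs A(1) interlaced_list_drop by (auto simp: row_lists_def)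
    then have "finite (snd p)" using interlaced_list_top_row rs(2) by (simp add: split_rows_def)
    then have take: "take k (bits (column_bound (snd p)) (snd p)) = replicate k True \<longleftrightarrow> {..<k} \<subseteq> snd p"
      by (intro take_bits_eq_replicate column_bound)
    have "(\<Sum>I | I \<subseteq> {1..m} \<and> card I = k. coef I * (upper_term m (?ov I) p * ?st (?ov I) p))
        = upper_term m z p * (\<Sum>I | I \<subseteq> {1..m} \<and> card I = k. coef I * ?st (?ov I) p)"
    proof -
      have "upper_term m (?ov I) p = upper_term m z p" if "I \<subseteq> {1..m}" for I
      proof -
        have "?ov I j = z j" if "m < j" for j
          using \<open>I \<subseteq> {1..m}\<close> that by (auto simp: override_on_def)
        then show ?thesis unfolding upper_term_def by (auto simp: case_prod_beta cong: upper_wt_cong)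
      qed
      then show ?thesis by (auto simp: sum_distrib_left intro!: sum.cong)
    qed
    also have "(\<Sum>I | I \<subseteq> {1..m} \<and> card I = k. coef I * ?st (?ov I) p)
        = (if take k (bits (column_bound (snd p)) (snd p)) = replicate k True then ?st z p else 0)"
    proof -
      have "(\<Sum>I | I \<subseteq> {1..m} \<and> card I = k. coef I * ?st (?ov I) p)
          = (\<Sum>I | I \<subseteq> {1..m} \<and> card I = k.
        (\<Prod>i\<in>I. \<Prod>j\<in>{1..m} - I. (z j - q * z i) / (z j - z i)) *
        (\<Prod>j\<in>{1..m} - I. ((z j - s) / (z j - s * q)) ^ k) *
        ((\<Prod>z\<in>z ` I. absorb z) * bethe (z ` I) (replicate k True) / stair_wt k) * ?st (?ov I) p)"
        unfolding coef_def using F_stair_select[OF z(2) zs _ _ k] by (intro sum.cong refl) simp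
      also have "\<dots> = (if take k (bits (column_bound (snd p)) (snd p)) = replicate k True then ?st z p else 0)"
        using z(2) zs by (intro stack_wt_difference) (auto simp del: upt_Suc)
      finally show ?thesis .
    qed
    finally show ?thesis by (simp add: take)
  qed
  have img: "split_rows m ` ?A' = {p \<in> ?T. {..<k} \<subseteq> snd p}" by (auto simp: split_rows_def)
  define G where "G p = (\<Sum>I | I \<subseteq> {1..m} \<and> card I = k. coef I * (upper_term m (?ov I) p * ?st (?ov I) p))" for p
  define H where "H p = upper_term m z p * ?st z p" for p
  have "(H has_sum D_formula s q k m g z) {p \<in> ?T. {..<k} \<subseteq> snd p} \<longleftrightarrow> (G has_sum D_formula s q k m g z) ?T"
    using eq unfolding G_def[symmetric] H_def[symmetric]
    by (intro has_sum_cong_neutral) auto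
  then have "((\<lambda>p. upper_term m z p * ?st z p) has_sum D_formula s q k m g z) (split_rows m ` ?A')"
    using D unfolding img G_def[symmetric] H_def[symmetric] by simp
  moreover have "((\<lambda>p. upper_term m z p * ?st z p) has_sum rows_sum f ?A' z) (split_rows m ` ?A')"
    using A by (intro rows_sum_fibers z(1) m lower_rows_free_stair) auto
  ultimately show ?thesis by (rule has_sum_unique)
qed

text \<open>Where coordinates coincide, the formula has a limit along injective points because there
  it equals a function continuous on the whole region. This proves the singularity
  removable.\<close>

lemma D_op_rows_sum:
  assumes z: "z \<in> region N w" and A: "A \<subseteq> row_lists N" "lower_rows_free m A"
    and m: "m \<le> N" and k: "1 \<le> k" and g: "\<And>z. z \<in> region N w \<Longrightarrow> g z = rows_sum f A z"
  shows "D_op s q k m g z = rows_sum f {rs \<in> A. {..<k} \<subseteq> top_row (drop (N - m) rs)} z"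
proof (cases "inj_on z {1..m}")
  case True
  then show ?thesis using D_formula_rows_sum[OF z True A m k g] by (simp add: D_op_def)
next
  case False
  let ?S = "{v. inj_on v {1..m}}"
  let ?A' = "{rs \<in> A. {..<k} \<subseteq> top_row (drop (N - m) rs)}"
  have "\<forall>\<^sub>F v in at z within ?S. v \<in> region N w \<and> inj_on v {1..m}"
    using eventually_region[OF z] unfolding eventually_at_filter by eventually_elim simp
  then have ev: "\<forall>\<^sub>F v in at z within ?S. rows_sum f ?A' v = D_formula s q k m g v"
    by eventually_elim (use D_formula_rows_sum[OF _ _ A m k g] in auto)
  have "(rows_sum f ?A' \<longlongrightarrow> rows_sum f ?A' z) (at z within ?S)"
    using A(1) by (intro rows_sum_tendsto z) auto
  then have "(D_formula s q k m g \<longlongrightarrow> rows_sum f ?A' z) (at z within ?S)"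
    using ev by (rule Lim_transform_eventually)
  then have "Lim (at z within ?S) (D_formula s q k m g) = rows_sum f ?A' z"
    by (rule tendsto_Lim[OF injective_points_limit[OF False]])
  then show ?thesis using False by (simp add: D_op_def)
qed

end

subsection \<open>The events\<close>

lemma top_row_drop_collection:
  "n \<le> N \<Longrightarrow> top_row (drop (N - n) (rows_list N (collection_rows N \<omega>))) = collection_rows N \<omega> n"
  by (simp add: drop_rows_list top_rows_list collection_rows_def)

lemma row_signature_paths_P:
  assumes "\<omega> \<in> paths_P N" "1 \<le> n" "n \<le> N"
  shows "row_signature n \<omega> = rev (sorted_list_of_set (collection_rows N \<omega> n))"
    "finite (collection_rows N \<omega> n)" "card (collection_rows N \<omega> n) = n"
  using row_signature_row_collection[of "collection_rows N \<omega>" n N] paths_P_eq_row_collection[OF assms(1)]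
    interlaced_rows_card[OF _ assms(3)] assms(2,3) by auto

text \<open>Only the conditions with index at least \<open>i\<close> are imposed: those inserted
  once the operators \<open>i, ..., k\<close> have been applied.\<close>

definition event_rows :: "nat \<Rightarrow> nat \<Rightarrow> (nat \<Rightarrow> nat) \<Rightarrow> nat \<Rightarrow> nat set list set" where
  "event_rows N k m i = {rs \<in> row_lists N. \<forall>l\<in>{i..k}. {..<l} \<subseteq> top_row (drop (N - m l) rs)}"

lemma event_A_eq_event_rows:
  assumes "\<And>i. i \<in> {1..k} \<Longrightarrow> i \<le> m i \<and> m i \<le> N"
  shows "event_A N k m = {\<omega> \<in> paths_P N. rows_list N (collection_rows N \<omega>) \<in> event_rows N k m 1}"
proof -
  have star: "row_signature (m i) \<omega> \<in> Sign_star (m i) i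
      \<longleftrightarrow> {..<i} \<subseteq> top_row (drop (N - m i) (rows_list N (collection_rows N \<omega>)))"
    if "\<omega> \<in> paths_P N" "i \<in> {1..k}" for \<omega> i
  proof -
    have mi: "1 \<le> m i" "i \<le> m i" "m i \<le> N" using assms[OF that(2)] that(2) by auto
    show ?thesis
      using row_signature_paths_P[OF that(1) mi(1,3)] mi(2,3)
      by (simp add: top_row_drop_collection rev_sorted_list_in_Sign_star)
  qed
  have rows: "rows_list N (collection_rows N \<omega>) \<in> row_lists N" if "\<omega> \<in> paths_P N" for \<omega>
    using bij_betw_rows_list[of N] that by (rule bij_betw_apply)
  show ?thesis
  proof (rule set_eqI)
    fix \<omega>
    show "\<omega> \<in> event_A N k m
        \<longleftrightarrow> \<omega> \<in> {\<omega> \<in> paths_P N. rows_list N (collection_rows N \<omega>) \<in> event_rows N k m 1}"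
      unfolding event_A_def event_rows_def mem_Collect_eq using star[of \<omega>] rows[of \<omega>] by blast
  qed
qed

lemma bij_betw_event_A:
  assumes "\<And>i. i \<in> {1..k} \<Longrightarrow> i \<le> m i \<and> m i \<le> N"
  shows "bij_betw (\<lambda>\<omega>. rows_list N (collection_rows N \<omega>)) (event_A N k m) (event_rows N k m 1)"
proof (rule bij_betw_imageI)
  let ?g = "\<lambda>\<omega>. rows_list N (collection_rows N \<omega>)"
  show "inj_on ?g (event_A N k m)"
    by (rule inj_on_subset[OF bij_betw_imp_inj_on[OF bij_betw_rows_list]]) (auto simp: event_A_def)
  have "event_rows N k m 1 \<subseteq> ?g ` paths_P N"
    unfolding bij_betw_imp_surj_on[OF bij_betw_rows_list] by (auto simp: event_rows_def)
  moreover have "event_A N k m = {\<omega> \<in> paths_P N. ?g \<omega> \<in> event_rows N k m 1}"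
    by (rule event_A_eq_event_rows) (rule assms)
  ultimately show "?g ` event_A N k m = event_rows N k m 1" by blast
qed

context generic_spin
begin

lemma weight_f_eq_term_f:
  assumes "\<omega> \<in> paths_P N" "1 \<le> N" "\<And>j. j \<in> {1..N} \<Longrightarrow> s * z j \<noteq> 1"
  shows "weight_f s q N f z \<omega> = term_f f z (rows_list N (collection_rows N \<omega>))"
  using collection_weight_rows[OF assms(1,3)] row_signature_paths_P(1)[OF assms(1,2) order_refl]
    top_row_drop_collection[of N N \<omega>]
  by (simp add: weight_f_def term_f_def)

lemma partition_fun_eq_rows_sum:
  assumes "1 \<le> N" "\<And>j. j \<in> {1..N} \<Longrightarrow> s * z j \<noteq> 1"
  shows "partition_fun s q N f z = rows_sum f (row_lists N) z"
proof -
  have "partition_fun s q N f z = (\<Sum>\<^sub>\<infinity>\<omega>\<in>paths_P N. term_f f z (rows_list N (collection_rows N \<omega>)))"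
    unfolding partition_fun_def by (intro infsum_cong weight_f_eq_term_f assms)
  then show ?thesis
    unfolding rows_sum_def infsum_reindex_bij_betw[OF bij_betw_rows_list] .
qed

lemma event_weight_eq_rows_sum:
  assumes "1 \<le> N" "\<And>j. j \<in> {1..N} \<Longrightarrow> s * z j \<noteq> 1" "\<And>i. i \<in> {1..k} \<Longrightarrow> i \<le> m i \<and> m i \<le> N"
  shows "event_weight s q N f k m z = rows_sum f (event_rows N k m 1) z"
proof -
  have "event_weight s q N f k m z = (\<Sum>\<^sub>\<infinity>\<omega>\<in>event_A N k m. term_f f z (rows_list N (collection_rows N \<omega>)))"
    unfolding event_weight_def by (intro infsum_cong weight_f_eq_term_f assms) (auto simp: event_A_def)
  also have "\<dots> = (\<Sum>\<^sub>\<infinity>rs\<in>event_rows N k m 1. term_f f z rs)"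
    by (rule infsum_reindex_bij_betw, rule bij_betw_event_A) (rule assms(3))
  finally show ?thesis unfolding rows_sum_def .
qed

end

context dominated_series
begin

text \<open>Condition \<open>l\<close> reads row \<open>m l\<close>, which lies above the cut or is
  the row at the cut; neither changes when the lower rows are replaced.\<close>

lemma lower_rows_free_event_rows:
  assumes "n \<le> N" "\<And>l. l \<in> {i..k} \<Longrightarrow> n \<le> m l"
  shows "lower_rows_free n (event_rows N k m i)"
  unfolding lower_rows_free_def
proof (intro ballI impI)
  fix rs ls assume rs: "rs \<in> event_rows N k m i" and ls: "ls \<in> row_lists n" "top_row ls = top_row (drop (N - n) rs)"
  let ?us = "take (N - n) rs"
  have len: "length rs = N" "length ?us = N - n" "length ls = n" and int: "interlaced_list rs" "interlaced_list ls"
    using rs ls by (auto simp: event_rows_def row_lists_def)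
  have "interlaced_list (?us @ drop (N - n) rs)" using int by simp
  then have "?us @ ls \<in> row_lists N"
    using int len ls(2) assms(1) interlaced_list_append_cong[of ?us "drop (N - n) rs" ls] by (simp add: row_lists_def)
  moreover have "top_row (drop (N - m l) (?us @ ls)) = top_row (drop (N - m l) rs)" if l: "l \<in> {i..k}" for l
  proof -
    have "N - m l \<le> length ?us" using assms(2)[OF l] len by simp
    then have *: "drop (N - m l) (?us @ xs) = drop (N - m l) ?us @ xs" for xs
      unfolding drop_append by (simp only: diff_is_0_eq[THEN iffD2] drop_0)
    have "top_row (drop (N - m l) (?us @ ls)) = top_row (drop (N - m l) (?us @ drop (N - n) rs))"
      unfolding * top_row_append ls(2) ..
    then show ?thesis by simp
  qed
  ultimately show "?us @ ls \<in> event_rows N k m i" using rs by (simp add: event_rows_def)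
qed

text \<open>Downward induction on \<open>i\<close>, from the innermost operator outwards. It must
  hold for all \<open>z\<close> in the region, since the next operator evaluates the result at
  specialized points; \<open>m_n <= m_l\<close> for \<open>l > n\<close> makes the event free below
  level \<open>m_n\<close>.\<close>

lemma D_product_rows_sum:
  assumes m: "mono_on {1..k} m" "\<And>i. i \<in> {1..k} \<Longrightarrow> i \<le> m i \<and> m i \<le> N"
    and g: "\<And>z. z \<in> region N w \<Longrightarrow> g z = rows_sum f (row_lists N) z"
    and i: "1 \<le> i" "i \<le> k + 1" and z: "z \<in> region N w"
  shows "foldr (\<lambda>i. D_op s q i (m i)) [i..<k + 1] g z = rows_sum f (event_rows N k m i) z"
  using i(2) z
proof (induction i arbitrary: z rule: inc_induct)
  case base
  have "event_rows N k m (k + 1) = row_lists N" by (auto simp: event_rows_def)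
  then show ?case using g[OF base] by simp
next
  case (step n)
  then have n: "n \<in> {1..k}" using i(1) by auto
  have A: "event_rows N k m (Suc n) \<subseteq> row_lists N" by (auto simp: event_rows_def)
  have free: "lower_rows_free (m n) (event_rows N k m (Suc n))"
    using m n by (intro lower_rows_free_event_rows) (auto simp: mono_on_def)
  have "foldr (\<lambda>i. D_op s q i (m i)) [n..<k + 1] g z
      = D_op s q n (m n) (foldr (\<lambda>i. D_op s q i (m i)) [Suc n..<k + 1] g) z"
    using n by (simp add: upt_conv_Cons del: upt_Suc)
  also have "\<dots> = rows_sum f {rs \<in> event_rows N k m (Suc n). {..<n} \<subseteq> top_row (drop (N - m n) rs)} z"
    using m(2)[OF n] n by (intro D_op_rows_sum[OF step.prems A free] step.IH) auto
  also have "{rs \<in> event_rows N k m (Suc n). {..<n} \<subseteq> top_row (drop (N - m n) rs)} = event_rows N k m n"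
  proof -
    have "{n..k} = insert n {Suc n..k}" using n by auto
    then show ?thesis by (auto simp: event_rows_def)
  qed
  finally show ?case .
qed

end

theorem lemma3p6:
  fixes s q :: complex and N k :: nat and u :: "nat \<Rightarrow> complex"
    and f :: "nat list \<Rightarrow> real" and m :: "nat \<Rightarrow> nat"
  assumes s_generic: "s \<noteq> 0" "s\<^sup>2 \<noteq> 1" "\<And>j. j \<in> {1..N} \<Longrightarrow> s * u j \<noteq> 1"
    and q_eq: "q = 1 / s\<^sup>2"
    and u_distinct: "inj_on u {1..N}"
    and f_support: "\<And>l. l \<in> Sign N \<Longrightarrow> f l \<noteq> 0 \<Longrightarrow> distinct l"
    and abs_summable: "\<forall>\<^sub>F z in nhds u. (\<lambda>\<omega>. norm (weight_f s q N f z \<omega>)) summable_on paths_P N"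
    and nonneg: "\<And>\<omega>. \<omega> \<in> paths_P N \<Longrightarrow> 0 \<le> weight_f s q N f u \<omega>"
    and pos: "0 < partition_fun s q N f u"
    and k_range: "k \<in> {1..N}"
    and m_mono: "mono_on {1..k} m"
    and m_range: "\<And>i. i \<in> {1..k} \<Longrightarrow> i \<le> m i \<and> m i \<le> N"
  shows "complex_of_real (measure (prob_f s q N f u) (event_A N k m))
           = event_weight s q N f k m u / partition_fun s q N f u \<and>
         event_weight s q N f k m u / partition_fun s q N f u
           = D_product s q k m (partition_fun s q N f) u / partition_fun s q N f u"
proof
  define W where "W = weight_f s q N f u"
  define Z where "Z = partition_fun s q N f u"
  define p where "p \<omega> = Re (W \<omega> / Z)" for \<omega>
  have real: "Im Z = 0" "0 < Re Z" using pos by (auto simp: Z_def less_complex_def)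
  have W: "W \<omega> = complex_of_real (Re (W \<omega>))" "0 \<le> Re (W \<omega>)" if "\<omega> \<in> paths_P N" for \<omega>
    using nonneg[OF that] by (auto simp: W_def less_eq_complex_def complex_eq_iff)
  have Z: "Z = complex_of_real (Re Z)" using real by (simp add: complex_eq_iff)
  \<comment> \<open>The weights and their total are nonnegative reals, so \<open>Re\<close> in
    \<open>prob_f\<close> loses nothing.\<close>
  have p: "W \<omega> / Z = complex_of_real (p \<omega>)" "0 \<le> p \<omega>" if "\<omega> \<in> paths_P N" for \<omega>
  proof -
    have "W \<omega> / Z = complex_of_real (Re (W \<omega>) / Re Z)" using W(1)[OF that] Z by (metis of_real_divide)
    then show "W \<omega> / Z = complex_of_real (p \<omega>)" "0 \<le> p \<omega>"
      using W(2)[OF that] real(2) by (simp_all add: p_def)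
  qed
  have sub: "event_A N k m \<subseteq> paths_P N" by (auto simp: event_A_def)
  have sumW: "(\<lambda>\<omega>. norm (W \<omega>)) summable_on paths_P N"
    unfolding W_def using abs_summable by (rule eventually_nhds_x_imp_x)
  have "norm (p \<omega>) = norm (W \<omega>) * (1 / norm Z)" if "\<omega> \<in> paths_P N" for \<omega>
    using arg_cong[OF p(1)[OF that], of norm] by (simp add: norm_divide)
  then have "(\<lambda>\<omega>. norm (p \<omega>)) summable_on paths_P N \<longleftrightarrow> (\<lambda>\<omega>. norm (W \<omega>) * (1 / norm Z)) summable_on paths_P N"
    by (rule summable_on_cong)
  then have sump: "(\<lambda>\<omega>. norm (p \<omega>)) summable_on paths_P N"
    using summable_on_cmult_left[OF sumW, of "1 / norm Z"] by blast
  have "measure (prob_f s q N f u) (event_A N k m) = (\<Sum>\<^sub>\<infinity>\<omega>\<in>event_A N k m. p \<omega>)"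
    unfolding prob_f_def W_def[symmetric] Z_def[symmetric] p_def[symmetric]
    by (rule measure_point_measure_infsum[OF p(2) sump sub])
  also have "complex_of_real \<dots> = (\<Sum>\<^sub>\<infinity>\<omega>\<in>event_A N k m. complex_of_real (p \<omega>))"
    by (rule infsumI[OF has_sum_of_real[OF has_sum_infsum], symmetric])
      (rule summable_on_subset_banach[OF abs_summable_summable[OF sump] sub])
  also have "\<dots> = (\<Sum>\<^sub>\<infinity>\<omega>\<in>event_A N k m. W \<omega> * (1 / Z))"
    using p(1) sub by (intro infsum_cong) auto
  also have "\<dots> = event_weight s q N f k m u / Z"
    unfolding event_weight_def W_def[symmetric] by (subst infsum_cmult_left') simp
  finally show "complex_of_real (measure (prob_f s q N f u) (event_A N k m))
      = event_weight s q N f k m u / partition_fun s q N f u" unfolding Z_def .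
next
  interpret generic_spin s q by unfold_locales (use s_generic q_eq in auto)
  have N: "1 \<le> N" using k_range by auto
  \<comment> \<open>The assumed convergence near \<open>u\<close> supplies the dominating point; all
    later convergence is derived from this single one.\<close>
  obtain w where dom: "(\<lambda>\<omega>. norm (weight_f s q N f w \<omega>)) summable_on paths_P N" "u \<in> region N w"
    "\<And>j. j \<in> {1..N} \<Longrightarrow> s * w j \<noteq> 1 \<and> emit (w j) \<noteq> 0"
    using exists_dominating_point[OF s_generic(3) abs_summable] by blast
  have "weight_f s q N f w \<omega> = term_f f w (rows_list N (collection_rows N \<omega>))" if "\<omega> \<in> paths_P N" for \<omega>
    by (rule weight_f_eq_term_f[OF that N]) (simp add: dom(3))
  then have "(\<lambda>\<omega>. norm (term_f f w (rows_list N (collection_rows N \<omega>)))) summable_on paths_P N"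
    using dom(1) by (simp cong: summable_on_cong)
  then have "(\<lambda>rs. norm (term_f f w rs)) summable_on row_lists N"
    by (subst summable_on_reindex_bij_betw[OF bij_betw_rows_list, symmetric])
  then interpret dominated_series s q N w f
    by unfold_locales (use dom(3) in auto)
  have "D_product s q k m (partition_fun s q N f) u = rows_sum f (event_rows N k m 1) u"
    unfolding D_product_def
    using m_mono m_range N dom(2)
    by (intro D_product_rows_sum) (auto simp: region_def intro!: partition_fun_eq_rows_sum)
  also have "\<dots> = event_weight s q N f k m u"
    using event_weight_eq_rows_sum[OF N s_generic(3) m_range] by simp
  finally show "event_weight s q N f k m u / partition_fun s q N f u
      = D_product s q k m (partition_fun s q N f) u / partition_fun s q N f u" by simp
qed

end
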